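(* Let $S=\mathbb{A}^2_{\mathbb{C}}=\operatorname{Spec}R$ with $R=\mathbb{C}[x,y]$, and let $(J,p)\in S^{[n]}\times S$. The fibre of $$\phi:S^{[n,n+1]}\to S^{[n]}\times S,\qquad \phi(I\subset J)=(J,\operatorname{res}(I,J)),$$ over $(J,p)$ is naturally $$\mathbb{P}(J(p)^\vee),\qquad J(p)=J\otimes_R R/\mathfrak{m}_p\cong J/\mathfrak{m}_pJ,$$ where $\mathbb{P}(V)$ denotes the projective space of lines in $V$. Equivalently, the fibre is the projective space of one-dimensional quotients of $J(p)$.
   Context: All schemes are over $\mathbb{C}$. $S^{[n]}=\operatorname{Hilb}^n(S)$ is the Hilbert scheme of $n$ points; its closed points are ideals of $R$ of colength $n$. The nested Hilbert scheme $S^{[n,n+1]}\subset S^{[n+1]}\times S^{[n]}$ is the closed incidence subscheme of pairs $(Z,Y)$ with $Y\subset Z$; its closed points are pairs of ideals $I\subset J\subset R$ with $\dim_{\mathbb{C}}R/I=n+1$, $\dim_{\mathbb{C}}R/J=n$. For such a pair, $J/I$ is an $R$-module of length one, so $J/I\cong R/\mathfrak{m}_p$ for a unique closed point $p\in S$; this $p$ is the residual point $\operatorname{res}(I,J)$. (In families over a base $B$, the quotient of the two ideal sheaves is an invertible $\mathcal{O}_B$-module on which $R$ acts through a ring map $R\to\mathcal{O}_B(B)$, giving the residual morphism $B\to S$.) $\mathfrak{m}_p\subset R$ denotes the maximal ideal of the closed point $p\in S$, and $V^\vee$ the dual of a vector space $V$. *)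

theory Defs
  imports
    "HOL-Algebra.Algebraic_Closure_Type"
    "HOL-Algebra.Module"
    "HOL-Algebra.Ideal_Product"
    "HOL-Library.Poly_Mapping"
begin

text \<open>
  Schemes over the complex numbers are represented by their functors of points on commutative
  \<open>\<complex>\<close>-algebras: a \<open>\<complex>\<close>-algebra is a type \<open>'a\<close> of class \<^class>\<open>comm_ring_1\<close> together with a ring
  homomorphism \<open>\<iota> :: complex \<Rightarrow> 'a\<close>. A scheme is determined by this functor, and a morphism of
  schemes is the same as a natural transformation. The zero ring is not an instance of
  \<^class>\<open>comm_ring_1\<close>; nothing is lost, as every scheme has exactly one point over it.

  \<open>A[x,y]\<close> is \<open>'a poly poly\<close>: the variable of the coefficient polynomials is \<open>x\<close>, that of the
  outer polynomials is \<open>y\<close>.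
\<close>

abbreviation rng :: "'a::comm_ring_1 ring"
  where "rng \<equiv> ring_of_type_algebra"

section \<open>Modules\<close>

text \<open>A subset \<open>N\<close> of a ring as a module over another ring, acting through \<open>h\<close>. The fields
  \<open>mult\<close> and \<open>one\<close> of a module record are never used.\<close>

definition as_module :: "('a::comm_ring_1 \<Rightarrow> 'b::comm_ring_1) \<Rightarrow> 'b set \<Rightarrow> ('a, 'b) module" where
  "as_module h N =
     \<lparr>carrier = N, monoid.mult = undefined, one = undefined, ring.zero = 0, add = (+),
      module.smult = (\<lambda>a x. h a * x)\<rparr>"

definition quotient_module :: "('a::comm_ring_1, 'm) module \<Rightarrow> 'm set \<Rightarrow> ('a, 'm set) module" where
  "quotient_module M K =
     \<lparr>carrier = a_rcosets\<^bsub>M\<^esub> K, monoid.mult = undefined, one = undefined, ring.zero = K,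
      add = set_add M,
      module.smult = (\<lambda>a U. set_add M K ((\<lambda>x. a \<odot>\<^bsub>M\<^esub> x) ` U))\<rparr>"

definition submodule_span :: "('a::comm_ring_1, 'm) module \<Rightarrow> 'm set \<Rightarrow> 'm set" where
  "submodule_span M S = \<Inter>{H. submodule H (rng :: 'a ring) M \<and> S \<subseteq> H}"

definition module_iso ::
    "('m \<Rightarrow> 'n) \<Rightarrow> ('a::comm_ring_1, 'm) module \<Rightarrow> ('a, 'n) module \<Rightarrow> bool" where
  "module_iso \<psi> M N \<longleftrightarrow>
     bij_betw \<psi> (carrier M) (carrier N) \<and>
     (\<forall>x\<in>carrier M. \<forall>y\<in>carrier M. \<psi> (x \<oplus>\<^bsub>M\<^esub> y) = \<psi> x \<oplus>\<^bsub>N\<^esub> \<psi> y) \<and>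
     (\<forall>a. \<forall>x\<in>carrier M. \<psi> (a \<odot>\<^bsub>M\<^esub> x) = a \<odot>\<^bsub>N\<^esub> \<psi> x)"

definition free_of_rank :: "('a::comm_ring_1, 'm) module \<Rightarrow> nat \<Rightarrow> bool" where
  "free_of_rank M r \<longleftrightarrow>
     (\<exists>e \<in> {..<r} \<rightarrow> carrier M. \<forall>m\<in>carrier M.
        \<exists>!c. c \<in> extensional {..<r} \<and> m = (\<Oplus>\<^bsub>M\<^esub>i\<in>{..<r}. c i \<odot>\<^bsub>M\<^esub> e i))"

text \<open>Zariski-local freeness: there are finitely many \<open>s\<close> generating the unit ideal such that each
  localisation \<open>M[1/s]\<close> is free of rank \<open>r\<close> over \<open>A[1/s]\<close>. Multiplying by a power of \<open>s\<close>, a basis of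
  \<open>M[1/s]\<close> may be taken in the image of \<open>M\<close>; the two conditions below say that \<open>e\<^sub>0/1, e\<^sub>1/1, \<dots>\<close>
  generate \<open>M[1/s]\<close> and are linearly independent, with denominators cleared.\<close>

definition locally_free :: "('a::comm_ring_1, 'm) module \<Rightarrow> nat \<Rightarrow> bool" where
  "locally_free M r \<longleftrightarrow>
     (\<exists>F. finite F \<and> 1 \<in> genideal (rng :: 'a ring) F \<and>
        (\<forall>s\<in>F. \<exists>e \<in> {..<r} \<rightarrow> carrier M.
           (\<forall>m\<in>carrier M. \<exists>k c. (s ^ k) \<odot>\<^bsub>M\<^esub> m = (\<Oplus>\<^bsub>M\<^esub>i\<in>{..<r}. c i \<odot>\<^bsub>M\<^esub> e i)) \<and>
           (\<forall>c. (\<Oplus>\<^bsub>M\<^esub>i\<in>{..<r}. c i \<odot>\<^bsub>M\<^esub> e i) = \<zero>\<^bsub>M\<^esub> \<longrightarrow> (\<exists>k. \<forall>i<r. s ^ k * c i = 0))))"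

definition dual_module :: "('a::comm_ring_1, 'm) module \<Rightarrow> ('a, 'm \<Rightarrow> 'a) module" where
  "dual_module M =
     \<lparr>carrier = {l \<in> extensional (carrier M).
        (\<forall>x\<in>carrier M. \<forall>y\<in>carrier M. l (x \<oplus>\<^bsub>M\<^esub> y) = l x + l y) \<and>
        (\<forall>a. \<forall>x\<in>carrier M. l (a \<odot>\<^bsub>M\<^esub> x) = a * l x)},
      monoid.mult = undefined, one = undefined,
      ring.zero = (\<lambda>x\<in>carrier M. 0),
      add = (\<lambda>l l'. \<lambda>x\<in>carrier M. l x + l' x),
      module.smult = (\<lambda>a l. \<lambda>x\<in>carrier M. a * l x)\<rparr>"

section \<open>Base change of modules\<close>

text \<open>For a ring homomorphism \<open>h : A \<rightarrow> B\<close> and an \<open>A\<close>-module \<open>M\<close>, the \<open>B\<close>-module \<open>M \<otimes>\<^sub>A B\<close> is the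
  free \<open>B\<close>-module on the set \<open>M\<close> modulo the relations making \<open>x \<mapsto> x \<otimes> 1\<close> additive and
  \<open>h\<close>-semilinear.\<close>

definition free_module_on :: "'m set \<Rightarrow> ('b::comm_ring_1, 'm \<Rightarrow>\<^sub>0 'b) module" where
  "free_module_on U =
     \<lparr>carrier = {c. Poly_Mapping.keys c \<subseteq> U}, monoid.mult = undefined, one = undefined,
      ring.zero = 0, add = (+), module.smult = (\<lambda>b. Poly_Mapping.map ((*) b))\<rparr>"

definition tensor_relations ::
    "('a::comm_ring_1 \<Rightarrow> 'b::comm_ring_1) \<Rightarrow> ('a, 'm) module \<Rightarrow> ('m \<Rightarrow>\<^sub>0 'b) set" where
  "tensor_relations h M =
     submodule_span (free_module_on (carrier M))
       ({Poly_Mapping.single (x \<oplus>\<^bsub>M\<^esub> y) 1 - Poly_Mapping.single x 1 - Poly_Mapping.single y 1 |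
           x y. x \<in> carrier M \<and> y \<in> carrier M} \<union>
        {Poly_Mapping.single (a \<odot>\<^bsub>M\<^esub> x) 1 - Poly_Mapping.single x (h a) | a x. x \<in> carrier M})"

definition base_change ::
    "('a::comm_ring_1 \<Rightarrow> 'b::comm_ring_1) \<Rightarrow> ('a, 'm) module \<Rightarrow> ('b, ('m \<Rightarrow>\<^sub>0 'b) set) module" where
  "base_change h M = quotient_module (free_module_on (carrier M)) (tensor_relations h M)"

text \<open>The element \<open>x \<otimes> 1\<close>.\<close>

definition tensor_one ::
    "('a::comm_ring_1 \<Rightarrow> 'b::comm_ring_1) \<Rightarrow> ('a, 'm) module \<Rightarrow> 'm \<Rightarrow> ('m \<Rightarrow>\<^sub>0 'b) set" where
  "tensor_one h M x =
     a_r_coset (free_module_on (carrier M) :: ('b, 'm \<Rightarrow>\<^sub>0 'b) module) (tensor_relations h M)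
       (Poly_Mapping.single x 1)"

text \<open>The map \<open>\<Sum> x\<^sub>i \<otimes> b\<^sub>i \<mapsto> \<Sum> f(b\<^sub>i) t(x\<^sub>i)\<close> from \<open>M \<otimes>\<^sub>A B\<close> to a \<open>B'\<close>-module \<open>N\<close>, where
  \<open>f : B \<rightarrow> B'\<close>. It is independent of the chosen representative whenever \<open>t\<close> is additive and
  semilinear with respect to \<open>A \<rightarrow> B \<rightarrow> B'\<close>, as in all uses below.\<close>

definition tensor_lift ::
    "('b::comm_ring_1 \<Rightarrow> 'b'::comm_ring_1) \<Rightarrow> ('b', 'n) module \<Rightarrow> ('m \<Rightarrow> 'n)
      \<Rightarrow> ('m \<Rightarrow>\<^sub>0 'b) set \<Rightarrow> 'n" where
  "tensor_lift f N t U =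
     (let c = (SOME c. c \<in> U)
      in (\<Oplus>\<^bsub>N\<^esub>x\<in>Poly_Mapping.keys c. f (Poly_Mapping.lookup c x) \<odot>\<^bsub>N\<^esub> t x))"

section \<open>Projective spaces\<close>

text \<open>\<open>A\<close>-points of the projective space of lines in \<open>V\<close>: the locally free rank one direct summands
  of \<open>V \<otimes> A\<close>. For \<open>A = \<complex>\<close> these are the one-dimensional subspaces of \<open>V\<close>.\<close>

definition proj_lines ::
    "(complex \<Rightarrow> 'a::comm_ring_1) \<Rightarrow> (complex, 'v) module \<Rightarrow> ('v \<Rightarrow>\<^sub>0 'a) set set set" where
  "proj_lines \<iota> V =
     {L. submodule L (rng :: 'a ring) (base_change \<iota> V) \<and>
         locally_free ((base_change \<iota> V)\<lparr>carrier := L\<rparr>) 1 \<and>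
         (\<exists>L'. submodule L' (rng :: 'a ring) (base_change \<iota> V) \<and>
            L \<inter> L' = {\<zero>\<^bsub>base_change \<iota> V\<^esub>} \<and>
            set_add (base_change \<iota> V) L L' = carrier (base_change \<iota> V))}"

text \<open>\<open>A\<close>-points of the projective space of one-dimensional quotients of \<open>V\<close>: invertible quotients of
  \<open>V \<otimes> A\<close>, each given by its kernel.\<close>

definition proj_quotients ::
    "(complex \<Rightarrow> 'a::comm_ring_1) \<Rightarrow> (complex, 'v) module \<Rightarrow> ('v \<Rightarrow>\<^sub>0 'a) set set set" where
  "proj_quotients \<iota> V =
     {K. submodule K (rng :: 'a ring) (base_change \<iota> V) \<and>
         locally_free (quotient_module (base_change \<iota> V) K) 1}"

text \<open>Functoriality of both in the \<open>\<complex>\<close>-algebra: the submodule of \<open>V \<otimes> B\<close> generated by the image of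
  \<open>L \<subseteq> V \<otimes> A\<close> under \<open>V \<otimes> f\<close>, for \<open>f : A \<rightarrow> B\<close>.\<close>

definition pull_submodule ::
    "(complex \<Rightarrow> 'a::comm_ring_1) \<Rightarrow> ('a \<Rightarrow> 'b::comm_ring_1) \<Rightarrow> (complex, 'v) module
      \<Rightarrow> ('v \<Rightarrow>\<^sub>0 'a) set set \<Rightarrow> ('v \<Rightarrow>\<^sub>0 'b) set set" where
  "pull_submodule \<iota> f V L =
     submodule_span (base_change (f \<circ> \<iota>) V)
       (tensor_lift f (base_change (f \<circ> \<iota>) V) (tensor_one (f \<circ> \<iota>) V) ` L)"

text \<open>The pairing of \<open>V\<^sup>\<or> \<otimes> A\<close> with \<open>V \<otimes> A\<close>, \<open>(l \<otimes> a, v \<otimes> b) \<mapsto> a b \<iota>(l(v))\<close>.\<close>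

definition dual_pairing ::
    "(complex \<Rightarrow> 'a::comm_ring_1) \<Rightarrow> (('v \<Rightarrow> complex) \<Rightarrow>\<^sub>0 'a) set \<Rightarrow> ('v \<Rightarrow>\<^sub>0 'a) set \<Rightarrow> 'a" where
  "dual_pairing \<iota> \<Lambda> U =
     tensor_lift id (as_module id UNIV)
       (\<lambda>l. tensor_lift id (as_module id UNIV) (\<lambda>v. \<iota> (l v)) U) \<Lambda>"

definition annihilator ::
    "(complex \<Rightarrow> 'a::comm_ring_1) \<Rightarrow> (complex, 'v) module \<Rightarrow> ('v \<Rightarrow>\<^sub>0 'a) set set
      \<Rightarrow> (('v \<Rightarrow> complex) \<Rightarrow>\<^sub>0 'a) set set" where
  "annihilator \<iota> V K =
     {\<Lambda> \<in> carrier (base_change \<iota> (dual_module V)). \<forall>U\<in>K. dual_pairing \<iota> \<Lambda> U = 0}"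

section \<open>The plane and its (nested) Hilbert schemes\<close>

definition const2 :: "'a::comm_ring_1 \<Rightarrow> 'a poly poly" where
  "const2 a = [:[:a:]:]"

definition map_coeffs :: "('a::comm_ring_1 \<Rightarrow> 'b::comm_ring_1) \<Rightarrow> 'a poly poly \<Rightarrow> 'b poly poly" where
  "map_coeffs f = map_poly (map_poly f)"

text \<open>Pullback along \<open>f : A \<rightarrow> B\<close> of the closed subscheme of the plane over \<open>A\<close> given by \<open>I\<close>.\<close>

definition extend_ideal ::
    "('a::comm_ring_1 \<Rightarrow> 'b::comm_ring_1) \<Rightarrow> 'a poly poly set \<Rightarrow> 'b poly poly set" where
  "extend_ideal f I = genideal rng (map_coeffs f ` I)"

text \<open>\<open>A\<close>-points of \<open>S = Spec R\<close>: the \<open>\<complex>\<close>-algebra homomorphisms \<open>R \<rightarrow> A\<close>.\<close>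

definition plane_points ::
    "(complex \<Rightarrow> 'a::comm_ring_1) \<Rightarrow> (complex poly poly \<Rightarrow> 'a) set" where
  "plane_points \<iota> = {\<rho> \<in> ring_hom rng rng. \<forall>c. \<rho> (const2 c) = \<iota> c}"

text \<open>The closed point \<open>p = (a, b)\<close> of \<open>S\<close> as a homomorphism \<open>R \<rightarrow> \<complex>\<close>; it induces
  \<open>R / \<mm>\<^sub>p \<cong> \<complex>\<close>.\<close>

definition eval_at :: "complex \<times> complex \<Rightarrow> complex poly poly \<Rightarrow> complex" where
  "eval_at p g = poly (poly g [:snd p:]) (fst p)"

definition max_ideal :: "complex \<times> complex \<Rightarrow> complex poly poly set" where
  "max_ideal p = a_kernel (rng :: complex poly poly ring) (rng :: complex ring) (eval_at p)"

text \<open>Closed points of the Hilbert scheme: ideals of \<open>R\<close> of colength \<open>n\<close>.\<close>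

definition hilb_closed_points :: "nat \<Rightarrow> complex poly poly set set" where
  "hilb_closed_points n =
     {J. ideal J rng \<and> free_of_rank (quotient_module (as_module const2 UNIV) J) n}"

text \<open>\<open>A\<close>-points of the Hilbert scheme: closed subschemes of the plane over \<open>A\<close>, finite locally free
  of degree \<open>n\<close> over \<open>A\<close>.\<close>

definition hilb :: "nat \<Rightarrow> 'a::comm_ring_1 poly poly set set" where
  "hilb n =
     {I. ideal I rng \<and>
         locally_free (quotient_module (as_module (const2 :: 'a \<Rightarrow> _) UNIV) I) n}"

definition nested_hilb :: "nat \<Rightarrow> ('a::comm_ring_1 poly poly set \<times> 'a poly poly set) set" where
  "nested_hilb n = {(I, J). I \<in> hilb (n + 1) \<and> J \<in> hilb n \<and> I \<subseteq> J}"

text \<open>The ring map \<open>R \<rightarrow> A\<close> through which \<open>R\<close> acts on the invertible \<open>A\<close>-module \<open>J/I\<close>.\<close>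

definition residual ::
    "(complex \<Rightarrow> 'a::comm_ring_1) \<Rightarrow> 'a poly poly set \<Rightarrow> 'a poly poly set
      \<Rightarrow> (complex poly poly \<Rightarrow> 'a)" where
  "residual \<iota> I J =
     (THE \<rho>. \<rho> \<in> plane_points \<iota> \<and>
        (\<forall>r. \<forall>g\<in>J. map_coeffs \<iota> r * g - const2 (\<rho> r) * g \<in> I))"

definition phi ::
    "(complex \<Rightarrow> 'a::comm_ring_1) \<Rightarrow> 'a poly poly set \<times> 'a poly poly set
      \<Rightarrow> 'a poly poly set \<times> (complex poly poly \<Rightarrow> 'a)" where
  "phi \<iota> = (\<lambda>(I, J). (J, residual \<iota> I J))"

text \<open>\<open>A\<close>-points of the scheme-theoretic fibre of \<open>\<phi>\<close> over \<open>(J, p)\<close>, i.e. of the fibre product with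
  \<open>Spec \<complex>\<close>: the points of the nested Hilbert scheme that \<open>\<phi>\<close> maps to the constant point
  \<open>Spec A \<rightarrow> Spec \<complex> \<rightarrow> S\<^sup>[\<^sup>n\<^sup>] \<times> S\<close>.\<close>

definition fibre ::
    "(complex \<Rightarrow> 'a::comm_ring_1) \<Rightarrow> nat \<Rightarrow> complex poly poly set \<Rightarrow> complex \<times> complex
      \<Rightarrow> ('a poly poly set \<times> 'a poly poly set) set" where
  "fibre \<iota> n J p = {Q \<in> nested_hilb n. phi \<iota> Q = (extend_ideal \<iota> J, \<iota> \<circ> eval_at p)}"

definition pull_flag ::
    "('a::comm_ring_1 \<Rightarrow> 'b::comm_ring_1) \<Rightarrow> 'a poly poly set \<times> 'a poly poly set
      \<Rightarrow> 'b poly poly set \<times> 'b poly poly set" where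
  "pull_flag f = (\<lambda>(I, J). (extend_ideal f I, extend_ideal f J))"

section \<open>The fibre of an ideal at a point and the comparison maps\<close>

text \<open>\<open>J(p) = J \<otimes>\<^sub>R R/\<mm>\<^sub>p\<close> as a complex vector space, with \<open>R/\<mm>\<^sub>p\<close> identified with \<open>\<complex>\<close>.\<close>

definition ideal_fibre ::
    "complex poly poly set \<Rightarrow> complex \<times> complex
      \<Rightarrow> (complex, (complex poly poly \<Rightarrow>\<^sub>0 complex) set) module" where
  "ideal_fibre J p = base_change (eval_at p) (as_module id J)"

definition restrict_to_fibre ::
    "complex poly poly set \<Rightarrow> complex \<times> complex \<Rightarrow> complex poly poly
      \<Rightarrow> (complex poly poly \<Rightarrow>\<^sub>0 complex) set" where
  "restrict_to_fibre J p g = tensor_one (eval_at p) (as_module id J) g"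

text \<open>\<open>J \<otimes>\<^sub>\<complex> A\<close> maps to \<open>A[x,y]\<close> by \<open>g \<otimes> a \<mapsto> a g\<close>, injectively and with image the extended ideal
  \<open>J\<^sub>A\<close>, and to \<open>J(p) \<otimes>\<^sub>\<complex> A\<close> by \<open>g \<otimes> a \<mapsto> g(p) \<otimes> a\<close>. A flag \<open>I \<subseteq> J\<^sub>A\<close> in the fibre is
  sent to the image of \<open>I\<close> in \<open>J(p) \<otimes>\<^sub>\<complex> A\<close>, i.e. to the kernel of \<open>J(p) \<otimes>\<^sub>\<complex> A \<rightarrow> J\<^sub>A/I\<close>.\<close>

definition flag_to_quotient ::
    "(complex \<Rightarrow> 'a::comm_ring_1) \<Rightarrow> complex poly poly set \<Rightarrow> complex \<times> complex
      \<Rightarrow> 'a poly poly set \<times> 'a poly poly set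
      \<Rightarrow> ((complex poly poly \<Rightarrow>\<^sub>0 complex) set \<Rightarrow>\<^sub>0 'a) set set" where
  "flag_to_quotient \<iota> J p Q =
     tensor_lift id (base_change \<iota> (ideal_fibre J p))
         (\<lambda>g. tensor_one \<iota> (ideal_fibre J p) (restrict_to_fibre J p g)) `
       {w \<in> carrier (base_change \<iota> (as_module const2 J)).
          tensor_lift id (as_module const2 UNIV) (map_coeffs \<iota>) w \<in> fst Q}"

text \<open>The dual of the quotient \<open>J(p) \<otimes>\<^sub>\<complex> A \<rightarrow> J\<^sub>A/I\<close>, as a submodule of \<open>J(p)\<^sup>\<or> \<otimes>\<^sub>\<complex> A\<close>.\<close>

definition flag_to_line ::
    "(complex \<Rightarrow> 'a::comm_ring_1) \<Rightarrow> complex poly poly set \<Rightarrow> complex \<times> complex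
      \<Rightarrow> 'a poly poly set \<times> 'a poly poly set
      \<Rightarrow> (((complex poly poly \<Rightarrow>\<^sub>0 complex) set \<Rightarrow> complex) \<Rightarrow>\<^sub>0 'a) set set" where
  "flag_to_line \<iota> J p Q = annihilator \<iota> (ideal_fibre J p) (flag_to_quotient \<iota> J p Q)"

end

theory Submission
  imports Defs "HOL-Library.Function_Algebras" "Jordan_Normal_Form.Determinant"
begin

text \<open>
  Write \<open>J\<^sub>A\<close> for the extension of \<open>J\<close> to \<open>A[x,y]\<close> and \<open>\<mm>\<close> for the maximal ideal of \<open>p\<close>. The theorem
  rests on one observation: an \<open>A\<close>-submodule \<open>I\<close> of \<open>J\<^sub>A\<close> belongs to a flag over \<open>(J, p)\<close> exactly when
  \<open>(\<mm>J)\<^sub>A \<subseteq> I\<close> and \<open>J\<^sub>A/I\<close> is invertible. By right exactness \<open>J\<^sub>A/(\<mm>J)\<^sub>A = J(p) \<otimes> A\<close>, so such \<open>I\<close> are the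
  same as kernels of invertible quotients of \<open>J(p) \<otimes> A\<close>.

  If \<open>I\<close> is given by a flag, then \<open>A[x,y]/I\<close> and \<open>A[x,y]/J\<^sub>A\<close> are locally free of ranks \<open>n + 1\<close> and
  \<open>n\<close>, so \<open>J\<^sub>A/I\<close> is invertible (\<open>lf_kernel\<close>, where the only real work is to see that a stably free
  module of rank one is locally generated by one element). An endomorphism of an invertible module
  is multiplication by a unique scalar (\<open>invertible_endomorphism_scalar\<close>), so the residual point
  exists and is unique (\<open>residual_ex1\<close>); that it is \<open>p\<close> says that \<open>\<mm>\<close> kills \<open>J\<^sub>A/I\<close>. Conversely, if
  \<open>(\<mm>J)\<^sub>A \<subseteq> I\<close>, then \<open>A[x,y]\<close> acts on \<open>J\<^sub>A/I\<close> through evaluation at \<open>p\<close>, so \<open>I\<close> is an ideal with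
  residual point \<open>p\<close>, and \<open>A[x,y]/I\<close> is an extension of a locally free module of rank \<open>n\<close> by an
  invertible one (\<open>lf_extension\<close>).

  The space \<open>J(p)\<close> has finite dimension \<open>d\<close>, because an ideal of finite colength is generated
  by finitely many elements modulo \<open>\<mm>J\<close> (\<open>finite_generation_mod_mJ\<close>). After the choice of a basis, \<open>J(p) \<otimes> A\<close> becomes \<open>A\<^sup>d\<close> and
  the map \<open>J\<^sub>A \<rightarrow> J(p) \<otimes> A\<close> becomes a tuple \<open>Lam\<close> of \<open>d\<close> functionals, defined on all of \<open>A[x,y]\<close>. The
  fibre is then the set of preimages under \<open>Lam\<close> of the kernels \<open>K \<subseteq> A\<^sup>d\<close> of invertible quotients
  (\<open>fibre_eq\<close>), and \<open>flag_to_quotient\<close> is \<open>I \<mapsto> Lam(I)\<close>.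

  Quotients of \<open>J(p)\<close> correspond to lines in its dual because \<open>K \<mapsto> K\<^sup>\<bottom>\<close> is a bijection from kernels of
  invertible quotients of \<open>A\<^sup>d\<close> to invertible direct summands. Both sides are encoded in the same
  local data: elements \<open>c \<in> K\<^sup>\<bottom>\<close> and \<open>e \<in> A\<^sup>d\<close> for which \<open>v \<mapsto> (c \<cdot> v) e\<close> is multiplication by
  \<open>\<sigma> = c \<cdot> e\<close> modulo \<open>K\<close>, with the \<open>\<sigma>\<close> generating the unit ideal (\<open>dual_pair\<close>). These data can be
  pushed forward along any \<open>A \<rightarrow> B\<close> (\<open>dual_pair_push\<close>), which gives naturality.
\<close>

hide_const (open) Ring_Hom.ring_hom

section \<open>Zariski-local freeness\<close>

text \<open>For a ring acting on itself, subspaces are ideals and spans are generated ideals.\<close>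

interpretation rg: Modules.module "(*) :: 'a::comm_ring_1 \<Rightarrow> 'a \<Rightarrow> 'a"
  by standard (auto simp: algebra_simps)

text \<open>As a rewrite rule, \<open>scale_scale\<close> for multiplication itself reverses associativity.\<close>

declare rg.scale_scale [simp del]

text \<open>All passages from local to global are instances of this: the radical of an ideal is an ideal, so
  if it contains generators of the unit ideal, then it contains \<open>1\<close>. The ideal is usually the set of
  scalars for which some identity, with denominators cleared, holds.\<close>

lemma local_principle:
  fixes U :: "'a::comm_ring_1 set"
  assumes U: "1 \<in> rg.span U" and A: "rg.subspace A"
    and pow: "\<And>s. s \<in> U \<Longrightarrow> \<exists>k. s ^ k \<in> A"
  shows "1 \<in> A"
proof -
  let ?rad = "{a. \<exists>k. a ^ k \<in> A}"
  have mult: "r * a \<in> A" if "a \<in> A" for r a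
    using rg.subspace_scale[OF A that] .
  have add: "a + b \<in> ?rad" if ab: "a \<in> ?rad" "b \<in> ?rad" for a b
  proof -
    obtain m n where m: "a ^ m \<in> A" and n: "b ^ n \<in> A" using ab by auto
    have "of_nat ((m + n) choose k) * a ^ k * b ^ (m + n - k) \<in> A" if "k \<le> m + n" for k
    proof (cases "m \<le> k")
      case True
      then have "a ^ k = a ^ m * a ^ (k - m)" by (simp flip: power_add)
      then have "of_nat ((m + n) choose k) * a ^ k * b ^ (m + n - k)
          = (of_nat ((m + n) choose k) * a ^ (k - m) * b ^ (m + n - k)) * a ^ m"
        by (simp only: ac_simps)
      then show ?thesis using mult[OF m] by simp
    next
      case False
      then have "b ^ (m + n - k) = b ^ n * b ^ (m - k)" by (simp flip: power_add add: add.commute)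
      then have "of_nat ((m + n) choose k) * a ^ k * b ^ (m + n - k)
          = (of_nat ((m + n) choose k) * a ^ k * b ^ (m - k)) * b ^ n"
        by (simp only: ac_simps)
      then show ?thesis using mult[OF n] by simp
    qed
    then have "(a + b) ^ (m + n) \<in> A"
      unfolding binomial_ring by (intro rg.subspace_sum[OF A]) auto
    then show ?thesis by blast
  qed
  have "rg.subspace ?rad"
  proof (rule rg.subspaceI)
    show "0 \<in> ?rad" using rg.subspace_0[OF A] by (auto intro: exI[of _ 1])
    show "c * x \<in> ?rad" if "x \<in> ?rad" for c x
      using that mult by (auto simp: power_mult_distrib)
  qed (rule add)
  then have "rg.span U \<subseteq> ?rad" using pow by (intro rg.span_minimal) auto
  then show ?thesis using U by auto
qed

lemma cover_product:
  fixes U Y Z :: "'a::comm_ring_1 set"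
  assumes U: "1 \<in> rg.span U" and Y: "1 \<in> rg.span Y"
    and Z: "\<And>s t. s \<in> U \<Longrightarrow> t \<in> Y \<Longrightarrow> \<exists>k. (s * t) ^ k \<in> rg.span Z"
  shows "1 \<in> rg.span Z"
proof (rule local_principle[OF U])
  fix s assume s: "s \<in> U"
  let ?A = "{a. \<exists>k. a * s ^ k \<in> rg.span Z}"
  have "1 \<in> ?A"
  proof (rule local_principle[OF Y])
    show "rg.subspace ?A"
    proof (rule rg.subspaceI)
      show "0 \<in> ?A" by (simp add: rg.span_zero)
      fix x y c assume x: "x \<in> ?A"
      then obtain k where k: "x * s ^ k \<in> rg.span Z" by auto
      show "c * x \<in> ?A" using rg.span_scale[OF k, of c] by (auto simp: ac_simps)
      assume "y \<in> ?A"
      then obtain l where l: "y * s ^ l \<in> rg.span Z" by auto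
      have "(x + y) * s ^ (k + l) = s ^ l * (x * s ^ k) + s ^ k * (y * s ^ l)"
        by (simp add: algebra_simps power_add)
      also have "\<dots> \<in> rg.span Z" by (intro rg.span_add rg.span_scale k l)
      finally show "x + y \<in> ?A" by blast
    qed
    fix t assume "t \<in> Y"
    then obtain k where "(s * t) ^ k \<in> rg.span Z" using Z s by blast
    then have "t ^ k * s ^ k \<in> rg.span Z" by (simp only: power_mult_distrib mult.commute)
    then show "\<exists>k. t ^ k \<in> ?A" by blast
  qed
  then show "\<exists>k. s ^ k \<in> rg.span Z" by simp
qed simp

text \<open>Finitely many denominators \<open>s ^ k\<close> have a common one.\<close>

lemma uniform_exponent:
  fixes P :: "'i \<Rightarrow> nat \<Rightarrow> bool"
  assumes "finite I" "\<And>i. i \<in> I \<Longrightarrow> \<exists>k. P i k"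
    and mono: "\<And>i k k'. i \<in> I \<Longrightarrow> P i k \<Longrightarrow> k \<le> k' \<Longrightarrow> P i k'"
  obtains k where "\<And>i. i \<in> I \<Longrightarrow> P i k"
proof -
  obtain k where k: "\<forall>i\<in>I. P i (k i)" using assms(2) by metis
  have "P i (Max (k ` I))" if i: "i \<in> I" for i
  proof (rule mono[OF i])
    show "P i (k i)" using k i by blast
    show "k i \<le> Max (k ` I)" using assms(1) i by simp
  qed
  then show ?thesis using that by blast
qed

lemma power_zero_mono: "s ^ k * x = 0 \<Longrightarrow> k \<le> l \<Longrightarrow> s ^ l * x = (0 :: 'a::comm_ring_1)"
  by (metis le_add_diff_inverse2 mult.assoc mult_zero_right power_add)

text \<open>Modules whose carrier is a type. A quotient module is represented by a pair of submodules \<open>N\<close> and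
  \<open>K\<close>; the predicates below speak of \<open>N/K\<close> with \<open>K \<subseteq> N\<close>.\<close>

locale ring_module = Modules.module scale
  for scale :: "'a::comm_ring_1 \<Rightarrow> 'b::ab_group_add \<Rightarrow> 'b" (infixr \<open>*s\<close> 75)
begin

text \<open>The localisation \<open>(N/K)[1/s]\<close> is free of rank \<open>r\<close>, with a basis coming from \<open>N\<close> and denominators
  cleared.\<close>

definition free_at :: "'b set \<Rightarrow> 'b set \<Rightarrow> nat \<Rightarrow> 'a \<Rightarrow> bool" where
  "free_at N K r s \<longleftrightarrow> (\<exists>e \<in> {..<r} \<rightarrow> N.
     (\<forall>m\<in>N. \<exists>k c. (s ^ k) *s m - (\<Sum>i<r. c i *s e i) \<in> K) \<and>
     (\<forall>c. (\<Sum>i<r. c i *s e i) \<in> K \<longrightarrow> (\<exists>k. \<forall>i<r. s ^ k * c i = 0)))"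

text \<open>Locally free of rank \<open>r\<close>. The set of all good \<open>s\<close> stands in for a finite covering family, because
  membership of \<open>1\<close> in the ideal that it generates involves only finitely many of them.\<close>

definition lf :: "'b set \<Rightarrow> 'b set \<Rightarrow> nat \<Rightarrow> bool" where
  "lf N K r \<longleftrightarrow> 1 \<in> rg.span {s. free_at N K r s}"

lemma free_atE:
  assumes "free_at N K r s"
  obtains e where "e \<in> {..<r} \<rightarrow> N"
    and "\<And>m. m \<in> N \<Longrightarrow> \<exists>k c. (s ^ k) *s m - (\<Sum>i<r. c i *s e i) \<in> K"
    and "\<And>c. (\<Sum>i<r. c i *s e i) \<in> K \<Longrightarrow> \<exists>k. \<forall>i<r. s ^ k * c i = 0"
  using assms unfolding free_at_def by blast

lemma power_scale_mono:
  assumes K: "subspace K" and "s ^ k *s x - (\<Sum>i\<in>I. c i *s e i) \<in> K" "k \<le> l"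
  shows "s ^ l *s x - (\<Sum>i\<in>I. (s ^ (l - k) * c i) *s e i) \<in> K"
proof -
  have "s ^ l = s ^ (l - k) * s ^ k" using assms(3) by (simp flip: power_add)
  then have "s ^ l *s x - (\<Sum>i\<in>I. (s ^ (l - k) * c i) *s e i)
      = s ^ (l - k) *s (s ^ k *s x - (\<Sum>i\<in>I. c i *s e i))"
    by (simp add: scale_right_diff_distrib scale_sum_right)
  then show ?thesis using subspace_scale[OF K assms(2)] by simp
qed

lemma power_scale_ex_mono:
  assumes "subspace K" "\<exists>c. s ^ k *s x - (\<Sum>i\<in>I. c i *s e i) \<in> K" "k \<le> l"
  shows "\<exists>c. s ^ l *s x - (\<Sum>i\<in>I. c i *s e i) \<in> K"
proof -
  obtain c where "s ^ k *s x - (\<Sum>i\<in>I. c i *s e i) \<in> K" using assms(2) by blast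
  from power_scale_mono[OF assms(1) this assms(3)] show ?thesis by (intro exI)
qed

lemma power_scale_in_mono:
  assumes K: "subspace K" and "s ^ k *s x \<in> K" "k \<le> l"
  shows "s ^ l *s x \<in> K"
  using power_scale_mono[OF K, where I="{}", OF _ assms(3)] assms(2) by simp

lemma free_at_mult:
  assumes K: "subspace K" and s: "free_at N K r s"
  shows "free_at N K r (s * t)"
proof -
  obtain e where e: "e \<in> {..<r} \<rightarrow> N"
    and gen: "\<And>m. m \<in> N \<Longrightarrow> \<exists>k c. (s ^ k) *s m - (\<Sum>i<r. c i *s e i) \<in> K"
    and ind: "\<And>c. (\<Sum>i<r. c i *s e i) \<in> K \<Longrightarrow> \<exists>k. \<forall>i<r. s ^ k * c i = 0"
    using s by (rule free_atE) blast
  have "\<exists>k c. ((s * t) ^ k) *s m - (\<Sum>i<r. c i *s e i) \<in> K" if m: "m \<in> N" for m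
  proof -
    obtain k c where "(s ^ k) *s m - (\<Sum>i<r. c i *s e i) \<in> K" using gen m by blast
    then have "t ^ k *s ((s ^ k) *s m - (\<Sum>i<r. c i *s e i)) \<in> K" using subspace_scale[OF K] by blast
    also have "t ^ k *s ((s ^ k) *s m - (\<Sum>i<r. c i *s e i))
        = ((s * t) ^ k) *s m - (\<Sum>i<r. (t ^ k * c i) *s e i)"
      by (simp add: scale_right_diff_distrib scale_sum_right power_mult_distrib mult.commute)
    finally show ?thesis by (intro exI)
  qed
  moreover have "\<exists>k. \<forall>i<r. (s * t) ^ k * c i = 0" if c: "(\<Sum>i<r. c i *s e i) \<in> K" for c
  proof -
    obtain k where "\<forall>i<r. s ^ k * c i = 0" using ind c by blast
    then have "\<forall>i<r. (s * t) ^ k * c i = 0"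
      by (simp only: power_mult_distrib mult.commute[of "s ^ k"] mult.assoc) simp
    then show ?thesis by blast
  qed
  ultimately show ?thesis unfolding free_at_def using e by blast
qed

text \<open>A basis of \<open>N/I\<close> consists of lifts of a basis of \<open>N/J\<close> and of the generator of \<open>J/I\<close>.\<close>

lemma free_at_extension:
  assumes sub: "subspace J" "subspace I" and IJ: "I \<subseteq> J" and JN: "J \<subseteq> N"
    and e: "free_at N J n s" and g: "free_at J I 1 s"
  shows "free_at N I (Suc n) s"
proof -
  obtain e where e: "e \<in> {..<n} \<rightarrow> N"
    and gen: "\<And>m. m \<in> N \<Longrightarrow> \<exists>k c. (s ^ k) *s m - (\<Sum>i<n. c i *s e i) \<in> J"
    and ind: "\<And>c. (\<Sum>i<n. c i *s e i) \<in> J \<Longrightarrow> \<exists>k. \<forall>i<n. s ^ k * c i = 0"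
    using e by (rule free_atE) blast
  obtain g where g: "g \<in> {..<1::nat} \<rightarrow> J"
    and geng: "\<And>m. m \<in> J \<Longrightarrow> \<exists>k c. (s ^ k) *s m - (\<Sum>i<(1::nat). c i *s g i) \<in> I"
    and indg: "\<And>c. (\<Sum>i<(1::nat). c i *s g i) \<in> I \<Longrightarrow> \<exists>k. \<forall>i<(1::nat). s ^ k * c i = 0"
    using g by (rule free_atE) blast
  have g0: "g 0 \<in> J" using g by auto
  define h where "h i = (if i < n then e i else g 0)" for i
  have sum_h: "(\<Sum>i<Suc n. c i *s h i) = (\<Sum>i<n. c i *s e i) + c n *s g 0" for c
    by (simp add: h_def)
  have "h \<in> {..<Suc n} \<rightarrow> N" using e g0 JN by (auto simp: h_def)
  moreover have "\<exists>k c. (s ^ k) *s m - (\<Sum>i<Suc n. c i *s h i) \<in> I" if m: "m \<in> N" for m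
  proof -
    obtain k c where "(s ^ k) *s m - (\<Sum>i<n. c i *s e i) \<in> J" using gen m by blast
    then obtain l d where "(s ^ l) *s ((s ^ k) *s m - (\<Sum>i<n. c i *s e i)) - d *s g 0 \<in> I"
      using geng[of "(s ^ k) *s m - (\<Sum>i<n. c i *s e i)"] by auto
    also have "(s ^ l) *s ((s ^ k) *s m - (\<Sum>i<n. c i *s e i)) - d *s g 0
        = s ^ (l + k) *s m - (\<Sum>i<Suc n. (if i < n then s ^ l * c i else d) *s h i)"
      unfolding sum_h by (simp add: scale_right_diff_distrib scale_sum_right power_add)
    finally show ?thesis by (intro exI)
  qed
  moreover have "\<exists>k. \<forall>i<Suc n. s ^ k * c i = 0" if c: "(\<Sum>i<Suc n. c i *s h i) \<in> I" for c
  proof -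
    have "(\<Sum>i<n. c i *s e i) = (\<Sum>i<Suc n. c i *s h i) - c n *s g 0" unfolding sum_h by simp
    also have "\<dots> \<in> J" using c IJ g0 sub by (intro subspace_diff subspace_scale) auto
    finally obtain k where k: "\<forall>i<n. s ^ k * c i = 0" using ind by blast
    have "s ^ k *s (\<Sum>i<Suc n. c i *s h i) = (s ^ k * c n) *s g 0"
      unfolding sum_h using k by (simp add: scale_right_distrib scale_sum_right)
    then have "(s ^ k * c n) *s g 0 \<in> I" using subspace_scale[OF sub(2) c] by metis
    then obtain l where l: "s ^ l * (s ^ k * c n) = 0"
      using indg[of "\<lambda>_. s ^ k * c n"] by auto
    have "s ^ (l + k) * c i = 0" if "i < Suc n" for i
    proof (cases "i < n")
      case True
      then show ?thesis using k by (auto simp: power_add mult.assoc)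
    next
      case False
      then have "i = n" using that by simp
      then show ?thesis using l by (simp add: power_add mult.assoc)
    qed
    then show ?thesis by blast
  qed
  ultimately show ?thesis unfolding free_at_def by blast
qed

lemma lf_extension:
  assumes "subspace J" "subspace I" "I \<subseteq> J" "J \<subseteq> N" "lf N J n" "lf J I 1"
  shows "lf N I (Suc n)"
  unfolding lf_def
proof (rule cover_product[OF assms(5)[unfolded lf_def] assms(6)[unfolded lf_def]])
  fix s t assume "s \<in> {s. free_at N J n s}" "t \<in> {s. free_at J I 1 s}"
  then have "free_at N J n (s * t)" "free_at J I 1 (s * t)"
    using assms free_at_mult[of J N n s t] free_at_mult[of I J 1 t s] by (auto simp: mult.commute)
  then have "s * t \<in> {s. free_at N I (Suc n) s}" using assms free_at_extension by blast
  then have "s * t \<in> rg.span {s. free_at N I (Suc n) s}" by (rule rg.span_base)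
  then show "\<exists>k. (s * t) ^ k \<in> rg.span {s. free_at N I (Suc n) s}" by (metis power_one_right)
qed

end

section \<open>Kernels of surjections between locally free modules\<close>

text \<open>Let \<open>C\<close> be an \<open>n \<times> (n + 1)\<close> matrix with right inverse \<open>\<sigma>\<inverse> D\<close>. The kernel of \<open>C\<close> is the image of
  the projection \<open>\<sigma>\<inverse> E\<close> with \<open>E = \<sigma> - D C\<close>. Its trace is \<open>(n + 1) - n = 1\<close>, so the diagonal entries of
  \<open>E\<close> add up to \<open>\<sigma>\<close>; and once the entry \<open>E\<^sub>j\<^sub>j\<close> is inverted, column \<open>j\<close> of \<open>E\<close> generates the
  kernel. Thus the kernel is locally free of rank one, although it is given only as a stably free
  module.\<close>

lemma split_matrix_kernel:
  fixes C D :: "nat \<Rightarrow> nat \<Rightarrow> 'a::comm_ring_1"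
  assumes CD: "\<And>i i'. i < n \<Longrightarrow> i' < n \<Longrightarrow>
      (\<Sum>j\<le>n. C i j * D j i') = (if i = i' then \<sigma> else 0)"
  defines "E \<equiv> \<lambda>j l. (if j = l then \<sigma> else 0) - (\<Sum>i<n. D j i * C i l)"
  shows "(\<Sum>j\<le>n. E j j) = \<sigma>"
    and "i < n \<Longrightarrow> l \<le> n \<Longrightarrow> (\<Sum>j\<le>n. C i j * E j l) = 0"
    and "(\<And>i. i < n \<Longrightarrow> (\<Sum>j\<le>n. C i j * v j) = 0) \<Longrightarrow> j \<le> n \<Longrightarrow> l \<le> n \<Longrightarrow>
           \<sigma> ^ n * E j j * (E j j * v l - v j * E l j) = 0"
proof -
  have "(\<Sum>j\<le>n. \<Sum>i<n. D j i * C i j) = (\<Sum>i<n. \<Sum>j\<le>n. C i j * D j i)"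
    by (subst sum.swap) (simp add: mult.commute)
  also have "\<dots> = of_nat n * \<sigma>" using CD by simp
  finally show "(\<Sum>j\<le>n. E j j) = \<sigma>"
    by (simp add: E_def sum_subtractf algebra_simps)
  have CE: "(\<Sum>j\<le>n. C i j * E j l) = 0" if i: "i < n" and l: "l \<le> n" for i l
  proof -
    have "(\<Sum>j\<le>n. C i j * (\<Sum>i'<n. D j i' * C i' l)) = (\<Sum>i'<n. (\<Sum>j\<le>n. C i j * D j i') * C i' l)"
      unfolding sum_distrib_left sum_distrib_right by (subst sum.swap) (simp add: mult.assoc)
    also have "\<dots> = (\<Sum>i'<n. (if i = i' then \<sigma> else 0) * C i' l)"
      using i by (intro sum.cong) (auto simp: CD)
    also have "\<dots> = \<sigma> * C i l" using i by (subst sum.remove[of _ i]) auto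
    finally have *: "(\<Sum>j\<le>n. C i j * (\<Sum>i'<n. D j i' * C i' l)) = \<sigma> * C i l" .
    have "(\<Sum>j\<le>n. C i j * (if j = l then \<sigma> else 0)) = \<sigma> * C i l"
      using l by (subst sum.remove[of _ l]) auto
    then show ?thesis using * by (simp add: E_def algebra_simps sum_subtractf)
  qed
  then show "i < n \<Longrightarrow> l \<le> n \<Longrightarrow> (\<Sum>j\<le>n. C i j * E j l) = 0" .
  assume v: "\<And>i. i < n \<Longrightarrow> (\<Sum>j\<le>n. C i j * v j) = 0" and j: "j \<le> n" and l: "l \<le> n"
  let ?n = "Suc n"
  \<comment> \<open>\<open>B\<close> is \<open>C\<close> with the coordinate function \<open>j\<close> as an additional row. The product with \<open>U\<close>, whose columns
      are those of \<open>D\<close> and column \<open>j\<close> of \<open>E\<close>, is triangular, so \<open>det B\<close> divides \<open>\<sigma> ^ n * E j j\<close>.\<close>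
  define B where "B = mat ?n ?n (\<lambda>(i, l). if i < n then C i l else if l = j then 1 else 0)"
  define U where "U = mat ?n ?n (\<lambda>(l, i). if i < n then D l i else E l j)"
  have B: "B \<in> carrier_mat ?n ?n" and U: "U \<in> carrier_mat ?n ?n" by (auto simp: B_def U_def)
  have atMost: "{..n} = {0..<?n}" by auto
  have lastrow: "(\<Sum>l\<le>n. (if l = j then 1 else 0) * y l) = y j" for y :: "nat \<Rightarrow> 'a"
    using j by (subst sum.remove[of _ j]) auto
  have BX: "(B * U) $$ (i, i') =
      (if i < n then if i' < n then if i = i' then \<sigma> else 0 else 0
       else if i' < n then D j i' else E j j)" if "i < ?n" "i' < ?n" for i i'
  proof -
    have "(B * U) $$ (i, i') = (\<Sum>l\<le>n. (if i < n then C i l else if l = j then 1 else 0) *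
         (if i' < n then D l i' else E l j))"
      using that by (simp add: B_def U_def times_mat_def scalar_prod_def atMost)
    then show ?thesis using that j CE[of i j] lastrow by (auto simp: CD)
  qed
  have "det (B * U) = prod_list (diag_mat (B * U))"
    using B U BX by (intro det_lower_triangular[of ?n]) auto
  also have "\<dots> = (\<Prod>i\<in>{0..<?n}. (B * U) $$ (i, i))"
    using B U by (simp add: prod_list_diag_prod)
  also have "\<dots> = (\<Prod>i\<in>{0..<n}. (B * U) $$ (i, i)) * (B * U) $$ (n, n)" by simp
  also have "(\<Prod>i\<in>{0..<n}. (B * U) $$ (i, i)) = (\<Prod>i\<in>{0..<n}. \<sigma>)"
    by (rule prod.cong) (auto simp: BX)
  finally have det: "det B * det U = \<sigma> ^ n * E j j"
    using det_mult[OF B U] by (simp add: BX)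
  \<comment> \<open>The vector \<open>z\<close> lies in the kernel of \<open>C\<close> and has coordinate \<open>j\<close> equal to zero, so \<open>B\<close> kills it.\<close>
  define z where "z l = E j j * v l - v j * E l j" for l
  define Z where "Z = Matrix.vec ?n z"
  have Z: "Z \<in> carrier_vec ?n" by (simp add: Z_def)
  have "B *\<^sub>v Z = 0\<^sub>v ?n"
  proof (rule eq_vecI)
    fix i assume "i < dim_vec (0\<^sub>v ?n :: 'a Matrix.vec)"
    then have i: "i < ?n" by simp
    have "(B *\<^sub>v Z) $ i = (\<Sum>l\<le>n. (if i < n then C i l else if l = j then 1 else 0) * z l)"
      using i by (simp add: B_def Z_def scalar_prod_def atMost)
    also have "\<dots> = 0"
    proof (cases "i < n")
      case True
      have "(\<Sum>l\<le>n. C i l * z l) = E j j * (\<Sum>l\<le>n. C i l * v l) - v j * (\<Sum>l\<le>n. C i l * E l j)"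
        by (simp add: z_def algebra_simps sum_subtractf sum_distrib_left)
      then show ?thesis using True v CE[of i j] j by simp
    next
      case False
      then show ?thesis using lastrow[of z] by (simp add: z_def)
    qed
    finally show "(B *\<^sub>v Z) $ i = 0\<^sub>v ?n $ i" using i by simp
  qed (simp add: B_def)
  then have "adj_mat B *\<^sub>v (B *\<^sub>v Z) = 0\<^sub>v ?n"
    using adj_mat(1)[OF B] by (auto simp: mult_mat_vec_def scalar_prod_def)
  then have "(det B \<cdot>\<^sub>m 1\<^sub>m ?n) *\<^sub>v Z = 0\<^sub>v ?n"
    using assoc_mult_mat_vec[OF adj_mat(1)[OF B] B Z] adj_mat(3)[OF B] by simp
  then have "((det B \<cdot>\<^sub>m 1\<^sub>m ?n) *\<^sub>v Z) $ l = 0" using l by simp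
  also have "((det B \<cdot>\<^sub>m 1\<^sub>m ?n) *\<^sub>v Z) $ l = det B * z l"
    using l by (simp add: Z_def scalar_prod_def sum.remove[of _ l])
  finally have "det B * z l = 0" .
  then have "det U * (det B * z l) = 0" by simp
  then show "\<sigma> ^ n * E j j * (E j j * v l - v j * E l j) = 0"
    using det unfolding z_def by (simp add: mult.assoc[symmetric] mult.commute)
qed


context ring_module
begin

text \<open>With bases \<open>f\<close> of \<open>N/I\<close> and \<open>e\<close> of \<open>N/J\<close> over \<open>A[1/s]\<close>, the map \<open>N/I \<rightarrow> N/J\<close> has a matrix \<open>C\<close>, and lifting
  the \<open>e i\<close> gives a right inverse \<open>D\<close>. The kernel \<open>J/I\<close> is therefore the kernel of a split matrix.\<close>

lemma free_at_kernel:
  assumes sub: "subspace J" "subspace I" and IJ: "I \<subseteq> J" and JN: "J \<subseteq> N" and N: "subspace N"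
    and e: "free_at N J n s" and f: "free_at N I (Suc n) s"
  shows "\<exists>k. s ^ k \<in> rg.span {t. free_at J I 1 t}"
proof -
  obtain e where e: "e \<in> {..<n} \<rightarrow> N"
    and gen_e: "\<And>m. m \<in> N \<Longrightarrow> \<exists>k c. (s ^ k) *s m - (\<Sum>i<n. c i *s e i) \<in> J"
    and ind_e: "\<And>c. (\<Sum>i<n. c i *s e i) \<in> J \<Longrightarrow> \<exists>k. \<forall>i<n. s ^ k * c i = 0"
    using e by (rule free_atE) blast
  obtain f where f: "f \<in> {..<Suc n} \<rightarrow> N"
    and gen_f: "\<And>m. m \<in> N \<Longrightarrow> \<exists>k c. (s ^ k) *s m - (\<Sum>j\<le>n. c j *s f j) \<in> I"
    and ind_f: "\<And>c. (\<Sum>j\<le>n. c j *s f j) \<in> I \<Longrightarrow> \<exists>k. \<forall>j\<le>n. s ^ k * c j = 0"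
    using f[unfolded free_at_def lessThan_Suc_atMost] less_Suc_eq_le[of _ n] lessThan_Suc_atMost[of n]
    by auto
  have fN: "f j \<in> N" if "j \<le> n" for j using f that by auto
  have eN: "e i \<in> N" if "i < n" for i using e that by auto
  obtain kC where kC: "\<And>j. j \<in> {..n} \<Longrightarrow> \<exists>c. (s ^ kC) *s f j - (\<Sum>i<n. c i *s e i) \<in> J"
  proof (rule uniform_exponent[of "{..n}" "\<lambda>j k. \<exists>c. (s ^ k) *s f j - (\<Sum>i<n. c i *s e i) \<in> J"])
    show "\<exists>k c. (s ^ k) *s f j - (\<Sum>i<n. c i *s e i) \<in> J" if "j \<in> {..n}" for j
      using gen_e[OF fN] that by auto
    show "\<exists>c. (s ^ k') *s f j - (\<Sum>i<n. c i *s e i) \<in> J"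
      if "\<exists>c. (s ^ k) *s f j - (\<Sum>i<n. c i *s e i) \<in> J" "k \<le> k'" for j k k'
      using power_scale_ex_mono[OF sub(1) that] .
  qed auto
  obtain kD where kD: "\<And>i. i \<in> {..<n} \<Longrightarrow> \<exists>c. (s ^ kD) *s e i - (\<Sum>j\<le>n. c j *s f j) \<in> I"
  proof (rule uniform_exponent[of "{..<n}" "\<lambda>i k. \<exists>c. (s ^ k) *s e i - (\<Sum>j\<le>n. c j *s f j) \<in> I"])
    show "\<exists>k c. (s ^ k) *s e i - (\<Sum>j\<le>n. c j *s f j) \<in> I" if "i \<in> {..<n}" for i
      using gen_f[OF eN] that by auto
    show "\<exists>c. (s ^ k') *s e i - (\<Sum>j\<le>n. c j *s f j) \<in> I"
      if "\<exists>c. (s ^ k) *s e i - (\<Sum>j\<le>n. c j *s f j) \<in> I" "k \<le> k'" for i k k'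
      using power_scale_ex_mono[OF sub(2) that] .
  qed auto
  obtain C' where C': "\<And>j. j \<le> n \<Longrightarrow> (s ^ kC) *s f j - (\<Sum>i<n. C' j i *s e i) \<in> J"
    using kC by (metis atMost_iff)
  define C where "C i j = C' j i" for i j
  have C: "(s ^ kC) *s f j - (\<Sum>i<n. C i j *s e i) \<in> J" if "j \<le> n" for j
    using C' that by (simp add: C_def)
  have Csum: "(s ^ kC) *s (\<Sum>j\<le>n. v j *s f j) - (\<Sum>i<n. (\<Sum>j\<le>n. C i j * v j) *s e i) \<in> J" for v
  proof -
    have "(\<Sum>i<n. (\<Sum>j\<le>n. C i j * v j) *s e i) = (\<Sum>j\<le>n. v j *s (\<Sum>i<n. C i j *s e i))"
      unfolding scale_sum_left scale_sum_right by (subst sum.swap) (simp add: mult.commute)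
    then have "(s ^ kC) *s (\<Sum>j\<le>n. v j *s f j) - (\<Sum>i<n. (\<Sum>j\<le>n. C i j * v j) *s e i)
        = (\<Sum>j\<le>n. v j *s ((s ^ kC) *s f j - (\<Sum>i<n. C i j *s e i)))"
      by (simp add: scale_right_diff_distrib sum_subtractf scale_sum_right mult.commute)
    also have "\<dots> \<in> J" using C by (intro subspace_sum subspace_scale sub) auto
    finally show ?thesis .
  qed
  have Cker: "\<exists>k. \<forall>i<n. s ^ k * (\<Sum>j\<le>n. C i j * v j) = 0" if v: "(\<Sum>j\<le>n. v j *s f j) \<in> J" for v
  proof (rule ind_e)
    have "(\<Sum>i<n. (\<Sum>j\<le>n. C i j * v j) *s e i) = (s ^ kC) *s (\<Sum>j\<le>n. v j *s f j) -
        ((s ^ kC) *s (\<Sum>j\<le>n. v j *s f j) - (\<Sum>i<n. (\<Sum>j\<le>n. C i j * v j) *s e i))" by simp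
    also have "\<dots> \<in> J" by (intro subspace_diff subspace_scale sub Csum v)
    finally show "(\<Sum>i<n. (\<Sum>j\<le>n. C i j * v j) *s e i) \<in> J" .
  qed
  obtain D' where D': "\<And>i. i < n \<Longrightarrow> (s ^ kD) *s e i - (\<Sum>j\<le>n. D' i j *s f j) \<in> I"
    using kD by (metis lessThan_iff)
  \<comment> \<open>\<open>C D' = s ^ (kC + kD)\<close> holds only up to \<open>s\<close>-power torsion; the factor \<open>s ^ m\<close> below removes it.\<close>
  have CD': "\<exists>k. \<forall>i<n. s ^ k * ((\<Sum>j\<le>n. C i j * D' i' j) - (if i = i' then s ^ (kC + kD) else 0)) = 0"
    if i': "i' < n" for i'
  proof (rule ind_e)
    let ?d = "\<Sum>j\<le>n. D' i' j *s f j"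
    have "(\<Sum>i<n. ((\<Sum>j\<le>n. C i j * D' i' j) - (if i = i' then s ^ (kC + kD) else 0)) *s e i)
        = (\<Sum>i<n. (\<Sum>j\<le>n. C i j * D' i' j) *s e i) - s ^ (kC + kD) *s e i'"
    proof -
      have "(\<Sum>i<n. (if i = i' then s ^ (kC + kD) else 0) *s e i) = s ^ (kC + kD) *s e i'"
        using i' by (subst sum.remove[of _ i']) auto
      then show ?thesis by (simp add: scale_left_diff_distrib sum_subtractf)
    qed
    also have "\<dots> = - (s ^ kC *s ?d - (\<Sum>i<n. (\<Sum>j\<le>n. C i j * D' i' j) *s e i))
        - s ^ kC *s (s ^ kD *s e i' - ?d)"
      by (simp add: scale_right_diff_distrib power_add)
    also have "\<dots> \<in> J"
      using subspace_diff[OF sub(1) subspace_neg[OF sub(1) Csum[of "D' i'"]]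
          subspace_scale[OF sub(1) subsetD[OF IJ D'[OF i']]]] .
    finally show "(\<Sum>i<n. ((\<Sum>j\<le>n. C i j * D' i' j) - (if i = i' then s ^ (kC + kD) else 0)) *s e i) \<in> J" .
  qed
  obtain m where m: "\<And>i'. i' \<in> {..<n} \<Longrightarrow>
     \<forall>i<n. s ^ m * ((\<Sum>j\<le>n. C i j * D' i' j) - (if i = i' then s ^ (kC + kD) else 0)) = 0"
  proof (rule uniform_exponent[of "{..<n}" "\<lambda>i' k.
     \<forall>i<n. s ^ k * ((\<Sum>j\<le>n. C i j * D' i' j) - (if i = i' then s ^ (kC + kD) else 0)) = 0"])
    show "\<exists>k. \<forall>i<n. s ^ k * ((\<Sum>j\<le>n. C i j * D' i' j) - (if i = i' then s ^ (kC + kD) else 0)) = 0"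
      if "i' \<in> {..<n}" for i' using CD' that by blast
    show "\<forall>i<n. s ^ k' * ((\<Sum>j\<le>n. C i j * D' i' j) - (if i = i' then s ^ (kC + kD) else 0)) = 0"
      if "\<forall>i<n. s ^ k * ((\<Sum>j\<le>n. C i j * D' i' j) - (if i = i' then s ^ (kC + kD) else 0)) = 0" "k \<le> k'"
      for i' k k' using that power_zero_mono by blast
  qed auto
  define \<kappa> where "\<kappa> = m + kC + kD"
  define \<sigma> where "\<sigma> = s ^ \<kappa>"
  define D where "D j i = s ^ m * D' i j" for j i
  have CD: "(\<Sum>j\<le>n. C i j * D j i') = (if i = i' then \<sigma> else 0)" if "i < n" "i' < n" for i i'
  proof -
    have "(\<Sum>j\<le>n. C i j * D j i') = s ^ m * (\<Sum>j\<le>n. C i j * D' i' j)"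
      by (simp add: D_def sum_distrib_left mult.left_commute)
    also have "\<dots> = s ^ m * (if i = i' then s ^ (kC + kD) else 0)"
      using m[of i'] that by (auto simp: right_diff_distrib)
    finally show ?thesis by (simp add: \<sigma>_def \<kappa>_def power_add mult.assoc)
  qed
  define E where "E j l = (if j = l then \<sigma> else 0) - (\<Sum>i<n. D j i * C i l)" for j l
  note E = split_matrix_kernel[of n C D \<sigma>, OF CD, folded E_def]
  have "free_at J I 1 (s * E j j)" if j: "j \<le> n" for j
  proof -
    define t where "t = E j j"
    define w where "w = (\<Sum>l\<le>n. E l j *s f l)"
    \<comment> \<open>The column itself is in \<open>J\<close> only after multiplication by a power of \<open>s\<close>.\<close>
    define g where "g = s ^ kC *s w"
    have gJ: "g \<in> J"
    proof -
      have "(\<Sum>i<n. (\<Sum>l\<le>n. C i l * E l j) *s e i) = 0" using E(2) j by simp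
      then show ?thesis using Csum[of "\<lambda>l. E l j"] by (simp add: g_def w_def)
    qed
    have gen: "\<exists>k c. ((s * t) ^ k) *s x - c *s g \<in> I" if x: "x \<in> J" for x
    proof -
      obtain l v where lv: "s ^ l *s x - (\<Sum>j\<le>n. v j *s f j) \<in> I" using gen_f[of x] x JN by blast
      have "(\<Sum>j\<le>n. v j *s f j) = s ^ l *s x - (s ^ l *s x - (\<Sum>j\<le>n. v j *s f j))" by simp
      also have "\<dots> \<in> J"
        using subspace_diff[OF sub(1) subspace_scale[OF sub(1) x] subsetD[OF IJ lv]] .
      finally obtain q where q: "\<forall>i<n. s ^ q * (\<Sum>j\<le>n. C i j * v j) = 0" using Cker by blast
      define v' where "v' j = s ^ q * v j" for j
      have v': "(\<Sum>j\<le>n. C i j * v' j) = 0" if "i < n" for i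
        using q that by (simp add: v'_def sum_distrib_left mult.left_commute)
      have lv': "s ^ (q + l) *s x - (\<Sum>j\<le>n. v' j *s f j) \<in> I"
        using power_scale_mono[OF sub(2) lv, of "q + l"] by (simp add: v'_def)
      have id: "\<sigma> ^ n * t * (t * v' l - v' j * E l j) = 0" if "l \<le> n" for l
        unfolding t_def using E(3)[of v' j l] v' j that by blast
      have "(\<sigma> ^ n * t * t) *s (\<Sum>l\<le>n. v' l *s f l) - (\<sigma> ^ n * t * v' j) *s w
          = (\<Sum>l\<le>n. (\<sigma> ^ n * t * (t * v' l - v' j * E l j)) *s f l)"
        by (simp add: w_def scale_sum_right sum_subtractf scale_left_diff_distrib right_diff_distrib mult.assoc)
      also have "\<dots> = 0" using id by simp
      finally have id2: "(\<sigma> ^ n * t * t) *s (\<Sum>l\<le>n. v' l *s f l) = (\<sigma> ^ n * t * v' j) *s w" by simp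
      define P where "P = kC + (\<kappa> * n + (q + l))"
      have "(s ^ kC * \<sigma> ^ n * t * t) *s (s ^ (q + l) *s x - (\<Sum>j\<le>n. v' j *s f j))
          = (s ^ P * t ^ 2) *s x - s ^ kC *s ((\<sigma> ^ n * t * t) *s (\<Sum>l\<le>n. v' l *s f l))"
        by (simp add: P_def \<sigma>_def power_add power_mult power2_eq_square scale_right_diff_distrib ac_simps)
      also have "\<dots> = (s ^ P * t ^ 2) *s x - (\<sigma> ^ n * t * v' j) *s g"
        unfolding id2 by (simp add: g_def ac_simps)
      finally have "(s ^ P * t ^ 2) *s x - (\<sigma> ^ n * t * v' j) *s g \<in> I"
        using subspace_scale[OF sub(2) lv'] by metis
      then have "(s ^ 2 * t ^ P) *s ((s ^ P * t ^ 2) *s x - (\<sigma> ^ n * t * v' j) *s g) \<in> I"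
        by (rule subspace_scale[OF sub(2)])
      also have "(s ^ 2 * t ^ P) *s ((s ^ P * t ^ 2) *s x - (\<sigma> ^ n * t * v' j) *s g)
          = ((s * t) ^ (P + 2)) *s x - (s ^ 2 * t ^ P * (\<sigma> ^ n * t * v' j)) *s g"
        by (simp add: scale_right_diff_distrib power_mult_distrib power_add power2_eq_square ac_simps)
      finally show ?thesis by (intro exI)
    qed
    have ind: "\<exists>k. (s * t) ^ k * c = 0" if c: "c *s g \<in> I" for c
    proof -
      have "c *s g = (\<Sum>l\<le>n. (c * s ^ kC * E l j) *s f l)"
        by (simp add: g_def w_def scale_sum_right mult.assoc)
      then have "(\<Sum>l\<le>n. (c * s ^ kC * E l j) *s f l) \<in> I" using c by (simp only:)
      from ind_f[OF this] obtain q where "\<forall>l\<le>n. s ^ q * (c * s ^ kC * E l j) = 0" by blast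
      then have q: "s ^ q * (c * s ^ kC * t) = 0" using j by (simp add: t_def)
      have "(s * t) ^ Suc (q + kC) * c = s * t ^ (q + kC) * (s ^ q * (c * s ^ kC * t))"
        by (simp add: power_mult_distrib power_add ac_simps)
      then show ?thesis unfolding q by (metis mult_zero_right)
    qed
    have "(\<lambda>_. g) \<in> {..<1::nat} \<rightarrow> J" using gJ by simp
    moreover have "\<exists>k c. ((s * t) ^ k) *s x - (\<Sum>i<(1::nat). c i *s g) \<in> I" if x: "x \<in> J" for x
    proof -
      obtain k c where "(s * t) ^ k *s x - c *s g \<in> I" using gen[OF x] by blast
      then have "(s * t) ^ k *s x - (\<Sum>i<(1::nat). (\<lambda>_. c) i *s g) \<in> I" by simp
      then show ?thesis by (intro exI)
    qed
    moreover have "\<exists>k. \<forall>i<(1::nat). (s * t) ^ k * c i = 0"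
      if "(\<Sum>i<(1::nat). c i *s g) \<in> I" for c
      using ind[of "c 0"] that by simp
    ultimately show ?thesis unfolding free_at_def t_def[symmetric]
      by (intro bexI[of _ "\<lambda>_. g"] conjI ballI allI impI) blast+
  qed
  then have "(\<Sum>j\<le>n. s * E j j) \<in> rg.span {t. free_at J I 1 t}"
    by (intro rg.span_sum rg.span_base) auto
  moreover have "(\<Sum>j\<le>n. s * E j j) = s ^ Suc \<kappa>"
    using E(1) by (simp add: sum_distrib_left[symmetric] \<sigma>_def)
  ultimately show ?thesis by metis
qed

lemma lf_kernel:
  assumes "subspace N" "subspace J" "subspace I" "I \<subseteq> J" "J \<subseteq> N" "lf N J n" "lf N I (Suc n)"
  shows "lf J I 1"
  unfolding lf_def
proof (rule cover_product[OF assms(6)[unfolded lf_def] assms(7)[unfolded lf_def]])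
  fix s t assume "s \<in> {s. free_at N J n s}" "t \<in> {s. free_at N I (Suc n) s}"
  then have "free_at N J n (s * t)" "free_at N I (Suc n) (s * t)"
    using assms free_at_mult[of J N n s t] free_at_mult[of I N "Suc n" t s] by (auto simp: mult.commute)
  then show "\<exists>k. (s * t) ^ k \<in> rg.span {s. free_at J I 1 s}"
    using assms free_at_kernel by blast
qed

lemma free_at_1:
  "free_at N K 1 s \<longleftrightarrow> (\<exists>e\<in>N. (\<forall>m\<in>N. \<exists>k c. s ^ k *s m - c *s e \<in> K) \<and>
     (\<forall>c. c *s e \<in> K \<longrightarrow> (\<exists>k. s ^ k * c = 0)))" (is "?L \<longleftrightarrow> ?R")
proof
  assume ?L
  then obtain e where e: "e \<in> {..<1::nat} \<rightarrow> N"
    and gen: "\<And>m. m \<in> N \<Longrightarrow> \<exists>k c. (s ^ k) *s m - (\<Sum>i<(1::nat). c i *s e i) \<in> K"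
    and ind: "\<And>c. (\<Sum>i<(1::nat). c i *s e i) \<in> K \<Longrightarrow> \<exists>k. \<forall>i<(1::nat). s ^ k * c i = 0"
    by (rule free_atE) blast
  have "\<exists>k. s ^ k * c = 0" if "c *s e 0 \<in> K" for c using ind[of "\<lambda>_. c"] that by auto
  moreover have "\<exists>k c. s ^ k *s m - c *s e 0 \<in> K" if "m \<in> N" for m using gen[OF that] by auto
  moreover have "e 0 \<in> N" using e by auto
  ultimately show ?R by blast
next
  assume ?R
  then obtain e where e: "e \<in> N" and gen: "\<And>m. m \<in> N \<Longrightarrow> \<exists>k c. s ^ k *s m - c *s e \<in> K"
    and ind: "\<And>c. c *s e \<in> K \<Longrightarrow> \<exists>k. s ^ k * c = 0" by blast
  have "(\<lambda>_. e) \<in> {..<1::nat} \<rightarrow> N" using e by simp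
  moreover have "\<exists>k c. (s ^ k) *s x - (\<Sum>i<(1::nat). c i *s e) \<in> K" if x: "x \<in> N" for x
  proof -
    obtain k c where "s ^ k *s x - c *s e \<in> K" using gen[OF x] by blast
    then have "s ^ k *s x - (\<Sum>i<(1::nat). (\<lambda>_. c) i *s e) \<in> K" by simp
    then show ?thesis by (intro exI)
  qed
  moreover have "\<exists>k. \<forall>i<(1::nat). s ^ k * c i = 0" if "(\<Sum>i<(1::nat). c i *s e) \<in> K" for c
    using ind[of "c 0"] that by simp
  ultimately show ?L unfolding free_at_def
    by (intro bexI[of _ "\<lambda>_. e"] conjI ballI allI impI) blast+
qed

lemma membership_local:
  assumes "1 \<in> rg.span U" "subspace K" "\<And>s. s \<in> U \<Longrightarrow> \<exists>k. s ^ k *s x \<in> K"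
  shows "x \<in> K"
proof -
  have "1 \<in> {a. a *s x \<in> K}"
  proof (rule local_principle[OF assms(1)])
    show "rg.subspace {a. a *s x \<in> K}"
    proof (rule rg.subspaceI)
      show "0 \<in> {a. a *s x \<in> K}" using subspace_0[OF assms(2)] by simp
      show "a + b \<in> {a. a *s x \<in> K}" if "a \<in> {a. a *s x \<in> K}" "b \<in> {a. a *s x \<in> K}" for a b
        using that subspace_add[OF assms(2)] by (simp add: scale_left_distrib)
      show "c * a \<in> {a. a *s x \<in> K}" if "a \<in> {a. a *s x \<in> K}" for a c
        using that subspace_scale[OF assms(2), of "a *s x" c] by simp
    qed
  qed (use assms(3) in auto)
  then show ?thesis by simp
qed

text \<open>An annihilator of an invertible module kills a local generator, hence is zero locally.\<close>

lemma lf_1_faithful: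
  assumes "lf N K 1" and a: "\<And>m. m \<in> N \<Longrightarrow> a *s m \<in> K"
  shows "a = 0"
proof -
  have "1 \<in> {b. b * a = 0}"
  proof (rule local_principle[OF assms(1)[unfolded lf_def]])
    show "rg.subspace {b. b * a = 0}"
      by (rule rg.subspaceI) (auto simp: distrib_right mult.assoc)
    fix s assume "s \<in> {s. free_at N K 1 s}"
    then show "\<exists>k. s ^ k \<in> {b. b * a = 0}" using a unfolding mem_Collect_eq free_at_1 by blast
  qed
  then show ?thesis by simp
qed

text \<open>Finite generation relative to \<open>K\<close>. It is needed wherever an exponent that depends on an element
  must be chosen uniformly on a module.\<close>

lemma finitely_generated_local:
  assumes U: "1 \<in> rg.span U"
    and G: "\<And>s. s \<in> U \<Longrightarrow> \<exists>G. finite G \<and> G \<subseteq> N \<and> (\<forall>m\<in>N. \<exists>k. s ^ k *s m \<in> span (G \<union> K))"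
  obtains G where "finite G" "G \<subseteq> N" "N \<subseteq> span (G \<union> K)"
proof -
  obtain F r where F: "finite F" "F \<subseteq> U" and 1: "1 = (\<Sum>a\<in>F. r a * a)"
    using U unfolding rg.span_explicit by blast
  have "1 \<in> rg.span F" unfolding 1 by (intro rg.span_sum rg.span_scale rg.span_base)
  obtain G where G: "\<And>s. s \<in> F \<Longrightarrow> finite (G s) \<and> G s \<subseteq> N \<and> (\<forall>m\<in>N. \<exists>k. s ^ k *s m \<in> span (G s \<union> K))"
    using G F by (metis subsetD)
  have "N \<subseteq> span (\<Union> (G ` F) \<union> K)"
  proof
    fix m assume m: "m \<in> N"
    show "m \<in> span (\<Union> (G ` F) \<union> K)"
    proof (rule membership_local[OF \<open>1 \<in> rg.span F\<close> subspace_span])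
      fix s assume s: "s \<in> F"
      then obtain k where "s ^ k *s m \<in> span (G s \<union> K)" using G m by blast
      then show "\<exists>k. s ^ k *s m \<in> span (\<Union> (G ` F) \<union> K)"
        using span_mono[of "G s \<union> K" "\<Union> (G ` F) \<union> K"] s by blast
    qed
  qed
  then show ?thesis using that[of "\<Union> (G ` F)"] G F by blast
qed

text \<open>Locally, \<open>\<phi>\<close> multiplies the generator \<open>e\<close> by \<open>c / s ^ k\<close>. Instead of gluing these scalars, consider the
  ideal of all \<open>a\<close> for which \<open>a \<phi>\<close> is multiplication by a scalar: it contains a power of every \<open>s\<close>.\<close>

lemma invertible_endomorphism_scalar:
  assumes N: "subspace N" and K: "subspace K" "K \<subseteq> N" and lf: "lf N K 1"
    and \<phi>: "module_hom scale scale \<phi>" and \<phi>N: "\<phi> ` N \<subseteq> N" and \<phi>K: "\<phi> ` K \<subseteq> K"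
  shows "\<exists>a. \<forall>m\<in>N. \<phi> m - a *s m \<in> K"
proof -
  interpret \<phi>: module_hom scale scale \<phi> by fact
  obtain G where G: "finite G" "G \<subseteq> N" "N \<subseteq> span (G \<union> K)"
  proof (rule finitely_generated_local[OF lf[unfolded lf_def], of N K])
    fix s assume "s \<in> {s. free_at N K 1 s}"
    then obtain e where e: "e \<in> N" and gen: "\<And>m. m \<in> N \<Longrightarrow> \<exists>k c. s ^ k *s m - c *s e \<in> K"
      unfolding mem_Collect_eq free_at_1 by blast
    have "\<exists>k. s ^ k *s m \<in> span ({e} \<union> K)" if "m \<in> N" for m
    proof -
      obtain k c where "s ^ k *s m - c *s e \<in> K" using gen \<open>m \<in> N\<close> by blast
      then have "(s ^ k *s m - c *s e) + c *s e \<in> span ({e} \<union> K)"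
        by (intro span_add span_scale) (auto intro: span_base)
      then show ?thesis by auto
    qed
    then show "\<exists>G. finite G \<and> G \<subseteq> N \<and> (\<forall>m\<in>N. \<exists>k. s ^ k *s m \<in> span (G \<union> K))"
      using e by (intro exI[of _ "{e}"]) auto
  qed
  let ?A = "{a. \<exists>b. \<forall>m\<in>N. a *s \<phi> m - b *s m \<in> K}"
  have "1 \<in> ?A"
  proof (rule local_principle[OF lf[unfolded lf_def]])
    show "rg.subspace ?A"
    proof (rule rg.subspaceI)
      show "0 \<in> ?A" using subspace_0[OF K(1)] by (auto intro!: exI[of _ 0])
    next
      fix a a' assume "a \<in> ?A" "a' \<in> ?A"
      then obtain b b' where b: "\<forall>m\<in>N. a *s \<phi> m - b *s m \<in> K" and b': "\<forall>m\<in>N. a' *s \<phi> m - b' *s m \<in> K"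
        by blast
      have "(a + a') *s \<phi> m - (b + b') *s m \<in> K" if "m \<in> N" for m
        using subspace_add[OF K(1) b[rule_format, OF that] b'[rule_format, OF that]]
        by (simp add: scale_left_distrib add_diff_add)
      then show "a + a' \<in> ?A" by blast
    next
      fix a c assume "a \<in> ?A"
      then obtain b where b: "\<forall>m\<in>N. a *s \<phi> m - b *s m \<in> K" by blast
      have "(c * a) *s \<phi> m - (c * b) *s m \<in> K" if "m \<in> N" for m
        using subspace_scale[OF K(1) b[rule_format, OF that], of c] by (simp add: scale_right_diff_distrib)
      then show "c * a \<in> ?A" by blast
    qed
    fix s assume "s \<in> {s. free_at N K 1 s}"
    then obtain e where e: "e \<in> N" and gen: "\<And>m. m \<in> N \<Longrightarrow> \<exists>k c. s ^ k *s m - c *s e \<in> K"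
      unfolding mem_Collect_eq free_at_1 by blast
    obtain k c where kc: "s ^ k *s \<phi> e - c *s e \<in> K" using gen[of "\<phi> e"] e \<phi>N by blast
    have "\<exists>j. s ^ j *s (s ^ k *s \<phi> m - c *s m) \<in> K" if m: "m \<in> N" for m
    proof -
      obtain j d where jd: "s ^ j *s m - d *s e \<in> K" using gen m by blast
      have "\<phi> (s ^ j *s m - d *s e) \<in> K" using jd \<phi>K by blast
      then have *: "s ^ j *s \<phi> m - d *s \<phi> e \<in> K" by (simp add: \<phi>.diff \<phi>.scale)
      have "s ^ j *s (s ^ k *s \<phi> m - c *s m) = s ^ k *s (s ^ j *s \<phi> m - d *s \<phi> e)
          + d *s (s ^ k *s \<phi> e - c *s e) - c *s (s ^ j *s m - d *s e)"
        by (simp add: scale_right_diff_distrib mult.commute)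
      also have "\<dots> \<in> K" by (intro subspace_diff subspace_add subspace_scale K * kc jd)
      finally show ?thesis by blast
    qed
    then have "\<exists>j. s ^ j *s (s ^ k *s \<phi> m - c *s m) \<in> K" if "m \<in> G" for m
      using G(2) that by blast
    then obtain j where j: "\<And>m. m \<in> G \<Longrightarrow> s ^ j *s (s ^ k *s \<phi> m - c *s m) \<in> K"
      by (rule uniform_exponent[where P="\<lambda>m j. s ^ j *s (s ^ k *s \<phi> m - c *s m) \<in> K", OF G(1)])
        (auto intro: power_scale_in_mono[OF K(1)])
    have "N \<subseteq> {m. s ^ j *s (s ^ k *s \<phi> m - c *s m) \<in> K}" (is "_ \<subseteq> ?M")
    proof -
      have "subspace ?M"
      proof (rule subspaceI)
        show "0 \<in> ?M" using subspace_0[OF K(1)] by simp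
        show "x + y \<in> ?M" if "x \<in> ?M" "y \<in> ?M" for x y
        proof -
          have "s ^ j *s (s ^ k *s \<phi> (x + y) - c *s (x + y))
             = s ^ j *s (s ^ k *s \<phi> x - c *s x) + s ^ j *s (s ^ k *s \<phi> y - c *s y)"
            by (simp add: \<phi>.add algebra_simps)
          then show ?thesis using that subspace_add[OF K(1)] by simp
        qed
        show "b *s x \<in> ?M" if "x \<in> ?M" for x b
        proof -
          have "s ^ j *s (s ^ k *s \<phi> (b *s x) - c *s (b *s x)) = b *s (s ^ j *s (s ^ k *s \<phi> x - c *s x))"
            by (simp add: \<phi>.scale scale_right_diff_distrib ac_simps)
          then show ?thesis using subspace_scale[OF K(1) that[unfolded mem_Collect_eq], of b]
            by (simp only: mem_Collect_eq)
        qed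
      qed
      moreover have "G \<union> K \<subseteq> ?M"
      proof (rule Un_least)
        show "G \<subseteq> ?M" using j by blast
        show "K \<subseteq> ?M"
        proof
          fix x assume x: "x \<in> K"
          then have "\<phi> x \<in> K" using \<phi>K by blast
          then show "x \<in> ?M" using x subspace_scale[OF K(1)] subspace_diff[OF K(1)] by simp
        qed
      qed
      ultimately show ?thesis using G(3) span_minimal by blast
    qed
    then have "\<forall>m\<in>N. s ^ (j + k) *s \<phi> m - (s ^ j * c) *s m \<in> K"
      by (auto simp: power_add scale_right_diff_distrib)
    then show "\<exists>k. s ^ k \<in> ?A" by blast
  qed
  then show ?thesis by simp
qed

end

section \<open>Duality between invertible quotients and lines\<close>

text \<open>Local freeness of a quotient is not affected by replacing both modules by their preimages under a
  linear map onto the numerator.\<close>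

context module_hom
begin

lemma free_at_preimage:
  assumes r1: "ring_module s1" and r2: "ring_module s2"
    and N: "N' = f ` N" and K: "K = {x \<in> N. f x \<in> K'}" and sN: "m1.subspace N"
  shows "ring_module.free_at s1 N K r s \<longleftrightarrow> ring_module.free_at s2 N' K' r s"
proof -
  interpret r1: ring_module s1 by fact
  interpret r2: ring_module s2 by fact
  have comb: "f (\<Sum>i<r. s1 (c i) (e i)) = (\<Sum>i<r. s2 (c i) (f (e i)))" for c e
    by (simp add: sum scale)
  have inN: "(\<Sum>i<r. s1 (c i) (e i)) \<in> N" if "e \<in> {..<r} \<rightarrow> N" for c e
    using that by (intro m1.subspace_sum[OF sN] m1.subspace_scale[OF sN]) auto
  have step: "(\<forall>m\<in>N. \<exists>k c. s1 (s ^ k) m - (\<Sum>i<r. s1 (c i) (e i)) \<in> K) \<longleftrightarrow>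
        (\<forall>m\<in>N'. \<exists>k c. s2 (s ^ k) m - (\<Sum>i<r. s2 (c i) (f (e i))) \<in> K')"
      "(\<Sum>i<r. s1 (c i) (e i)) \<in> K \<longleftrightarrow> (\<Sum>i<r. s2 (c i) (f (e i))) \<in> K'"
    if e: "e \<in> {..<r} \<rightarrow> N" for e c
  proof -
    have "s1 (s ^ k) m - (\<Sum>i<r. s1 (c i) (e i)) \<in> K \<longleftrightarrow>
        s2 (s ^ k) (f m) - (\<Sum>i<r. s2 (c i) (f (e i))) \<in> K'" if m: "m \<in> N" for m k c
      using m1.subspace_diff[OF sN m1.subspace_scale[OF sN m] inN[OF e]]
      by (simp add: K diff comb scale)
    then show "(\<forall>m\<in>N. \<exists>k c. s1 (s ^ k) m - (\<Sum>i<r. s1 (c i) (e i)) \<in> K) \<longleftrightarrow>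
        (\<forall>m\<in>N'. \<exists>k c. s2 (s ^ k) m - (\<Sum>i<r. s2 (c i) (f (e i))) \<in> K')"
      unfolding N by simp
    show "(\<Sum>i<r. s1 (c i) (e i)) \<in> K \<longleftrightarrow> (\<Sum>i<r. s2 (c i) (f (e i))) \<in> K'"
      using inN[OF e] by (simp add: K comb)
  qed
  show ?thesis
  proof
    assume "r1.free_at N K r s"
    then obtain e where e: "e \<in> {..<r} \<rightarrow> N"
      and gen: "\<forall>m\<in>N. \<exists>k c. s1 (s ^ k) m - (\<Sum>i<r. s1 (c i) (e i)) \<in> K"
      and ind: "\<forall>c. (\<Sum>i<r. s1 (c i) (e i)) \<in> K \<longrightarrow> (\<exists>k. \<forall>i<r. s ^ k * c i = 0)"
      unfolding r1.free_at_def by blast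
    show "r2.free_at N' K' r s"
      unfolding r2.free_at_def
    proof (intro bexI[of _ "\<lambda>i. f (e i)"] conjI)
      show "\<forall>m\<in>N'. \<exists>k c. s2 (s ^ k) m - (\<Sum>i<r. s2 (c i) (f (e i))) \<in> K'"
        using gen step(1)[OF e] by blast
      show "\<forall>c. (\<Sum>i<r. s2 (c i) (f (e i))) \<in> K' \<longrightarrow> (\<exists>k. \<forall>i<r. s ^ k * c i = 0)"
        using ind step(2)[OF e] by blast
    qed (use e N in auto)
  next
    assume "r2.free_at N' K' r s"
    then obtain e' where e': "e' \<in> {..<r} \<rightarrow> N'"
      and gen: "\<forall>m\<in>N'. \<exists>k c. s2 (s ^ k) m - (\<Sum>i<r. s2 (c i) (e' i)) \<in> K'"
      and ind: "\<forall>c. (\<Sum>i<r. s2 (c i) (e' i)) \<in> K' \<longrightarrow> (\<exists>k. \<forall>i<r. s ^ k * c i = 0)"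
      unfolding r2.free_at_def by blast
    have "\<forall>i\<in>{..<r}. \<exists>x\<in>N. f x = e' i"
    proof
      fix i assume "i \<in> {..<r}"
      then have "e' i \<in> f ` N" using e' N by blast
      then show "\<exists>x\<in>N. f x = e' i" by (metis imageE)
    qed
    then obtain e where e: "\<And>i. i \<in> {..<r} \<Longrightarrow> e i \<in> N \<and> f (e i) = e' i" by metis
    then have eN: "e \<in> {..<r} \<rightarrow> N" by blast
    have fe: "(\<Sum>i<r. s2 (c i) (e' i)) = (\<Sum>i<r. s2 (c i) (f (e i)))" for c
      using e by (intro sum.cong) auto
    show "r1.free_at N K r s"
      unfolding r1.free_at_def
    proof (intro bexI[OF _ eN] conjI)
      show "\<forall>m\<in>N. \<exists>k c. s1 (s ^ k) m - (\<Sum>i<r. s1 (c i) (e i)) \<in> K"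
        using gen unfolding fe step(1)[OF eN] .
      show "\<forall>c. (\<Sum>i<r. s1 (c i) (e i)) \<in> K \<longrightarrow> (\<exists>k. \<forall>i<r. s ^ k * c i = 0)"
        using ind unfolding fe step(2)[OF eN] .
    qed
  qed
qed

lemma lf_preimage:
  assumes "ring_module s1" "ring_module s2" "N' = f ` N" "K = {x \<in> N. f x \<in> K'}" "m1.subspace N"
  shows "ring_module.lf s1 N K r \<longleftrightarrow> ring_module.lf s2 N' K' r"
  unfolding ring_module.lf_def[OF assms(1)] ring_module.lf_def[OF assms(2)]
    free_at_preimage[OF assms] ..

end

definition vscale :: "'a::comm_ring_1 \<Rightarrow> (nat \<Rightarrow> 'a) \<Rightarrow> nat \<Rightarrow> 'a" where
  "vscale a v = (\<lambda>i. a * v i)"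

lemma vscale_apply [simp]: "vscale a v i = a * v i"
  by (simp add: vscale_def)

lemma sum_apply: "(\<Sum>x\<in>F. g x) i = (\<Sum>x\<in>F. g x i)"
  by (induction F rule: infinite_finite_induct) auto

interpretation vec: ring_module vscale
  by standard (auto simp: fun_eq_iff algebra_simps)

text \<open>The free module \<open>A\<^sup>d\<close> consists of the sequences that vanish from index \<open>d\<close> on.\<close>

definition vecs :: "nat \<Rightarrow> (nat \<Rightarrow> 'a::comm_ring_1) set" where
  "vecs d = {v. \<forall>i\<ge>d. v i = 0}"

definition unitv :: "nat \<Rightarrow> nat \<Rightarrow> 'a::comm_ring_1" where
  "unitv i = (\<lambda>j. if j = i then 1 else 0)"

definition dot :: "nat \<Rightarrow> (nat \<Rightarrow> 'a::comm_ring_1) \<Rightarrow> (nat \<Rightarrow> 'a) \<Rightarrow> 'a" where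
  "dot d a b = (\<Sum>i<d. a i * b i)"

lemma subspace_vecs: "vec.subspace (vecs d)"
  by (rule vec.subspaceI) (auto simp: vecs_def)

lemma unitv_in_vecs: "i < d \<Longrightarrow> unitv i \<in> vecs d"
  by (auto simp: vecs_def unitv_def)

lemma vec_expand:
  assumes "v \<in> vecs d"
  shows "(\<Sum>i<d. vscale (v i) (unitv i)) = v"
proof
  fix j
  have "(\<Sum>i<d. vscale (v i) (unitv i)) j = (\<Sum>i<d. if j = i then v i else 0)"
    unfolding sum_apply by (intro sum.cong) (auto simp: unitv_def)
  also have "\<dots> = v j" using assms by (auto simp: vecs_def)
  finally show "(\<Sum>i<d. vscale (v i) (unitv i)) j = v j" .
qed

lemma dot_add_left: "dot d (a + b) c = dot d a c + dot d b c"
  and dot_add_right: "dot d a (b + c) = dot d a b + dot d a c"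
  and dot_scale_left: "dot d (vscale x a) b = x * dot d a b"
  and dot_scale_right: "dot d a (vscale x b) = x * dot d a b"
  and dot_diff_right: "dot d a (b - c) = dot d a b - dot d a c"
  and dot_diff_left: "dot d (a - b) c = dot d a c - dot d b c"
  and dot_zero_left: "dot d 0 c = 0"
  and dot_zero_right: "dot d c 0 = 0"
  by (simp_all add: dot_def algebra_simps sum.distrib sum_distrib_left sum_subtractf)

lemmas dot_linear = dot_add_left dot_add_right dot_scale_left dot_scale_right dot_diff_right
  dot_diff_left dot_zero_left dot_zero_right

lemma dot_commute: "dot d a b = dot d b a"
  by (simp add: dot_def mult.commute)

lemma dot_unitv: "i < d \<Longrightarrow> dot d a (unitv i) = a i"
  by (simp add: dot_def unitv_def if_distrib sum.If_cases cong: if_cong)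

lemma vec_eqI: "a \<in> vecs d \<Longrightarrow> b \<in> vecs d \<Longrightarrow> (\<And>v. v \<in> vecs d \<Longrightarrow> dot d a v = dot d b v) \<Longrightarrow> a = b"
proof
  fix i assume a: "a \<in> vecs d" "b \<in> vecs d" and eq: "\<And>v. v \<in> vecs d \<Longrightarrow> dot d a v = dot d b v"
  show "a i = b i"
  proof (cases "i < d")
    case True
    then show ?thesis using eq[OF unitv_in_vecs[OF True]] by (simp add: dot_unitv)
  qed (use a in \<open>auto simp: vecs_def\<close>)
qed

definition perp :: "nat \<Rightarrow> (nat \<Rightarrow> 'a::comm_ring_1) set \<Rightarrow> (nat \<Rightarrow> 'a) set" where
  "perp d K = {l \<in> vecs d. \<forall>v\<in>K. dot d l v = 0}"

lemma subspace_perp: "vec.subspace (perp d K)"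
  by (rule vec.subspaceI) (auto simp: perp_def dot_linear vec.subspace_0[OF subspace_vecs]
      vec.subspace_add[OF subspace_vecs] vec.subspace_scale[OF subspace_vecs])

text \<open>For \<open>\<sigma>\<close> in this set, \<open>A\<^sup>d\<close> splits over \<open>A[1/\<sigma>]\<close> as the sum of \<open>K\<close> and the line through \<open>e\<close>, with
  \<open>\<sigma>\<inverse> c\<close> the coordinate on that line.\<close>

definition splittings ::
    "nat \<Rightarrow> (nat \<Rightarrow> 'a::comm_ring_1) set \<Rightarrow> (nat \<Rightarrow> 'a) set \<Rightarrow> 'a set" where
  "splittings d K L = {\<sigma>. \<exists>c\<in>L. \<exists>e\<in>vecs d. dot d c e = \<sigma> \<and>
     (\<forall>v\<in>vecs d. vscale \<sigma> v - vscale (dot d c v) e \<in> K)}"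

text \<open>Local splittings determine each of \<open>K\<close> and \<open>L\<close> as the orthogonal of the other. All properties of
  invertible quotients and of lines are derived from this one symmetric description.\<close>

definition dual_pair :: "nat \<Rightarrow> (nat \<Rightarrow> 'a::comm_ring_1) set \<Rightarrow> (nat \<Rightarrow> 'a) set \<Rightarrow> bool" where
  "dual_pair d K L \<longleftrightarrow> vec.subspace K \<and> K \<subseteq> vecs d \<and> vec.subspace L \<and> L \<subseteq> vecs d \<and>
     (\<forall>l\<in>L. \<forall>v\<in>K. dot d l v = 0) \<and> 1 \<in> rg.span (splittings d K L)"

text \<open>Pair both sides with \<open>v\<close> and use that \<open>l\<close> is orthogonal to \<open>\<sigma> v - (c \<cdot> v) e\<close>.\<close>

lemma splitting_line:
  assumes dp: "dual_pair d K L" and ce: "c \<in> L" "e \<in> vecs d"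
      "\<forall>v\<in>vecs d. vscale (dot d c e) v - vscale (dot d c v) e \<in> K"
    and l: "l \<in> vecs d" "\<forall>v\<in>K. dot d l v = 0"
  shows "vscale (dot d c e) l = vscale (dot d l e) c"
proof (rule vec_eqI)
  have cv: "c \<in> vecs d" using dp ce by (auto simp: dual_pair_def)
  show "vscale (dot d c e) l \<in> vecs d" "vscale (dot d l e) c \<in> vecs d"
    using l cv vec.subspace_scale[OF subspace_vecs] by auto
  fix v :: "nat \<Rightarrow> 'a" assume "v \<in> vecs d"
  then have "dot d l (vscale (dot d c e) v - vscale (dot d c v) e) = 0" using ce l by blast
  then show "dot d (vscale (dot d c e) l) v = dot d (vscale (dot d l e) c) v"
    by (simp add: dot_linear mult.commute)
qed

lemma dual_pair_perp:
  assumes dp: "dual_pair d K L"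
  shows "L = perp d K" "K = perp d L"
proof -
  show "L = perp d K"
  proof (intro equalityI subsetI)
    fix l assume "l \<in> perp d K"
    then have l: "l \<in> vecs d" "\<forall>v\<in>K. dot d l v = 0" by (auto simp: perp_def)
    show "l \<in> L"
    proof (rule vec.membership_local)
      show "1 \<in> rg.span (splittings d K L)" "vec.subspace L" using dp by (auto simp: dual_pair_def)
      fix \<sigma> assume "\<sigma> \<in> splittings d K L"
      then obtain c e where ce: "c \<in> L" "e \<in> vecs d" "dot d c e = \<sigma>"
        "\<forall>v\<in>vecs d. vscale (dot d c e) v - vscale (dot d c v) e \<in> K"
        by (auto simp: splittings_def)
      have "vscale (\<sigma> ^ 1) l = vscale (dot d l e) c"
        using splitting_line[OF dp ce(1,2,4) l] ce(3) by simp
      also have "\<dots> \<in> L" using ce dp by (intro vec.subspace_scale) (auto simp: dual_pair_def)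
      finally show "\<exists>k. vscale (\<sigma> ^ k) l \<in> L" by blast
    qed
  qed (use dp in \<open>auto simp: dual_pair_def perp_def\<close>)
  show "K = perp d L"
  proof (intro equalityI subsetI)
    fix v assume "v \<in> perp d L"
    then have v: "v \<in> vecs d" "\<forall>l\<in>L. dot d l v = 0" by (auto simp: perp_def dot_commute)
    show "v \<in> K"
    proof (rule vec.membership_local)
      show "1 \<in> rg.span (splittings d K L)" "vec.subspace K" using dp by (auto simp: dual_pair_def)
      fix \<sigma> assume "\<sigma> \<in> splittings d K L"
      then obtain c e where ce: "c \<in> L" "vscale \<sigma> v - vscale (dot d c v) e \<in> K"
        using v by (auto simp: splittings_def)
      then have "vscale (\<sigma> ^ 1) v \<in> K" using v by simp
      then show "\<exists>k. vscale (\<sigma> ^ k) v \<in> K" by blast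
    qed
  next
    fix v assume v: "v \<in> K"
    have "dot d v l = 0" if "l \<in> L" for l
      unfolding dot_commute[of d v] using dp v that by (simp add: dual_pair_def)
    then show "v \<in> perp d L" using dp v by (auto simp: dual_pair_def perp_def)
  qed
qed

text \<open>The vectors \<open>e\<close> generate the quotient locally, and \<open>c\<close> shows that they are independent.\<close>

lemma dual_pair_quotient:
  assumes dp: "dual_pair d K L"
  shows "vec.lf (vecs d) K 1"
proof -
  have "splittings d K L \<subseteq> {s. vec.free_at (vecs d) K 1 s}"
  proof
    fix \<sigma> assume "\<sigma> \<in> splittings d K L"
    then obtain c e where ce: "c \<in> L" "e \<in> vecs d" "dot d c e = \<sigma>"
      "\<forall>v\<in>vecs d. vscale \<sigma> v - vscale (dot d c v) e \<in> K"
      by (auto simp: splittings_def)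
    have "\<exists>k a. vscale (\<sigma> ^ k) v - vscale a e \<in> K" if "v \<in> vecs d" for v
      using ce(4) that by (metis power_one_right)
    moreover have "\<exists>k. \<sigma> ^ k * a = 0" if "vscale a e \<in> K" for a
    proof -
      have "dot d c (vscale a e) = 0" using dp ce that by (auto simp: dual_pair_def)
      then show ?thesis using ce(3) by (intro exI[of _ 1]) (simp add: dot_linear mult.commute)
    qed
    ultimately have "vec.free_at (vecs d) K 1 \<sigma>"
      unfolding vec.free_at_1 using ce(2) by blast
    then show "\<sigma> \<in> {s. vec.free_at (vecs d) K 1 s}" by blast
  qed
  then show ?thesis using rg.span_mono dp unfolding vec.lf_def dual_pair_def by blast
qed

text \<open>By the identity \<open>\<sigma> l = (l \<cdot> e) c\<close>, the vectors \<open>c\<close> are local generators of \<open>L\<close>.\<close>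

lemma dual_pair_line:
  assumes dp: "dual_pair d K L"
  shows "vec.lf L {0} 1"
proof -
  have "splittings d K L \<subseteq> {s. vec.free_at L {0} 1 s}"
  proof
    fix \<sigma> assume "\<sigma> \<in> splittings d K L"
    then obtain c e where ce: "c \<in> L" "e \<in> vecs d" "dot d c e = \<sigma>"
      "\<forall>v\<in>vecs d. vscale (dot d c e) v - vscale (dot d c v) e \<in> K"
      by (auto simp: splittings_def)
    have "\<exists>k a. vscale (\<sigma> ^ k) l - vscale a c \<in> {0}" if "l \<in> L" for l
    proof -
      have "vscale (dot d c e) l = vscale (dot d l e) c"
        by (rule splitting_line[OF dp ce(1,2,4)]) (use that dp in \<open>auto simp: dual_pair_def\<close>)
      then have "vscale (\<sigma> ^ 1) l - vscale (dot d l e) c \<in> {0}" using ce(3) by simp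
      then show ?thesis by blast
    qed
    moreover have "\<exists>k. \<sigma> ^ k * a = 0" if "vscale a c \<in> {0}" for a
    proof -
      have "dot d (vscale a c) e = 0" using that by (simp add: dot_linear)
      then show ?thesis using ce(3) by (intro exI[of _ 1]) (simp add: dot_linear mult.commute)
    qed
    ultimately have "vec.free_at L {0} 1 \<sigma>"
      unfolding vec.free_at_1 using ce(1) by blast
    then show "\<sigma> \<in> {s. vec.free_at L {0} 1 s}" by blast
  qed
  then show ?thesis using rg.span_mono dp unfolding vec.lf_def dual_pair_def by blast
qed

text \<open>If \<open>1\<close> is the sum of the \<open>r \<sigma> * \<sigma>\<close>, then the sum of the maps \<open>v \<mapsto> r \<sigma> (v \<cdot> e) c\<close> is a projection onto
  \<open>L\<close>, and its kernel is a complement.\<close>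

lemma dual_pair_summand:
  assumes dp: "dual_pair d K L"
  shows "\<exists>L'. vec.subspace L' \<and> L' \<subseteq> vecs d \<and> L \<inter> L' = {0} \<and> {x + y | x y. x \<in> L \<and> y \<in> L'} = vecs d"
proof -
  have sL: "vec.subspace L" and Lv: "L \<subseteq> vecs d" using dp by (auto simp: dual_pair_def)
  have "1 \<in> rg.span (splittings d K L)" using dp by (simp add: dual_pair_def)
  then obtain F r where F: "finite F" "F \<subseteq> splittings d K L" and one: "1 = (\<Sum>a\<in>F. r a * a)"
    unfolding rg.span_explicit by blast
  have "\<forall>\<sigma>\<in>F. \<exists>c e. c \<in> L \<and> e \<in> vecs d \<and> dot d c e = \<sigma> \<and>
     (\<forall>v\<in>vecs d. vscale (dot d c e) v - vscale (dot d c v) e \<in> K)"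
    using F unfolding splittings_def by fastforce
  then obtain c e where ce: "\<And>\<sigma>. \<sigma> \<in> F \<Longrightarrow> c \<sigma> \<in> L \<and> e \<sigma> \<in> vecs d \<and> dot d (c \<sigma>) (e \<sigma>) = \<sigma> \<and>
     (\<forall>v\<in>vecs d. vscale (dot d (c \<sigma>) (e \<sigma>)) v - vscale (dot d (c \<sigma>) v) (e \<sigma>) \<in> K)"
    by metis
  define P where "P v = (\<Sum>\<sigma>\<in>F. vscale (r \<sigma> * dot d v (e \<sigma>)) (c \<sigma>))" for v
  have PL: "P v \<in> L" for v
    unfolding P_def using ce by (intro vec.subspace_sum[OF sL] vec.subspace_scale[OF sL]) auto
  have Pid: "P l = l" if l: "l \<in> L" for l
  proof -
    have "vscale (r \<sigma> * dot d l (e \<sigma>)) (c \<sigma>) = vscale (r \<sigma> * \<sigma>) l" if "\<sigma> \<in> F" for \<sigma>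
    proof -
      have "vscale (dot d (c \<sigma>) (e \<sigma>)) l = vscale (dot d l (e \<sigma>)) (c \<sigma>)"
        by (rule splitting_line[OF dp]) (use ce[OF that] l dp in \<open>auto simp: dual_pair_def\<close>)
      then have "vscale \<sigma> l = vscale (dot d l (e \<sigma>)) (c \<sigma>)" using ce[OF that] by simp
      then show ?thesis by (simp flip: vec.scale_scale)
    qed
    then have "P l = (\<Sum>\<sigma>\<in>F. vscale (r \<sigma> * \<sigma>) l)" unfolding P_def by (rule sum.cong[OF refl])
    also have "\<dots> = l" by (simp flip: vec.scale_sum_left one)
    finally show ?thesis .
  qed
  have Padd: "P (x + y) = P x + P y" for x y
    by (simp add: P_def dot_linear distrib_left vec.scale_left_distrib sum.distrib)
  have Pscale: "P (vscale a x) = vscale a (P x)" for x a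
    by (simp add: P_def dot_linear vec.scale_sum_right mult.left_commute)
  have P0: "P 0 = 0" by (simp add: P_def dot_linear)
  let ?L' = "{v \<in> vecs d. P v = 0}"
  show ?thesis
  proof (intro exI[of _ ?L'] conjI)
    show "vec.subspace ?L'"
      by (rule vec.subspaceI) (auto simp: Padd Pscale P0 vec.subspace_0[OF subspace_vecs]
          vec.subspace_add[OF subspace_vecs] vec.subspace_scale[OF subspace_vecs])
    show "L \<inter> ?L' = {0}"
      using Pid P0 vec.subspace_0[OF sL] vec.subspace_0[OF subspace_vecs] by fastforce
    show "{x + y | x y. x \<in> L \<and> y \<in> ?L'} = vecs d"
    proof (intro equalityI subsetI)
      fix v :: "nat \<Rightarrow> 'a" assume v: "v \<in> vecs d"
      have "P (v - P v) + P (P v) = P v" by (simp flip: Padd)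
      then have "P (v - P v) = 0" using Pid[OF PL] by simp
      then have "v - P v \<in> ?L'" using v PL Lv vec.subspace_diff[OF subspace_vecs] by blast
      moreover have "v = P v + (v - P v)" by simp
      ultimately show "v \<in> {x + y | x y. x \<in> L \<and> y \<in> ?L'}" using PL by blast
    qed (use Lv vec.subspace_add[OF subspace_vecs] in auto)
  qed auto
qed

text \<open>A local generator \<open>e\<close> of \<open>A\<^sup>d/K\<close> gives coordinates \<open>c\<close> with \<open>s ^ k v - (c \<cdot> v) e \<in> K\<close>. On \<open>K\<close> the functional
  \<open>c\<close> vanishes only after multiplication by a power of \<open>s\<close> that depends on the element. Since \<open>K\<close> is
  finitely generated, one power \<open>s ^ j\<close> suffices, and \<open>s ^ j c\<close> lies in the orthogonal of \<open>K\<close>.\<close>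

lemma dual_pair_of_quotient:
  assumes sK: "vec.subspace K" and KN: "K \<subseteq> vecs d" and lf: "vec.lf (vecs d) K 1"
  shows "dual_pair d K (perp d K)"
proof -
  let ?U = "{s. vec.free_at (vecs d) K 1 s}"
  have local: "\<exists>e k c. e \<in> vecs d \<and> c \<in> vecs d \<and>
       (\<forall>v\<in>vecs d. vscale (s ^ k) v - vscale (dot d c v) e = (\<Sum>i<d. vscale (v i) (vscale (s ^ k) (unitv i) - vscale (c i) e))) \<and>
       (\<forall>i<d. vscale (s ^ k) (unitv i) - vscale (c i) e \<in> K) \<and>
       (\<forall>a. vscale a e \<in> K \<longrightarrow> (\<exists>k. s ^ k * a = 0))" if s: "s \<in> ?U" for s
  proof -
    obtain e where e: "e \<in> vecs d" and gen: "\<And>m. m \<in> vecs d \<Longrightarrow> \<exists>k c. vscale (s ^ k) m - vscale c e \<in> K"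
      and ind: "\<And>c. vscale c e \<in> K \<Longrightarrow> \<exists>k. s ^ k * c = 0"
      using s unfolding mem_Collect_eq vec.free_at_1 by blast
    obtain k where k: "\<And>i. i \<in> {..<d} \<Longrightarrow> \<exists>c. vscale (s ^ k) (unitv i) - vscale c e \<in> K"
    proof (rule uniform_exponent[of "{..<d}" "\<lambda>i k. \<exists>c. vscale (s ^ k) (unitv i) - vscale c e \<in> K"])
      show "\<exists>k c. vscale (s ^ k) (unitv i) - vscale c e \<in> K" if "i \<in> {..<d}" for i
        using gen[OF unitv_in_vecs] that by simp
      show "\<exists>c. vscale (s ^ k') (unitv i) - vscale c e \<in> K"
        if "\<exists>c. vscale (s ^ k) (unitv i) - vscale c e \<in> K" "k \<le> k'" for i k k'
      proof -
        obtain c where "vscale (s ^ k) (unitv i) - vscale c e \<in> K" using \<open>\<exists>c. _ c\<close> by blast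
        then show ?thesis
          using vec.power_scale_mono[where I="{0::nat}" and x="unitv i" and c="\<lambda>_. c" and e="\<lambda>_. e"
                and s=s and k=k, OF sK _ that(2)]
          by auto
      qed
    qed auto
    then obtain c' where c': "\<And>i. i < d \<Longrightarrow> vscale (s ^ k) (unitv i) - vscale (c' i) e \<in> K"
      by (metis lessThan_iff)
    define c where "c i = (if i < d then c' i else 0)" for i
    have c: "vscale (s ^ k) (unitv i) - vscale (c i) e \<in> K" if "i < d" for i
      using c'[OF that] that by (simp add: c_def)
    have "vscale (s ^ k) v - vscale (dot d c v) e
        = (\<Sum>i<d. vscale (v i) (vscale (s ^ k) (unitv i) - vscale (c i) e))" if v: "v \<in> vecs d" for v
    proof -
      have "(\<Sum>i<d. vscale (v i) (vscale (s ^ k) (unitv i) - vscale (c i) e))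
          = (\<Sum>i<d. vscale (s ^ k) (vscale (v i) (unitv i))) - (\<Sum>i<d. vscale (c i * v i) e)"
        by (simp add: vec.scale_right_diff_distrib sum_subtractf mult.commute)
      also have "(\<Sum>i<d. vscale (s ^ k) (vscale (v i) (unitv i))) = vscale (s ^ k) v"
        unfolding vec.scale_sum_right[symmetric] vec_expand[OF v] ..
      finally show ?thesis unfolding dot_def vec.scale_sum_left by (rule sym)
    qed
    moreover have "c \<in> vecs d" by (auto simp: vecs_def c_def)
    ultimately show ?thesis using e c ind by blast
  qed
  obtain G where G: "finite G" "G \<subseteq> K" "K \<subseteq> vec.span (G \<union> {})"
  proof (rule vec.finitely_generated_local[OF lf[unfolded vec.lf_def], of K "{}"])
    fix s assume "s \<in> ?U"
    from local[OF this] obtain e k c where e: "e \<in> vecs d"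
      and eq: "\<And>v. v\<in>vecs d \<Longrightarrow> vscale (s ^ k) v - vscale (dot d c v) e = (\<Sum>i<d. vscale (v i) (vscale (s ^ k) (unitv i) - vscale (c i) e))"
      and c: "\<And>i. i<d \<Longrightarrow> vscale (s ^ k) (unitv i) - vscale (c i) e \<in> K"
      and ind: "\<And>a. vscale a e \<in> K \<Longrightarrow> \<exists>k. s ^ k * a = 0" by blast
    let ?G = "(\<lambda>i. vscale (s ^ k) (unitv i) - vscale (c i) e) ` {..<d}"
    have "\<exists>k. vscale (s ^ k) v \<in> vec.span (?G \<union> {})" if v: "v \<in> K" for v
    proof -
      have vv: "v \<in> vecs d" using v KN by blast
      have "vscale (dot d c v) e = vscale (s ^ k) v - (vscale (s ^ k) v - vscale (dot d c v) e)" by simp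
      also have "\<dots> \<in> K" unfolding eq[OF vv]
        by (intro vec.subspace_diff[OF sK] vec.subspace_sum[OF sK] vec.subspace_scale[OF sK] v c) auto
      finally obtain j where j: "s ^ j * dot d c v = 0" using ind by blast
      have "vscale (s ^ (j + k)) v = vscale (s ^ j) (vscale (s ^ k) v - vscale (dot d c v) e)"
        using j by (simp add: vec.scale_right_diff_distrib power_add)
      also have "\<dots> \<in> vec.span ?G" unfolding eq[OF vv]
        by (intro vec.span_scale vec.span_sum vec.span_base) auto
      finally show ?thesis by auto
    qed
    then show "\<exists>G. finite G \<and> G \<subseteq> K \<and> (\<forall>m\<in>K. \<exists>k. vscale (s ^ k) m \<in> vec.span (G \<union> {}))"
      using c by (intro exI[of _ ?G]) auto
  qed
  have "1 \<in> rg.span (splittings d K (perp d K))"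
  proof (rule local_principle[OF lf[unfolded vec.lf_def] rg.subspace_span])
    fix s assume "s \<in> ?U"
    from local[OF this] obtain e k c where e: "e \<in> vecs d" and cv: "c \<in> vecs d"
      and eq: "\<And>v. v\<in>vecs d \<Longrightarrow> vscale (s ^ k) v - vscale (dot d c v) e = (\<Sum>i<d. vscale (v i) (vscale (s ^ k) (unitv i) - vscale (c i) e))"
      and c: "\<And>i. i<d \<Longrightarrow> vscale (s ^ k) (unitv i) - vscale (c i) e \<in> K"
      and ind: "\<And>a. vscale a e \<in> K \<Longrightarrow> \<exists>k. s ^ k * a = 0" by blast
    have eqK: "vscale (s ^ k) v - vscale (dot d c v) e \<in> K" if "v \<in> vecs d" for v
      unfolding eq[OF that]
      by (intro vec.subspace_sum[OF sK] vec.subspace_scale[OF sK] c) auto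
    have "\<exists>j. s ^ j * dot d c v = 0" if v: "v \<in> K" for v
    proof (rule ind)
      have vv: "v \<in> vecs d" using v KN by blast
      have "vscale (dot d c v) e = vscale (s ^ k) v - (vscale (s ^ k) v - vscale (dot d c v) e)" by simp
      also have "\<dots> \<in> K" by (intro vec.subspace_diff[OF sK] vec.subspace_scale[OF sK] v eqK[OF vv])
      finally show "vscale (dot d c v) e \<in> K" .
    qed
    then obtain j where j: "\<And>v. v \<in> G \<Longrightarrow> s ^ j * dot d c v = 0"
      using G(2) by (rule_tac uniform_exponent[where P="\<lambda>v j. s ^ j * dot d c v = 0", OF G(1)])
        (auto intro: power_zero_mono)
    have j: "s ^ j * dot d c v = 0" if "v \<in> K" for v
    proof -
      have "v \<in> vec.span G" using that G(3) by auto
      then show ?thesis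
        by (induction rule: vec.span_induct_alt)
          (simp_all only: dot_linear j distrib_left mult.left_commute[of "s ^ j"] mult_zero_right add_0)
    qed
    have "vscale (s ^ k - dot d c e) e \<in> K" using eqK[OF e] by (simp add: vec.scale_left_diff_distrib)
    then obtain q where q: "s ^ q * (s ^ k - dot d c e) = 0" using ind by blast
    \<comment> \<open>The factor \<open>s ^ j\<close> makes \<open>c\<close> orthogonal to \<open>K\<close>, and \<open>s ^ q\<close> makes its value at \<open>e\<close> a power of \<open>s\<close>.\<close>
    define c2 where "c2 = vscale (s ^ (q + j)) c"
    have dotc2: "dot d c2 v = s ^ (q + j) * dot d c v" for v by (simp add: c2_def dot_linear)
    have "s ^ q * dot d c e = s ^ (q + k)" using q by (simp add: right_diff_distrib power_add)
    then have dot_e: "dot d c2 e = s ^ (q + j + k)"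
      by (simp add: dotc2 power_add ac_simps)
    have "c2 \<in> perp d K"
      using j cv by (auto simp: perp_def dotc2 power_add mult.assoc)
        (auto simp: c2_def vec.subspace_scale[OF subspace_vecs])
    moreover have "vscale (s ^ (q + j + k)) v - vscale (dot d c2 v) e \<in> K" if "v \<in> vecs d" for v
      using vec.subspace_scale[OF sK eqK[OF that], of "s ^ (q + j)"]
      by (simp add: dotc2 vec.scale_right_diff_distrib power_add)
    ultimately have "s ^ (q + j + k) \<in> splittings d K (perp d K)"
      unfolding splittings_def using e dot_e by blast
    then show "\<exists>k. s ^ k \<in> rg.span (splittings d K (perp d K))" using rg.span_base by blast
  qed
  then show ?thesis using sK KN subspace_perp[of d K] by (auto simp: dual_pair_def perp_def)
qed

text \<open>The projection of \<open>A\<^sup>d\<close> to \<open>L\<close> sends the unit vectors to elements \<open>x i\<close>. Expressing these by a local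
  generator \<open>c\<close> of \<open>L\<close> gives the coordinates of the vector \<open>e\<close>.\<close>

lemma dual_pair_of_summand:
  assumes sL: "vec.subspace L" and LN: "L \<subseteq> vecs d" and lf: "vec.lf L {0} 1"
    and sL': "vec.subspace L'" and int: "L \<inter> L' = {0}" and sum: "{x + y | x y. x \<in> L \<and> y \<in> L'} = vecs d"
  shows "dual_pair d (perp d L) L"
proof -
  have "\<forall>i<d. \<exists>x y. x \<in> L \<and> y \<in> L' \<and> unitv i = x + y" using unitv_in_vecs sum by blast
  then obtain x y where xy: "\<And>i. i < d \<Longrightarrow> x i \<in> L \<and> y i \<in> L' \<and> unitv i = x i + y i" by metis
  have P: "(\<Sum>i<d. vscale (l i) (x i)) = l" if l: "l \<in> L" for l
  proof -
    have "l = (\<Sum>i<d. vscale (l i) (unitv i))" using vec_expand l LN by fastforce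
    also have "\<dots> = (\<Sum>i<d. vscale (l i) (x i)) + (\<Sum>i<d. vscale (l i) (y i))"
      using xy by (simp add: sum.distrib[symmetric] vec.scale_right_distrib[symmetric])
    finally have eq: "l - (\<Sum>i<d. vscale (l i) (x i)) = (\<Sum>i<d. vscale (l i) (y i))" by (simp add: algebra_simps)
    have "(\<Sum>i<d. vscale (l i) (y i)) \<in> L'"
      using xy by (intro vec.subspace_sum[OF sL'] vec.subspace_scale[OF sL']) auto
    moreover have "l - (\<Sum>i<d. vscale (l i) (x i)) \<in> L"
      using xy l by (intro vec.subspace_diff[OF sL] vec.subspace_sum[OF sL] vec.subspace_scale[OF sL]) auto
    ultimately have "l - (\<Sum>i<d. vscale (l i) (x i)) \<in> L \<inter> L'" unfolding eq by blast
    then have "l - (\<Sum>i<d. vscale (l i) (x i)) = 0" unfolding int by blast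
    then show ?thesis by simp
  qed
  have "1 \<in> rg.span (splittings d (perp d L) L)"
  proof (rule local_principle[OF lf[unfolded vec.lf_def] rg.subspace_span])
    fix s assume "s \<in> {s. vec.free_at L {0} 1 s}"
    then obtain c where c: "c \<in> L" and gen: "\<And>m. m \<in> L \<Longrightarrow> \<exists>k a. vscale (s ^ k) m - vscale a c \<in> {0}"
      and ind: "\<And>a. vscale a c \<in> {0} \<Longrightarrow> \<exists>k. s ^ k * a = 0"
      unfolding mem_Collect_eq vec.free_at_1 by blast
    obtain k where k: "\<And>i. i \<in> {..<d} \<Longrightarrow> \<exists>a. vscale (s ^ k) (x i) = vscale a c"
    proof (rule uniform_exponent[of "{..<d}" "\<lambda>i k. \<exists>a. vscale (s ^ k) (x i) = vscale a c"])
      show "\<exists>k a. vscale (s ^ k) (x i) = vscale a c" if "i \<in> {..<d}" for i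
        using gen[of "x i"] xy that by simp
      show "\<exists>a. vscale (s ^ k') (x i) = vscale a c"
        if ex: "\<exists>a. vscale (s ^ k) (x i) = vscale a c" and le: "k \<le> k'" for i k k'
      proof -
        obtain a where a: "vscale (s ^ k) (x i) = vscale a c" using ex by blast
        have "vscale (s ^ k') (x i) = vscale (s ^ (k' - k)) (vscale (s ^ k) (x i))"
          using le by (simp flip: power_add)
        then show ?thesis unfolding a by (metis vec.scale_scale)
      qed
    qed auto
    then obtain e' where e': "\<And>i. i < d \<Longrightarrow> vscale (s ^ k) (x i) = vscale (e' i) c"
      by (metis lessThan_iff)
    define e where "e i = (if i < d then e' i else 0)" for i
    have e: "vscale (s ^ k) (x i) = vscale (e i) c" if "i < d" for i
      using e'[OF that] that by (simp add: e_def)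
    have ev: "e \<in> vecs d" by (auto simp: vecs_def e_def)
    have le: "vscale (s ^ k) l = vscale (dot d l e) c" if l: "l \<in> L" for l
    proof -
      have "vscale (s ^ k) l = (\<Sum>i<d. vscale (l i) (vscale (s ^ k) (x i)))"
        by (subst P[OF l, symmetric]) (simp add: vec.scale_sum_right mult.commute)
      also have "\<dots> = (\<Sum>i<d. vscale (l i * e i) c)" using e by simp
      finally show ?thesis by (simp add: dot_def vec.scale_sum_left)
    qed
    have "vscale (s ^ k - dot d c e) c \<in> {0}" using le[OF c] by (simp add: vec.scale_left_diff_distrib)
    then obtain j where j: "s ^ j * (s ^ k - dot d c e) = 0" using ind by blast
    define e2 where "e2 = vscale (s ^ j) e"
    have "e2 \<in> vecs d" using ev by (simp add: e2_def vec.subspace_scale[OF subspace_vecs])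
    have "dot d c e2 = s ^ (j + k)" using j by (simp add: e2_def dot_linear right_diff_distrib power_add)
    moreover have "vscale (s ^ (j + k)) v - vscale (dot d c v) e2 \<in> perp d L" if v: "v \<in> vecs d" for v
    proof -
      have "dot d (vscale (s ^ (j + k)) v - vscale (dot d c v) e2) l = 0" if l: "l \<in> L" for l
      proof -
        have "dot d (vscale (s ^ k) l) v = dot d (vscale (dot d l e) c) v" using le[OF l] by simp
        then have "s ^ k * dot d l v = dot d l e * dot d c v" by (simp add: dot_linear)
        then show ?thesis
          by (simp add: dot_linear e2_def power_add mult.assoc dot_commute[of d _ l])
      qed
      moreover have "vscale (s ^ (j + k)) v - vscale (dot d c v) e2 \<in> vecs d"
        using v \<open>e2 \<in> vecs d\<close> by (intro vec.subspace_diff vec.subspace_scale subspace_vecs)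
      ultimately show ?thesis by (simp add: perp_def)
    qed
    ultimately have "s ^ (j + k) \<in> splittings d (perp d L) L"
      unfolding splittings_def using c \<open>e2 \<in> vecs d\<close> by blast
    then show "\<exists>k. s ^ k \<in> rg.span (splittings d (perp d L) L)" using rg.span_base by blast
  qed
  then show ?thesis using sL LN subspace_perp[of d L]
    by (auto simp: dual_pair_def perp_def dot_commute)
qed

section \<open>Record modules presented by submodules of a type\<close>

lemma rng_simps [simp]:
  "carrier rng = UNIV" "x \<otimes>\<^bsub>rng\<^esub> y = x * y" "x \<oplus>\<^bsub>rng\<^esub> y = x + y" "\<zero>\<^bsub>rng\<^esub> = 0" "\<one>\<^bsub>rng\<^esub> = 1"
  by (simp_all add: ring_of_type_algebra_def)

lemma ring_rng: "Ring.ring (rng :: 'a::comm_ring_1 ring)"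
  by (rule ring_from_type_algebra)

lemma comm_ring_hom_rng: "f \<in> ring_hom rng rng \<longleftrightarrow> comm_ring_hom f"
proof
  assume f: "f \<in> ring_hom rng rng"
  then have add: "f (x + y) = f x + f y" and "f (x * y) = f x * f y" "f 1 = 1" for x y
    by (auto simp: Ring.ring_hom_def)
  moreover have "f 0 = 0" using add[of 0 0] by simp
  ultimately show "comm_ring_hom f" by unfold_locales
next
  assume "comm_ring_hom f"
  then interpret comm_ring_hom f .
  show "f \<in> ring_hom rng rng" by (auto simp: Ring.ring_hom_def hom_distribs)
qed

lemma comm_ring_hom_comp:
  assumes "comm_ring_hom f" "comm_ring_hom g"
  shows "comm_ring_hom (f \<circ> g)"
proof -
  interpret f: comm_ring_hom f by fact
  interpret g: comm_ring_hom g by fact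
  show ?thesis by unfold_locales (auto simp: f.hom_add f.hom_mult g.hom_add g.hom_mult)
qed

lemma ideal_rng: "ideal I rng \<longleftrightarrow> rg.subspace (I :: 'a::comm_ring_1 set)"
proof
  assume "ideal I rng"
  then interpret ideal I "rng :: 'a ring" .
  show "rg.subspace I"
    using additive_subgroup.zero_closed[OF additive_subgroup_axioms]
      additive_subgroup.a_closed[OF additive_subgroup_axioms] I_l_closed
    by (intro rg.subspaceI) auto
next
  assume I: "rg.subspace I"
  interpret R: Ring.ring "rng :: 'a ring" by (rule ring_rng)
  show "ideal I rng"
  proof (rule idealI[OF ring_rng])
    show "subgroup I (add_monoid (rng :: 'a ring))"
    proof
      fix x assume "x \<in> I"
      have "\<ominus>\<^bsub>rng\<^esub> x = - x" using R.minus_equality[of "- x" x] by simp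
      then show "inv\<^bsub>add_monoid rng\<^esub> x \<in> I"
        using rg.subspace_neg[OF I \<open>x \<in> I\<close>] by (simp add: a_inv_def)
    qed (use rg.subspace_add[OF I] rg.subspace_0[OF I] in auto)
    fix a x assume "a \<in> I" "x \<in> carrier (rng :: 'a ring)"
    then show "x \<otimes>\<^bsub>rng\<^esub> a \<in> I" "a \<otimes>\<^bsub>rng\<^esub> x \<in> I"
      using rg.subspace_scale[OF I, of a x] by (simp_all add: mult.commute)
  qed
qed

lemma genideal_rng: "genideal rng S = rg.span S"
  unfolding genideal_def rg.span_def hull_def ideal_rng by simp

text \<open>The covering family of \<open>locally_free\<close> is finite; that of \<open>lf\<close> need not be.\<close>

lemma cover_finite:
  "1 \<in> rg.span U \<longleftrightarrow> (\<exists>F. finite F \<and> F \<subseteq> U \<and> 1 \<in> rg.span F)"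
proof
  assume "1 \<in> rg.span U"
  then obtain F r where F: "finite F" "F \<subseteq> U" and 1: "1 = (\<Sum>a\<in>F. r a * a)"
    unfolding rg.span_explicit by blast
  have "1 \<in> rg.span F" unfolding 1 by (intro rg.span_sum rg.span_scale rg.span_base)
  then show "\<exists>F. finite F \<and> F \<subseteq> U \<and> 1 \<in> rg.span F" using F by blast
qed (use rg.span_mono in blast)

text \<open>The record module \<open>M\<close> is \<open>N/K\<close>, where \<open>N\<close> and \<open>K\<close> are submodules of a type and \<open>q\<close> is the quotient map.
  The modules that occur in the theorem are cosets of cosets of formal sums; through a presentation
  every statement about them is reduced to one about polynomials or vectors.\<close>

locale presentation = ring_module sc
  for sc :: "'a::comm_ring_1 \<Rightarrow> 'n::ab_group_add \<Rightarrow> 'n" +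
  fixes M :: "('a, 'm) module" and q :: "'n \<Rightarrow> 'm" and N K :: "'n set"
  assumes subspace_N: "subspace N" and K_subset: "K \<subseteq> N"
    and carrier: "carrier M = q ` N" and zero: "\<zero>\<^bsub>M\<^esub> = q 0"
    and add: "x \<in> N \<Longrightarrow> y \<in> N \<Longrightarrow> q x \<oplus>\<^bsub>M\<^esub> q y = q (x + y)"
    and smult: "x \<in> N \<Longrightarrow> a \<odot>\<^bsub>M\<^esub> q x = q (sc a x)"
    and eq: "x \<in> N \<Longrightarrow> y \<in> N \<Longrightarrow> q x = q y \<longleftrightarrow> x - y \<in> K"
begin

lemma N0: "0 \<in> N"
  and N_add: "x \<in> N \<Longrightarrow> y \<in> N \<Longrightarrow> x + y \<in> N"
  and N_scale: "x \<in> N \<Longrightarrow> sc a x \<in> N"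
  and N_neg: "x \<in> N \<Longrightarrow> - x \<in> N"
  using subspace_0 subspace_add subspace_scale subspace_diff subspace_neg subspace_N by auto

lemma eq0: "x \<in> N \<Longrightarrow> q x = q 0 \<longleftrightarrow> x \<in> K"
  using eq[OF _ N0] by simp

lemma abelian_group: "abelian_group M"
proof (rule abelian_groupI)
  fix x y assume "x \<in> carrier M" "y \<in> carrier M"
  then obtain x' y' where xy: "x = q x'" "y = q y'" "x' \<in> N" "y' \<in> N" by (auto simp: carrier)
  show "x \<oplus>\<^bsub>M\<^esub> y \<in> carrier M" using xy by (simp add: add N_add carrier)
  show "x \<oplus>\<^bsub>M\<^esub> y = y \<oplus>\<^bsub>M\<^esub> x" using xy by (simp add: add add.commute)
  fix z assume "z \<in> carrier M"
  then obtain z' where z: "z = q z'" "z' \<in> N" by (auto simp: carrier)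
  show "x \<oplus>\<^bsub>M\<^esub> y \<oplus>\<^bsub>M\<^esub> z = x \<oplus>\<^bsub>M\<^esub> (y \<oplus>\<^bsub>M\<^esub> z)"
    using xy z by (simp add: add add.assoc N_add)
next
  show "\<zero>\<^bsub>M\<^esub> \<in> carrier M" by (simp add: zero carrier N0)
  fix x assume "x \<in> carrier M"
  then obtain x' where x: "x = q x'" "x' \<in> N" by (auto simp: carrier)
  show "\<zero>\<^bsub>M\<^esub> \<oplus>\<^bsub>M\<^esub> x = x" using x by (simp add: zero add N0)
  have "q (- x') \<oplus>\<^bsub>M\<^esub> x = \<zero>\<^bsub>M\<^esub>" using x by (simp add: zero add N_neg)
  then show "\<exists>y\<in>carrier M. y \<oplus>\<^bsub>M\<^esub> x = \<zero>\<^bsub>M\<^esub>" using x by (auto simp: carrier intro!: N_neg)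
qed

lemma finsum:
  assumes "finite F" and "\<And>i. i \<in> F \<Longrightarrow> g i = q (g' i) \<and> g' i \<in> N"
  shows "finsum M g F = q (sum g' F)"
  using assms
proof (induction F)
  case empty
  interpret abelian_group M by (rule abelian_group)
  show ?case by (simp add: zero)
next
  case (insert x F)
  interpret abelian_group M by (rule abelian_group)
  have "sum g' F \<in> N" using insert by (intro subspace_sum[OF subspace_N]) auto
  moreover have "g \<in> F \<rightarrow> carrier M" "g x \<in> carrier M" using insert.prems by (auto simp: carrier)
  ultimately show ?case using insert by (simp add: add)
qed

lemma submodule_preimage:
  assumes "submodule H rng M"
  shows "subspace {x \<in> N. q x \<in> H}" "K \<subseteq> {x \<in> N. q x \<in> H}" "q ` {x \<in> N. q x \<in> H} = H"
proof -
  interpret submodule H "rng :: 'a ring" M by fact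
  have zeroH: "q 0 \<in> H" using one_closed by (simp add: zero)
  show "subspace {x \<in> N. q x \<in> H}"
  proof (rule subspaceI)
    show "0 \<in> {x \<in> N. q x \<in> H}" using zeroH N0 by simp
    show "x + y \<in> {x \<in> N. q x \<in> H}" if "x \<in> {x \<in> N. q x \<in> H}" "y \<in> {x \<in> N. q x \<in> H}" for x y
      using that m_closed[of "q x" "q y"] by (simp add: add N_add)
    show "sc c x \<in> {x \<in> N. q x \<in> H}" if "x \<in> {x \<in> N. q x \<in> H}" for x c
      using that smult_closed[of c "q x"] by (simp add: smult N_scale)
  qed
  show "K \<subseteq> {x \<in> N. q x \<in> H}"
  proof
    fix x assume x: "x \<in> K"
    then have "x \<in> N" using K_subset by blast
    moreover from this have "q x = q 0" using eq0 x by simp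
    ultimately show "x \<in> {x \<in> N. q x \<in> H}" using zeroH by simp
  qed
  show "q ` {x \<in> N. q x \<in> H} = H" using subset by (auto simp: carrier)
qed

lemma submodule_image:
  assumes W: "subspace W" "W \<subseteq> N"
  shows "submodule (q ` W) rng M"
proof -
  interpret G: abelian_group M by (rule abelian_group)
  have inv: "inv\<^bsub>add_monoid M\<^esub> (q x) = q (- x)" if "x \<in> W" for x
  proof -
    have x: "x \<in> N" using that W by auto
    have "\<ominus>\<^bsub>M\<^esub> (q x) = q (- x)"
      using x by (intro G.minus_equality) (auto simp: add N_neg zero carrier)
    then show ?thesis by (simp add: a_inv_def)
  qed
  show ?thesis
  proof (intro submodule.intro submodule_axioms.intro subgroup.intro)
    show "q ` W \<subseteq> carrier (add_monoid M)" using W by (auto simp: carrier)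
    fix x y assume "x \<in> q ` W" "y \<in> q ` W"
    then obtain x' y' where xy: "x = q x'" "y = q y'" "x' \<in> W" "y' \<in> W" by auto
    then have "x \<otimes>\<^bsub>add_monoid M\<^esub> y = q (x' + y')" using W by (simp add: add subsetD)
    then show "x \<otimes>\<^bsub>add_monoid M\<^esub> y \<in> q ` W" using xy subspace_add[OF W(1)] by auto
  next
    show "\<one>\<^bsub>add_monoid M\<^esub> \<in> q ` W" using subspace_0[OF W(1)] by (simp add: zero)
    fix x assume "x \<in> q ` W"
    then show "inv\<^bsub>add_monoid M\<^esub> x \<in> q ` W" using inv subspace_neg[OF W(1)] by auto
  next
    fix a x assume "x \<in> q ` W"
    then show "a \<odot>\<^bsub>M\<^esub> x \<in> q ` W" using W subspace_scale[OF W(1)] by (auto simp: smult subsetD)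
  qed
qed

lemma preimage_image:
  assumes W: "subspace W" "W \<subseteq> N" "K \<subseteq> W"
  shows "{x \<in> N. q x \<in> q ` W} = W"
proof (intro equalityI subsetI)
  fix x assume "x \<in> {x \<in> N. q x \<in> q ` W}"
  then obtain w where w: "x \<in> N" "w \<in> W" "q x = q w" by auto
  then have "x - w \<in> W" using eq[of x w] W by auto
  then show "x \<in> W" using subspace_add[OF W(1) _ w(2), of "x - w"] by simp
qed (use W in auto)

lemma submodule_iff:
  "submodule H rng M \<longleftrightarrow> (\<exists>W. subspace W \<and> K \<subseteq> W \<and> W \<subseteq> N \<and> H = q ` W)"
proof
  assume H: "submodule H rng M"
  show "\<exists>W. subspace W \<and> K \<subseteq> W \<and> W \<subseteq> N \<and> H = q ` W"
    using submodule_preimage[OF H] by (intro exI[of _ "{x \<in> N. q x \<in> H}"]) simp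
qed (use submodule_image in blast)

lemma locally_free_iff: "locally_free M r \<longleftrightarrow> lf N K r"
proof -
  have comb: "(\<Oplus>\<^bsub>M\<^esub>i\<in>{..<r}. c i \<odot>\<^bsub>M\<^esub> e i) = q (\<Sum>i<r. sc (c i) (e' i))"
      "(\<Sum>i<r. sc (c i) (e' i)) \<in> N"
    if "\<And>i. i < r \<Longrightarrow> e' i \<in> N \<and> e i = q (e' i)" for c e e'
    using that by (auto intro!: finsum subspace_sum[OF subspace_N] simp: smult N_scale)
  let ?free = "\<lambda>s. \<exists>e \<in> {..<r} \<rightarrow> carrier M.
           (\<forall>m\<in>carrier M. \<exists>k c. (s ^ k) \<odot>\<^bsub>M\<^esub> m = (\<Oplus>\<^bsub>M\<^esub>i\<in>{..<r}. c i \<odot>\<^bsub>M\<^esub> e i)) \<and>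
           (\<forall>c. (\<Oplus>\<^bsub>M\<^esub>i\<in>{..<r}. c i \<odot>\<^bsub>M\<^esub> e i) = \<zero>\<^bsub>M\<^esub> \<longrightarrow> (\<exists>k. \<forall>i<r. s ^ k * c i = 0))"
  have conv: "((\<forall>m\<in>carrier M. \<exists>k c. (s ^ k) \<odot>\<^bsub>M\<^esub> m = (\<Oplus>\<^bsub>M\<^esub>i\<in>{..<r}. c i \<odot>\<^bsub>M\<^esub> e i)) \<and>
           (\<forall>c. (\<Oplus>\<^bsub>M\<^esub>i\<in>{..<r}. c i \<odot>\<^bsub>M\<^esub> e i) = \<zero>\<^bsub>M\<^esub> \<longrightarrow> (\<exists>k. \<forall>i<r. s ^ k * c i = 0))) \<longleftrightarrow>
        ((\<forall>m\<in>N. \<exists>k c. sc (s ^ k) m - (\<Sum>i<r. sc (c i) (e' i)) \<in> K) \<and>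
           (\<forall>c. (\<Sum>i<r. sc (c i) (e' i)) \<in> K \<longrightarrow> (\<exists>k. \<forall>i<r. s ^ k * c i = 0)))"
    if e: "\<And>i. i < r \<Longrightarrow> e' i \<in> N \<and> e i = q (e' i)" for s e e'
  proof -
    have "(s ^ k) \<odot>\<^bsub>M\<^esub> q m = (\<Oplus>\<^bsub>M\<^esub>i\<in>{..<r}. c i \<odot>\<^bsub>M\<^esub> e i) \<longleftrightarrow>
        sc (s ^ k) m - (\<Sum>i<r. sc (c i) (e' i)) \<in> K" if "m \<in> N" for m k c
      using that comb[OF e] by (simp add: smult eq N_scale)
    moreover have "(\<Oplus>\<^bsub>M\<^esub>i\<in>{..<r}. c i \<odot>\<^bsub>M\<^esub> e i) = \<zero>\<^bsub>M\<^esub> \<longleftrightarrow> (\<Sum>i<r. sc (c i) (e' i)) \<in> K" for c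
      using comb[OF e] by (simp add: zero eq0)
    ultimately show ?thesis by (simp add: carrier)
  qed
  have free: "?free s \<longleftrightarrow> free_at N K r s" for s
  proof
    assume "?free s"
    then obtain e where e: "e \<in> {..<r} \<rightarrow> carrier M" and
      cond: "(\<forall>m\<in>carrier M. \<exists>k c. (s ^ k) \<odot>\<^bsub>M\<^esub> m = (\<Oplus>\<^bsub>M\<^esub>i\<in>{..<r}. c i \<odot>\<^bsub>M\<^esub> e i)) \<and>
           (\<forall>c. (\<Oplus>\<^bsub>M\<^esub>i\<in>{..<r}. c i \<odot>\<^bsub>M\<^esub> e i) = \<zero>\<^bsub>M\<^esub> \<longrightarrow> (\<exists>k. \<forall>i<r. s ^ k * c i = 0))"
      by (elim bexE)
    have "\<forall>i<r. \<exists>x. x \<in> N \<and> e i = q x" using e carrier by blast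
    then obtain e' where e': "\<And>i. i < r \<Longrightarrow> e' i \<in> N \<and> e i = q (e' i)" by metis
    have "e' \<in> {..<r} \<rightarrow> N" using e' by auto
    moreover have "(\<forall>m\<in>N. \<exists>k c. sc (s ^ k) m - (\<Sum>i<r. sc (c i) (e' i)) \<in> K) \<and>
           (\<forall>c. (\<Sum>i<r. sc (c i) (e' i)) \<in> K \<longrightarrow> (\<exists>k. \<forall>i<r. s ^ k * c i = 0))"
      using conv[of e' e s, OF e'] cond by (rule iffD1)
    ultimately show "free_at N K r s" unfolding free_at_def by - (rule bexI)
  next
    assume "free_at N K r s"
    then obtain e' where e': "e' \<in> {..<r} \<rightarrow> N" and
      cond: "(\<forall>m\<in>N. \<exists>k c. sc (s ^ k) m - (\<Sum>i<r. sc (c i) (e' i)) \<in> K) \<and>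
           (\<forall>c. (\<Sum>i<r. sc (c i) (e' i)) \<in> K \<longrightarrow> (\<exists>k. \<forall>i<r. s ^ k * c i = 0))"
      unfolding free_at_def by (elim bexE)
    have "\<And>i. i < r \<Longrightarrow> e' i \<in> N \<and> q (e' i) = q (e' i)" using e' by auto
    note iffD2[OF conv[of e' "\<lambda>i. q (e' i)" s, OF this] cond]
    moreover have "(\<lambda>i. q (e' i)) \<in> {..<r} \<rightarrow> carrier M" using e' by (auto simp: carrier)
    ultimately show "?free s" by (rule bexI)
  qed
  show ?thesis
    unfolding locally_free_def free lf_def genideal_rng cover_finite[of "{s. free_at N K r s}"]
    by blast
qed

lemma coset:
  assumes H: "submodule H rng M" and x: "x \<in> N"
  shows "a_r_coset M H (q x) = (\<lambda>z. q (z + x)) ` {x \<in> N. q x \<in> H}"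
proof -
  have "a_r_coset M H (q x) = (\<lambda>h. h \<oplus>\<^bsub>M\<^esub> q x) ` (q ` {x \<in> N. q x \<in> H})"
    unfolding submodule_preimage(3)[OF H] by (auto simp: a_r_coset_defs)
  also have "\<dots> = (\<lambda>z. q (z + x)) ` {x \<in> N. q x \<in> H}"
    unfolding image_image using x by (intro image_cong) (auto simp: add)
  finally show ?thesis .
qed

text \<open>A quotient of a presented module has the same generators and more relations.\<close>

lemma presentation_quotient:
  assumes H: "submodule H rng M"
  shows "presentation sc (quotient_module M H) (\<lambda>x. a_r_coset M H (q x)) N {x \<in> N. q x \<in> H}"
proof -
  let ?W = "{x \<in> N. q x \<in> H}"
  note W = submodule_preimage[OF H]
  have HW: "H = q ` ?W" using W(3) by simp
  show ?thesis
  proof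
    show "subspace N" by (rule subspace_N)
    show "?W \<subseteq> N" by auto
    show "carrier (quotient_module M H) = (\<lambda>x. a_r_coset M H (q x)) ` N"
      by (auto simp: quotient_module_def A_RCOSETS_def' carrier)
    show "\<zero>\<^bsub>quotient_module M H\<^esub> = a_r_coset M H (q 0)"
      unfolding coset[OF H N0] using W(3) by (simp add: quotient_module_def)
  next
    fix x y assume x: "x \<in> N" and y: "y \<in> N"
    have "set_add M (a_r_coset M H (q x)) (a_r_coset M H (q y)) = a_r_coset M H (q (x + y))"
    proof (intro equalityI subsetI)
      fix u assume "u \<in> set_add M (a_r_coset M H (q x)) (a_r_coset M H (q y))"
      then obtain v w where vw: "v \<in> ?W" "w \<in> ?W" "u = q (v + x) \<oplus>\<^bsub>M\<^esub> q (w + y)"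
        unfolding coset[OF H x] coset[OF H y] by (auto simp: set_add_defs)
      then have "u = q ((v + w) + (x + y))"
        using x y by (simp add: add N_add algebra_simps)
      then show "u \<in> a_r_coset M H (q (x + y))"
        unfolding coset[OF H N_add[OF x y]] using subspace_add[OF W(1) vw(1,2)] by blast
    next
      fix u assume "u \<in> a_r_coset M H (q (x + y))"
      then obtain v where v: "v \<in> ?W" "u = q (v + (x + y))"
        unfolding coset[OF H N_add[OF x y]] by blast
      then have "u = q (v + x) \<oplus>\<^bsub>M\<^esub> q (0 + y)"
        using x y by (simp add: add N_add add.assoc)
      moreover have "q (v + x) \<in> a_r_coset M H (q x)" "q (0 + y) \<in> a_r_coset M H (q y)"
        unfolding coset[OF H x] coset[OF H y] using v subspace_0[OF W(1)] by blast+
      ultimately show "u \<in> set_add M (a_r_coset M H (q x)) (a_r_coset M H (q y))"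
        by (auto simp: set_add_defs)
    qed
    then show "a_r_coset M H (q x) \<oplus>\<^bsub>quotient_module M H\<^esub> a_r_coset M H (q y) = a_r_coset M H (q (x + y))"
      by (simp add: quotient_module_def)
    show "a_r_coset M H (q x) = a_r_coset M H (q y) \<longleftrightarrow> x - y \<in> ?W"
    proof
      assume "a_r_coset M H (q x) = a_r_coset M H (q y)"
      moreover have "q (0 + x) \<in> a_r_coset M H (q x)"
        unfolding coset[OF H x] using subspace_0[OF W(1)] by blast
      ultimately obtain z where z: "z \<in> ?W" "q x = q (z + y)" unfolding coset[OF H y] by auto
      then have "x - (z + y) \<in> ?W" using eq[OF x, of "z + y"] N_add y W(2) by auto
      then have "x - (z + y) + z \<in> ?W" using z(1) subspace_add[OF W(1)] by blast
      then show "x - y \<in> ?W" by simp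
    next
      assume xy: "x - y \<in> ?W"
      have "(\<lambda>z. q (z + x)) ` ?W = (\<lambda>z. q (z + y)) ` ?W"
      proof (intro equalityI subsetI)
        fix u assume "u \<in> (\<lambda>z. q (z + x)) ` ?W"
        then obtain z where z: "z \<in> ?W" "u = q (z + x)" by blast
        then have "z + (x - y) \<in> ?W" "u = q ((z + (x - y)) + y)" using subspace_add[OF W(1) z(1) xy] by auto
        then show "u \<in> (\<lambda>z. q (z + y)) ` ?W" by blast
      next
        fix u assume "u \<in> (\<lambda>z. q (z + y)) ` ?W"
        then obtain z where z: "z \<in> ?W" "u = q (z + y)" by blast
        then have "z - (x - y) \<in> ?W" "u = q ((z - (x - y)) + x)" using subspace_diff[OF W(1) z(1) xy] by auto
        then show "u \<in> (\<lambda>z. q (z + x)) ` ?W" by blast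
      qed
      then show "a_r_coset M H (q x) = a_r_coset M H (q y)" unfolding coset[OF H x] coset[OF H y] .
    qed
  next
    fix x a assume x: "x \<in> N"
    have "set_add M H ((\<lambda>x. a \<odot>\<^bsub>M\<^esub> x) ` a_r_coset M H (q x)) = a_r_coset M H (q (sc a x))"
    proof (intro equalityI subsetI)
      fix u assume "u \<in> set_add M H ((\<lambda>x. a \<odot>\<^bsub>M\<^esub> x) ` a_r_coset M H (q x))"
      then obtain h v where hv: "h \<in> H" "v \<in> ?W" "u = h \<oplus>\<^bsub>M\<^esub> a \<odot>\<^bsub>M\<^esub> q (v + x)"
        unfolding coset[OF H x] by (auto simp: set_add_defs)
      then obtain w where w: "w \<in> ?W" "h = q w" using HW by blast
      have "u = q ((w + sc a v) + sc a x)"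
        using hv w x by (simp add: smult add N_add N_scale scale_right_distrib add.assoc)
      moreover have "w + sc a v \<in> ?W" using w hv subspace_add[OF W(1)] subspace_scale[OF W(1)] by blast
      ultimately show "u \<in> a_r_coset M H (q (sc a x))" unfolding coset[OF H N_scale[OF x]] by blast
    next
      fix u assume "u \<in> a_r_coset M H (q (sc a x))"
      then obtain w where w: "w \<in> ?W" "u = q (w + sc a x)" unfolding coset[OF H N_scale[OF x]] by blast
      have "u = q w \<oplus>\<^bsub>M\<^esub> a \<odot>\<^bsub>M\<^esub> q (0 + x)" using w x by (simp add: add smult N_scale)
      moreover have "q (0 + x) \<in> a_r_coset M H (q x)"
        unfolding coset[OF H x] using subspace_0[OF W(1)] by blast
      ultimately show "u \<in> set_add M H ((\<lambda>x. a \<odot>\<^bsub>M\<^esub> x) ` a_r_coset M H (q x))"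
        using w by (auto simp: set_add_defs)
    qed
    then show "a \<odot>\<^bsub>quotient_module M H\<^esub> a_r_coset M H (q x) = a_r_coset M H (q (sc a x))"
      by (simp add: quotient_module_def)
  qed
qed

lemma presentation_submodule:
  assumes W: "subspace W" "K \<subseteq> W" "W \<subseteq> N"
  shows "presentation sc (M\<lparr>carrier := q ` W\<rparr>) q W K"
  by unfold_locales (use W add smult eq zero in \<open>auto simp: subset_iff\<close>)

lemma submodule_span_image:
  assumes G: "G \<subseteq> N"
  shows "submodule_span M (q ` G) = q ` span (G \<union> K)"
proof -
  have span: "span (G \<union> K) \<subseteq> N" using G K_subset subspace_N by (intro span_minimal) auto
  show ?thesis
  proof (intro equalityI)
    have "submodule (q ` span (G \<union> K)) rng M" by (rule submodule_image[OF subspace_span span])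
    moreover have "q ` G \<subseteq> q ` span (G \<union> K)" using span_superset by blast
    ultimately show "submodule_span M (q ` G) \<subseteq> q ` span (G \<union> K)"
      unfolding submodule_span_def by blast
    show "q ` span (G \<union> K) \<subseteq> submodule_span M (q ` G)"
      unfolding submodule_span_def
    proof (rule Inter_greatest)
      fix H assume "H \<in> {H. submodule H rng M \<and> q ` G \<subseteq> H}"
      then have H: "submodule H rng M" "q ` G \<subseteq> H" by auto
      note W = submodule_preimage[OF H(1)]
      have "G \<union> K \<subseteq> {x \<in> N. q x \<in> H}" using G H(2) W(2) by blast
      then have "span (G \<union> K) \<subseteq> {x \<in> N. q x \<in> H}" using W(1) by (rule span_minimal)
      then show "q ` span (G \<union> K) \<subseteq> H" by blast
    qed
  qed
qed

lemma set_add_image: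
  assumes "W \<subseteq> N" "W' \<subseteq> N"
  shows "set_add M (q ` W) (q ` W') = q ` {x + y | x y. x \<in> W \<and> y \<in> W'}"
  using assms add by (fastforce simp: set_add_defs subset_iff)

end

lemma module_iso_of_presentations:
  assumes "presentation sc M q N K" "presentation sc M' q' N K"
  shows "\<exists>\<psi>. module_iso \<psi> M M' \<and> (\<forall>x\<in>N. \<psi> (q x) = q' x)"
proof -
  interpret P: presentation sc M q N K by fact
  interpret P': presentation sc M' q' N K by fact
  define \<psi> where "\<psi> m = q' (inv_into N q m)" for m
  have \<psi>: "\<psi> (q x) = q' x" if "x \<in> N" for x
  proof -
    have i: "inv_into N q (q x) \<in> N" "q (inv_into N q (q x)) = q x"
      using that by (auto intro: inv_into_into f_inv_into_f)
    then show ?thesis unfolding \<psi>_def using P.eq[OF i(1) that] P'.eq[OF i(1) that] by simp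
  qed
  have "module_iso \<psi> M M'"
    unfolding module_iso_def
  proof (intro conjI ballI allI)
    show "bij_betw \<psi> (carrier M) (carrier M')"
      unfolding bij_betw_def inj_on_def P.carrier P'.carrier
      using \<psi> P.eq P'.eq by (auto simp: image_image)
  qed (auto simp: P.carrier \<psi> P.add P'.add P.N_add P.smult P'.smult P.N_scale)
  then show ?thesis using \<psi> by blast
qed

lemma presentation_as_module:
  assumes "ring_module sc" "\<And>a x. sc a x = h a * x" "Modules.module.subspace sc N"
  shows "presentation sc (as_module h N) (\<lambda>x. x) N {0}"
proof -
  interpret ring_module sc by fact
  show ?thesis
    by unfold_locales (use assms subspace_0 in \<open>auto simp: as_module_def\<close>)
qed

section \<open>Base change in coordinates\<close>

lemma comm_ring_hom_ident: "comm_ring_hom (\<lambda>x :: 'a::comm_ring_1. x)"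
  by (simp flip: comm_ring_hom_rng add: Ring.ring_hom_def)

definition fscale :: "'b::comm_ring_1 \<Rightarrow> ('m \<Rightarrow>\<^sub>0 'b) \<Rightarrow> ('m \<Rightarrow>\<^sub>0 'b)" where
  "fscale b = Poly_Mapping.map ((*) b)"

lemma lookup_fscale [simp]: "Poly_Mapping.lookup (fscale b c) x = b * Poly_Mapping.lookup c x"
  by (simp add: fscale_def Poly_Mapping.map.rep_eq when_def)

interpretation fm: ring_module fscale
  by standard (auto intro!: poly_mapping_eqI simp: lookup_add algebra_simps)

definition supported :: "'m set \<Rightarrow> ('m \<Rightarrow>\<^sub>0 'b::comm_ring_1) set" where
  "supported U = {c. Poly_Mapping.keys c \<subseteq> U}"

lemma supported_iff: "c \<in> supported U \<longleftrightarrow> (\<forall>x. x \<notin> U \<longrightarrow> Poly_Mapping.lookup c x = 0)"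
  by (auto simp: supported_def in_keys_iff)

lemma single_supported: "x \<in> U \<Longrightarrow> Poly_Mapping.single x b \<in> supported U"
  by (auto simp: supported_iff lookup_single when_def)

lemma subspace_supported: "fm.subspace (supported U)"
  by (rule fm.subspaceI) (auto simp: supported_iff lookup_add)

lemma presentation_free_module:
  "presentation fscale (free_module_on U) (\<lambda>c. c) (supported U) {0}"
  by unfold_locales
    (auto simp: subspace_supported[unfolded supported_def] free_module_on_def supported_def fscale_def)

lemma sum_singles: "(\<Sum>x\<in>Poly_Mapping.keys c. Poly_Mapping.single x (Poly_Mapping.lookup c x)) = c"
proof (rule poly_mapping_eqI)
  fix y
  have "(\<Sum>x\<in>Poly_Mapping.keys c. Poly_Mapping.lookup (Poly_Mapping.single x (Poly_Mapping.lookup c x)) y)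
      = (\<Sum>x\<in>Poly_Mapping.keys c. if x = y then Poly_Mapping.lookup c x else 0)"
    by (intro sum.cong) (auto simp: lookup_single when_def)
  also have "\<dots> = Poly_Mapping.lookup c y" by (simp add: in_keys_iff)
  finally show "Poly_Mapping.lookup (\<Sum>x\<in>Poly_Mapping.keys c. Poly_Mapping.single x (Poly_Mapping.lookup c x)) y
      = Poly_Mapping.lookup c y" by (simp add: lookup_sum)
qed

text \<open>The linear extension of \<open>t\<close> to formal sums, semilinear with respect to \<open>f\<close>.\<close>

definition lift ::
    "('b::comm_ring_1 \<Rightarrow> 'c::comm_ring_1) \<Rightarrow> ('c \<Rightarrow> 'n::ab_group_add \<Rightarrow> 'n) \<Rightarrow> ('m \<Rightarrow> 'n)
      \<Rightarrow> ('m \<Rightarrow>\<^sub>0 'b) \<Rightarrow> 'n" where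
  "lift f sc t c = (\<Sum>x\<in>Poly_Mapping.keys c. sc (f (Poly_Mapping.lookup c x)) (t x))"

definition relations ::
    "('a::comm_ring_1 \<Rightarrow> 'b::comm_ring_1) \<Rightarrow> ('a, 'm) module \<Rightarrow> ('m \<Rightarrow>\<^sub>0 'b) set" where
  "relations h M =
     {Poly_Mapping.single (x \<oplus>\<^bsub>M\<^esub> y) 1 - Poly_Mapping.single x 1 - Poly_Mapping.single y 1 |
         x y. x \<in> carrier M \<and> y \<in> carrier M} \<union>
     {Poly_Mapping.single (a \<odot>\<^bsub>M\<^esub> x) 1 - Poly_Mapping.single x (h a) | a x. x \<in> carrier M}"

locale semilinear_extension = ring_module sc + f: comm_ring_hom f
  for sc :: "'c::comm_ring_1 \<Rightarrow> 'n::ab_group_add \<Rightarrow> 'n" and f :: "'b::comm_ring_1 \<Rightarrow> 'c"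
begin

lemma lift_superset:
  assumes "finite F" "Poly_Mapping.keys c \<subseteq> F"
  shows "lift f sc t c = (\<Sum>x\<in>F. sc (f (Poly_Mapping.lookup c x)) (t x))"
  unfolding lift_def using assms by (intro sum.mono_neutral_left) (auto simp: in_keys_iff)

lemma lift_add: "lift f sc t (c + c') = lift f sc t c + lift f sc t c'"
proof -
  let ?F = "Poly_Mapping.keys c \<union> Poly_Mapping.keys c'"
  have "finite ?F" by simp
  note L = lift_superset[OF this]
  show ?thesis
    using keys_add[of c c'] by (simp add: L lookup_add f.hom_add scale_left_distrib sum.distrib)
qed

lemma lift_scale: "lift f sc t (fscale b c) = sc (f b) (lift f sc t c)"
proof -
  have "Poly_Mapping.keys (fscale b c) \<subseteq> Poly_Mapping.keys c" by (auto simp: in_keys_iff)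
  then show ?thesis
    by (simp add: lift_superset[of "Poly_Mapping.keys c"] f.hom_mult scale_sum_right)
qed

lemma lift_single: "lift f sc t (Poly_Mapping.single x b) = sc (f b) (t x)"
  by (simp add: lift_superset[of "{x}"])

lemma lift_hom: "module_hom fscale (\<lambda>b. sc (f b)) (lift f sc t)"
  by unfold_locales
    (auto simp: lift_add lift_scale fm.scale_left_distrib fm.scale_right_distrib
      scale_right_distrib scale_left_distrib f.hom_add f.hom_mult f.hom_one)

lemma lift_diff: "lift f sc t (c - c') = lift f sc t c - lift f sc t c'"
proof -
  interpret L: module_hom fscale "\<lambda>b. sc (f b)" "lift f sc t" by (rule lift_hom)
  show ?thesis by (rule L.diff)
qed

lemma lift_sum: "lift f sc t (sum g F) = (\<Sum>x\<in>F. lift f sc t (g x))"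
proof -
  interpret L: module_hom fscale "\<lambda>b. sc (f b)" "lift f sc t" by (rule lift_hom)
  show ?thesis by (rule L.sum)
qed

text \<open>One half of the universal property of the tensor product: an additive map that is semilinear with
  respect to \<open>f \<circ> h\<close> kills the defining relations.\<close>

lemma lift_relations:
  assumes add: "\<And>x y. x \<in> carrier M \<Longrightarrow> y \<in> carrier M \<Longrightarrow> t (x \<oplus>\<^bsub>M\<^esub> y) = t x + t y"
    and smult: "\<And>a x. x \<in> carrier M \<Longrightarrow> t (a \<odot>\<^bsub>M\<^esub> x) = sc (f (h a)) (t x)"
    and c: "c \<in> fm.span (relations h M)"
  shows "lift f sc t c = 0"
  using c
proof (induction rule: fm.span_induct_alt)
  case base
  show ?case by (simp add: lift_def)
next
  case (step b x y)
  have "lift f sc t x = 0"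
    using step(1) add smult by (auto simp: relations_def lift_diff lift_single)
  then show ?case using step by (simp add: lift_add lift_scale)
qed

end

locale base_change_presentation = presentation sc M q N K + h: comm_ring_hom h
  for sc :: "'a::comm_ring_1 \<Rightarrow> 'n::ab_group_add \<Rightarrow> 'n" and M :: "('a, 'm) module"
    and q N K and h :: "'a \<Rightarrow> 'b::comm_ring_1"
begin

lemma add_closed: "x \<in> carrier M \<Longrightarrow> y \<in> carrier M \<Longrightarrow> x \<oplus>\<^bsub>M\<^esub> y \<in> carrier M"
  by (auto simp: carrier add N_add)

lemma smult_closed: "x \<in> carrier M \<Longrightarrow> a \<odot>\<^bsub>M\<^esub> x \<in> carrier M"
  by (auto simp: carrier smult N_scale)

lemma relations_supported: "relations h M \<subseteq> supported (carrier M)"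
  unfolding relations_def
  by (auto intro!: fm.subspace_diff[OF subspace_supported] single_supported add_closed smult_closed)

lemma tensor_relations: "tensor_relations h M = fm.span (relations h M)"
proof -
  interpret F: presentation fscale "free_module_on (carrier M)" "\<lambda>c. c" "supported (carrier M)" "{0}"
    by (rule presentation_free_module)
  have "submodule_span (free_module_on (carrier M)) (relations h M) = fm.span (relations h M \<union> {0})"
    using F.submodule_span_image[OF relations_supported] by simp
  also have "\<dots> = fm.span (relations h M)"
  proof (rule equalityI)
    show "fm.span (relations h M \<union> {0}) \<subseteq> fm.span (relations h M)"
      by (rule fm.span_minimal) (auto simp: fm.span_base fm.span_zero)
  qed (rule fm.span_mono, blast)
  finally show ?thesis by (simp add: tensor_relations_def relations_def)
qed

lemma tensor_relations_submodule:
  "submodule (tensor_relations h M) rng (free_module_on (carrier M))"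
proof -
  interpret F: presentation fscale "free_module_on (carrier M)" "\<lambda>c. c" "supported (carrier M)" "{0}"
    by (rule presentation_free_module)
  show ?thesis
    unfolding tensor_relations
    using F.submodule_image[OF fm.subspace_span] fm.span_minimal[OF relations_supported subspace_supported]
    by simp
qed

lemma tensor_relations_supported: "tensor_relations h M \<subseteq> supported (carrier M)"
  unfolding tensor_relations by (rule fm.span_minimal[OF relations_supported subspace_supported])

definition tensor_class :: "('m \<Rightarrow>\<^sub>0 'b) \<Rightarrow> ('m \<Rightarrow>\<^sub>0 'b) set" where
  "tensor_class = a_r_coset (free_module_on (carrier M)) (tensor_relations h M)"

lemma presentation_base_change:
  "presentation fscale (base_change h M) tensor_class (supported (carrier M)) (tensor_relations h M)"
proof -
  interpret F: presentation fscale "free_module_on (carrier M)" "\<lambda>c. c" "supported (carrier M)" "{0}"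
    by (rule presentation_free_module)
  have "{c \<in> supported (carrier M). c \<in> tensor_relations h M} = tensor_relations h M"
    using tensor_relations_supported by blast
  then show ?thesis
    using F.presentation_quotient[OF tensor_relations_submodule]
    by (simp add: base_change_def tensor_class_def)
qed

lemma tensor_class_eq: 
  assumes "c \<in> supported (carrier M)"
  shows "tensor_class c = (\<lambda>z. z + c) ` tensor_relations h M"
proof -
  interpret F: presentation fscale "free_module_on (carrier M)" "\<lambda>c. c" "supported (carrier M)" "{0}"
    by (rule presentation_free_module)
  have "{c \<in> supported (carrier M). c \<in> tensor_relations h M} = tensor_relations h M"
    using tensor_relations_supported by blast
  then show ?thesis using F.coset[OF tensor_relations_submodule assms] by (simp add: tensor_class_def)
qed

lemma tensor_one_class: "tensor_one h M x = tensor_class (Poly_Mapping.single x 1)"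
  by (simp add: tensor_one_def tensor_class_def)

text \<open>The representative that \<open>tensor_lift\<close> chooses does not matter, because \<open>lift\<close> kills the relations.\<close>

lemma tensor_lift_class:
  fixes f :: "'b \<Rightarrow> 'c::comm_ring_1" and sc' :: "'c \<Rightarrow> 'k::ab_group_add \<Rightarrow> 'k"
  assumes f: "comm_ring_hom f" and N': "presentation sc' M' q' N' K'"
    and t: "\<And>x. x \<in> carrier M \<Longrightarrow> t x \<in> N'"
    and add: "\<And>x y. x \<in> carrier M \<Longrightarrow> y \<in> carrier M \<Longrightarrow> t (x \<oplus>\<^bsub>M\<^esub> y) = t x + t y"
    and smult: "\<And>a x. x \<in> carrier M \<Longrightarrow> t (a \<odot>\<^bsub>M\<^esub> x) = sc' (f (h a)) (t x)"
    and t': "\<And>x. x \<in> carrier M \<Longrightarrow> t' x = q' (t x)"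
    and c: "c \<in> supported (carrier M)"
  shows "tensor_lift f M' t' (tensor_class c) = q' (lift f sc' t c)"
proof -
  interpret P': presentation sc' M' q' N' K' by fact
  interpret f: comm_ring_hom f by fact
  interpret L: semilinear_extension sc' f ..
  define c' where "c' = (SOME c'. c' \<in> tensor_class c)"
  have "c \<in> tensor_class c"
    unfolding tensor_class_eq[OF c] tensor_relations
    by (rule image_eqI[of _ _ 0]) (simp_all add: fm.span_zero)
  then have "c' \<in> tensor_class c" unfolding c'_def by (rule someI)
  then obtain z where z: "z \<in> tensor_relations h M" "c' = z + c" unfolding tensor_class_eq[OF c] by blast
  have "lift f sc' t z = 0"
    using z(1) L.lift_relations[OF add smult] unfolding tensor_relations by blast
  then have lift: "lift f sc' t c' = lift f sc' t c" by (simp add: z L.lift_add)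
  have "c' \<in> supported (carrier M)"
    using z c tensor_relations_supported fm.subspace_add[OF subspace_supported] by blast
  then have supp: "x \<in> carrier M" if "x \<in> Poly_Mapping.keys c'" for x using that by (auto simp: supported_def)
  have "tensor_lift f M' t' (tensor_class c)
      = (\<Oplus>\<^bsub>M'\<^esub>x\<in>Poly_Mapping.keys c'. f (Poly_Mapping.lookup c' x) \<odot>\<^bsub>M'\<^esub> t' x)"
    by (simp add: tensor_lift_def c'_def Let_def)
  also have "\<dots> = q' (\<Sum>x\<in>Poly_Mapping.keys c'. sc' (f (Poly_Mapping.lookup c' x)) (t x))"
    by (rule P'.finsum) (auto simp: supp t t' P'.smult P'.N_scale)
  finally show ?thesis using lift by (simp add: lift_def)
qed

end

locale free_presentation = presentation vscale M q "vecs d" "{0}"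
  for M :: "('a::comm_ring_1, 'm) module" and q d
begin

definition coords :: "'m \<Rightarrow> nat \<Rightarrow> 'a" where
  "coords x = inv_into (vecs d) q x"

lemma coords_in: "x \<in> carrier M \<Longrightarrow> coords x \<in> vecs d"
  and q_coords: "x \<in> carrier M \<Longrightarrow> q (coords x) = x"
  using inv_into_into[of x q "vecs d"] f_inv_into_f[of x q "vecs d"] by (simp_all add: coords_def carrier)

lemma coords_q: "v \<in> vecs d \<Longrightarrow> coords (q v) = v"
  using eq[of "coords (q v)" v] coords_in[of "q v"] q_coords[of "q v"] by (auto simp: carrier)

lemma coords_add: "x \<in> carrier M \<Longrightarrow> y \<in> carrier M \<Longrightarrow> coords (x \<oplus>\<^bsub>M\<^esub> y) = coords x + coords y"
  by (auto simp: carrier add coords_q N_add)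

lemma coords_smult: "x \<in> carrier M \<Longrightarrow> coords (a \<odot>\<^bsub>M\<^esub> x) = vscale a (coords x)"
  by (auto simp: carrier smult coords_q N_scale)

lemma basis_in: "i < d \<Longrightarrow> q (unitv i) \<in> carrier M"
  by (auto simp: carrier unitv_in_vecs)

end

definition combination ::
    "(nat \<Rightarrow> 'm) \<Rightarrow> nat \<Rightarrow> (nat \<Rightarrow> 'b::comm_ring_1) \<Rightarrow> 'm \<Rightarrow>\<^sub>0 'b" where
  "combination e d b = (\<Sum>i<d. Poly_Mapping.single (e i) (b i))"

lemma combination_add: "combination e d (b + b') = combination e d b + combination e d b'"
  by (simp add: combination_def single_add sum.distrib)

lemma combination_scale: "combination e d (vscale a b) = fscale a (combination e d b)"
proof -
  have "Poly_Mapping.single x (a * b) = fscale a (Poly_Mapping.single x b)" for x :: 'a and a b :: 'b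
    by (rule poly_mapping_eqI) (simp add: lookup_single when_def)
  then show ?thesis by (simp add: combination_def fm.scale_sum_right)
qed

lemma combination_hom: "module_hom vscale fscale (combination e d)"
  by unfold_locales (simp_all add: combination_add combination_scale)

text \<open>The element \<open>\<Sum> e i \<otimes> b i\<close>. For a basis \<open>e\<close> of \<open>M\<close> this identifies \<open>B\<^sup>d\<close> with \<open>M \<otimes> B\<close>.\<close>

definition tensor_vec ::
    "('a::comm_ring_1 \<Rightarrow> 'b::comm_ring_1) \<Rightarrow> ('a, 'm) module \<Rightarrow> (nat \<Rightarrow> 'm) \<Rightarrow> nat
      \<Rightarrow> (nat \<Rightarrow> 'b) \<Rightarrow> ('m \<Rightarrow>\<^sub>0 'b) set" where
  "tensor_vec h M e d b =
     a_r_coset (free_module_on (carrier M)) (tensor_relations h M) (combination e d b)"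

locale free_base_change = free_presentation M q d + h: comm_ring_hom h
  for M :: "('a::comm_ring_1, 'm) module" and q d and h :: "'a \<Rightarrow> 'b::comm_ring_1"
begin

sublocale base_change_presentation vscale M q "vecs d" "{0}" h ..

abbreviation "basis \<equiv> \<lambda>i. q (unitv i)"

lemma tensor_vec_class: "tensor_vec h M basis d b = tensor_class (combination basis d b)"
  by (simp add: tensor_vec_def tensor_class_def)

lemma combination_supported: "combination basis d b \<in> supported (carrier M)"
  unfolding combination_def
  by (intro fm.subspace_sum[OF subspace_supported] single_supported basis_in) auto

lemma vec_extension: "semilinear_extension (vscale :: 'b \<Rightarrow> _) (\<lambda>b. b)"
  by (intro semilinear_extension.intro vec.ring_module_axioms comm_ring_hom_ident)

lemma hom_vec: "v \<in> vecs d \<Longrightarrow> h \<circ> v \<in> vecs d"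
  by (simp add: vecs_def)

text \<open>The coordinates of a formal sum. They are well defined on classes, which gives the injectivity of
  \<open>tensor_vec\<close>.\<close>

abbreviation tcoords :: "('m \<Rightarrow>\<^sub>0 'b) \<Rightarrow> nat \<Rightarrow> 'b" where
  "tcoords \<equiv> lift (\<lambda>b. b) vscale (\<lambda>x. h \<circ> coords x)"

lemma tcoords_relations: "c \<in> tensor_relations h M \<Longrightarrow> tcoords c = 0"
  unfolding tensor_relations
  by (rule semilinear_extension.lift_relations[OF vec_extension, of M _ h]) (auto simp: coords_add coords_smult fun_eq_iff h.hom_add h.hom_mult)

lemma tcoords_in: "c \<in> supported (carrier M) \<Longrightarrow> tcoords c \<in> vecs d"
  unfolding lift_def
  by (intro vec.subspace_sum[OF subspace_vecs] vec.subspace_scale[OF subspace_vecs] hom_vec coords_in)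
    (auto simp: supported_def)

lemma tcoords_combination:
  assumes b: "b \<in> vecs d"
  shows "tcoords (combination basis d b) = b"
proof -
  have "tcoords (combination basis d b) = (\<Sum>i<d. vscale (b i) (h \<circ> unitv i))"
    unfolding combination_def semilinear_extension.lift_sum[OF vec_extension] by (simp add: semilinear_extension.lift_single[OF vec_extension] coords_q unitv_in_vecs)
  also have "\<dots> = (\<Sum>i<d. vscale (b i) (unitv i))"
    by (intro sum.cong) (auto simp: unitv_def fun_eq_iff)
  finally show ?thesis using vec_expand[OF b] by simp
qed

text \<open>Induction on the number of coordinates that have been expanded.\<close>

lemma single_combination:
  assumes v: "v \<in> vecs d"
  shows "Poly_Mapping.single (q v) 1 - combination basis d (h \<circ> v) \<in> tensor_relations h M"
proof -
  let ?R = "tensor_relations h M"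
  have R: "fm.subspace ?R" by (simp add: tensor_relations)
  let ?v = "\<lambda>n. \<Sum>i<n. vscale (v i) (unitv i)"
  have vn: "?v n \<in> vecs d" if "n \<le> d" for n
    using that by (intro vec.subspace_sum[OF subspace_vecs] vec.subspace_scale[OF subspace_vecs] unitv_in_vecs) auto
  have "Poly_Mapping.single (q (?v n)) 1 - (\<Sum>i<n. Poly_Mapping.single (basis i) (h (v i))) \<in> ?R"
    if "n \<le> d" for n
    using that
  proof (induction n)
    case 0
    have "q 0 \<in> carrier M" by (simp add: carrier N0)
    then have "Poly_Mapping.single (0 \<odot>\<^bsub>M\<^esub> q 0) 1 - Poly_Mapping.single (q 0) (h 0) \<in> ?R"
      unfolding tensor_relations relations_def by (intro fm.span_base) blast
    moreover have "0 \<odot>\<^bsub>M\<^esub> q 0 = q 0"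
      using smult[OF N0, of 0] unfolding vec.scale_zero_left .
    ultimately have "Poly_Mapping.single (q 0) 1 \<in> ?R" by (simp only: h.hom_zero single_zero diff_zero)
    then show ?case unfolding lessThan_0 sum.empty diff_zero .
  next
    case (Suc n)
    let ?s = "Poly_Mapping.single :: 'm \<Rightarrow> 'b \<Rightarrow> 'm \<Rightarrow>\<^sub>0 'b"
    have un: "(unitv n :: nat \<Rightarrow> 'a) \<in> vecs d" by (rule unitv_in_vecs) (use Suc.prems in simp)
    then have sn: "vscale (v n) (unitv n) \<in> vecs d" by (rule N_scale)
    have "?s (q (?v n) \<oplus>\<^bsub>M\<^esub> q (vscale (v n) (unitv n))) 1 - ?s (q (?v n)) 1
        - ?s (q (vscale (v n) (unitv n))) 1 \<in> ?R"
      unfolding tensor_relations relations_def using vn[of n] sn Suc.prems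
      by (intro fm.span_base) (auto simp: carrier)
    then have 1: "?s (q (?v (Suc n))) 1 - ?s (q (?v n)) 1 - ?s (q (vscale (v n) (unitv n))) 1 \<in> ?R"
      using vn[of n] sn Suc.prems by (simp add: add)
    have "q (unitv n) \<in> carrier M" using un by (simp add: carrier)
    then have "?s (v n \<odot>\<^bsub>M\<^esub> q (unitv n)) 1 - ?s (q (unitv n)) (h (v n)) \<in> ?R"
      unfolding tensor_relations relations_def by (intro fm.span_base) blast
    then have 2: "?s (q (vscale (v n) (unitv n))) 1 - ?s (q (unitv n)) (h (v n)) \<in> ?R"
      using un by (simp add: smult)
    have "?s (q (?v n)) 1 - (\<Sum>i<n. ?s (basis i) (h (v i))) \<in> ?R"
      using Suc.IH[OF Suc_leD[OF Suc.prems]] .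
    from fm.subspace_add[OF R fm.subspace_add[OF R 1 2] this]
    have "?s (q (?v (Suc n))) 1 - (\<Sum>i<Suc n. ?s (basis i) (h (v i))) \<in> ?R"
      by (simp add: algebra_simps)
    then show ?case .
  qed
  from this[of d] show ?thesis using vec_expand[OF v] by (simp add: combination_def)
qed

lemma class_combination:
  assumes c: "c \<in> supported (carrier M)"
  shows "c - combination basis d (tcoords c) \<in> tensor_relations h M"
proof -
  let ?R = "tensor_relations h M"
  have R: "fm.subspace ?R" by (simp add: tensor_relations)
  interpret C: module_hom vscale fscale "combination basis d :: (nat \<Rightarrow> 'b) \<Rightarrow> _" by (rule combination_hom)
  have "c - combination basis d (tcoords c) = (\<Sum>x\<in>Poly_Mapping.keys c.
      fscale (Poly_Mapping.lookup c x) (Poly_Mapping.single x 1 - combination basis d (h \<circ> coords x)))"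
  proof -
    have s: "fscale b (Poly_Mapping.single x 1) = Poly_Mapping.single x b" for b :: 'b and x :: 'm
      by (rule poly_mapping_eqI) (simp add: lookup_single when_def)
    show ?thesis
      unfolding fm.scale_right_diff_distrib sum_subtractf s sum_singles lift_def C.sum C.scale ..
  qed
  also have "\<dots> \<in> ?R"
  proof (intro fm.subspace_sum[OF R] fm.subspace_scale[OF R])
    fix x assume "x \<in> Poly_Mapping.keys c"
    then have x: "x \<in> carrier M" using c by (auto simp: supported_def)
    show "Poly_Mapping.single x 1 - combination basis d (h \<circ> coords x) \<in> ?R"
      using single_combination[OF coords_in[OF x]] q_coords[OF x] by simp
  qed
  finally show ?thesis .
qed

text \<open>Modulo the relations every formal sum is a combination of basis elements (\<open>class_combination\<close>), and
  \<open>tcoords\<close> recovers the coefficients.\<close>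

lemma presentation_tensor_vec:
  "presentation vscale (base_change h M) (tensor_vec h M basis d) (vecs d) {0}"
proof -
  interpret B: presentation fscale "base_change h M" tensor_class "supported (carrier M)" "tensor_relations h M"
    by (rule presentation_base_change)
  interpret C: module_hom vscale fscale "combination basis d :: (nat \<Rightarrow> 'b) \<Rightarrow> _" by (rule combination_hom)
  note cs = combination_supported
  show ?thesis
  proof
    show "carrier (base_change h M) = tensor_vec h M basis d ` vecs d"
      unfolding B.carrier
    proof (intro equalityI subsetI)
      fix u assume "u \<in> tensor_class ` supported (carrier M)"
      then obtain c where c: "c \<in> supported (carrier M)" "u = tensor_class c" by blast
      then have "u = tensor_class (combination basis d (tcoords c))"
        using B.eq[OF c(1) cs] class_combination by simp
      then show "u \<in> tensor_vec h M basis d ` vecs d"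
        using tcoords_in[OF c(1)] by (auto simp: tensor_vec_class)
    qed (use cs in \<open>auto simp: tensor_vec_class\<close>)
    show "\<zero>\<^bsub>base_change h M\<^esub> = tensor_vec h M basis d 0"
      by (simp add: B.zero tensor_vec_class C.zero)
    fix x y :: "nat \<Rightarrow> 'b" and a
    assume x: "x \<in> vecs d"
    show "a \<odot>\<^bsub>base_change h M\<^esub> tensor_vec h M basis d x = tensor_vec h M basis d (vscale a x)"
      by (simp add: tensor_vec_class B.smult cs C.scale)
    assume y: "y \<in> vecs d"
    show "tensor_vec h M basis d x \<oplus>\<^bsub>base_change h M\<^esub> tensor_vec h M basis d y = tensor_vec h M basis d (x + y)"
      by (simp add: tensor_vec_class B.add cs C.add)
    have "combination basis d (x - y) \<in> tensor_relations h M \<longleftrightarrow> x - y = 0"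
    proof
      assume "combination basis d (x - y) \<in> tensor_relations h M"
      then have "tcoords (combination basis d (x - y)) = 0" by (rule tcoords_relations)
      then show "x - y = 0"
        using tcoords_combination[OF vec.subspace_diff[OF subspace_vecs x y]] by simp
    next
      assume "x - y = 0"
      then show "combination basis d (x - y) \<in> tensor_relations h M"
        by (simp only: C.zero) (simp add: tensor_relations fm.span_zero)
    qed
    then show "tensor_vec h M basis d x = tensor_vec h M basis d y \<longleftrightarrow> x - y \<in> {0}"
      by (simp add: tensor_vec_class B.eq cs C.diff[symmetric])
  qed (auto simp: subspace_vecs vec.subspace_0)
qed

lemma tensor_one_vec:
  assumes v: "v \<in> vecs d"
  shows "tensor_one h M (q v) = tensor_vec h M basis d (h \<circ> v)"
proof -
  interpret B: presentation fscale "base_change h M" tensor_class "supported (carrier M)" "tensor_relations h M"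
    by (rule presentation_base_change)
  have "q v \<in> carrier M" using v by (simp add: carrier)
  then show ?thesis
    unfolding tensor_one_class tensor_vec_class
    using B.eq[OF single_supported combination_supported] single_combination[OF v] by blast
qed

lemma tensor_lift_vec:
  fixes f :: "'b \<Rightarrow> 'c::comm_ring_1" and sc' :: "'c \<Rightarrow> 'k::ab_group_add \<Rightarrow> 'k"
  assumes f: "comm_ring_hom f" and N': "presentation sc' M' q' N' K'"
    and t: "\<And>x. x \<in> carrier M \<Longrightarrow> t x \<in> N'"
    and add: "\<And>x y. x \<in> carrier M \<Longrightarrow> y \<in> carrier M \<Longrightarrow> t (x \<oplus>\<^bsub>M\<^esub> y) = t x + t y"
    and smult: "\<And>a x. x \<in> carrier M \<Longrightarrow> t (a \<odot>\<^bsub>M\<^esub> x) = sc' (f (h a)) (t x)"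
    and t': "\<And>x. x \<in> carrier M \<Longrightarrow> t' x = q' (t x)"
  shows "tensor_lift f M' t' (tensor_vec h M basis d b) = q' (\<Sum>i<d. sc' (f (b i)) (t (basis i)))"
proof -
  interpret P': presentation sc' M' q' N' K' by fact
  interpret f: comm_ring_hom f by fact
  interpret L: semilinear_extension sc' f ..
  show ?thesis
    using tensor_lift_class[OF f N' t add smult t' combination_supported, of b]
    by (simp add: tensor_vec_class combination_def L.lift_sum L.lift_single)
qed

end

context free_presentation
begin

definition functional :: "(nat \<Rightarrow> 'a) \<Rightarrow> 'm \<Rightarrow> 'a" where
  "functional l = (\<lambda>x\<in>carrier M. dot d l (coords x))"

lemma functional_basis: "i < d \<Longrightarrow> functional l (q (unitv i)) = l i"
  by (simp add: functional_def basis_in coords_q unitv_in_vecs dot_unitv)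

text \<open>The functionals that correspond to the unit vectors form the dual basis.\<close>

lemma presentation_dual: "presentation vscale (dual_module M) functional (vecs d) {0}"
proof
  have lin: "functional l \<in> carrier (dual_module M)" for l
    by (auto simp: dual_module_def functional_def carrier coords_q add smult dot_linear N_add N_scale)
  show "carrier (dual_module M) = functional ` vecs d"
  proof (intro equalityI subsetI)
    fix l assume "l \<in> carrier (dual_module M)"
    then have ext: "l \<in> extensional (carrier M)"
      and add': "\<And>x y. x \<in> carrier M \<Longrightarrow> y \<in> carrier M \<Longrightarrow> l (x \<oplus>\<^bsub>M\<^esub> y) = l x + l y"
      and smult': "\<And>a x. x \<in> carrier M \<Longrightarrow> l (a \<odot>\<^bsub>M\<^esub> x) = a * l x"
      by (auto simp: dual_module_def)
    define v where "v i = (if i < d then l (q (unitv i)) else 0)" for i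
    have "l (q w) = dot d v w" if w: "w \<in> vecs d" for w
    proof -
      have "l (q (\<Sum>i<n. vscale (w i) (unitv i))) = (\<Sum>i<n. v i * w i)
          \<and> (\<Sum>i<n. vscale (w i) (unitv i)) \<in> vecs d" if "n \<le> d" for n
        using that
      proof (induction n)
        case 0
        have "l (0 \<odot>\<^bsub>M\<^esub> q 0) = 0" using smult'[of "q 0" 0] by (simp add: carrier N0)
        moreover have "0 \<odot>\<^bsub>M\<^esub> q 0 = q 0" using smult[OF N0, of 0] unfolding vec.scale_zero_left .
        ultimately have "l (q 0) = 0" by (simp only:)
        then show ?case unfolding lessThan_0 sum.empty using N0 by blast
      next
        case (Suc n)
        have un: "(unitv n :: nat \<Rightarrow> 'a) \<in> vecs d" by (rule unitv_in_vecs) (use Suc.prems in simp)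
        define S where "S = (\<Sum>i<n. vscale (w i) (unitv i))"
        have S: "l (q S) = (\<Sum>i<n. v i * w i)" "S \<in> vecs d"
          using Suc.IH[OF Suc_leD[OF Suc.prems]] unfolding S_def by blast+
        have "l (q (vscale (w n) (unitv n))) = w n * l (q (unitv n))"
          using smult'[of "q (unitv n)" "w n"] un by (simp add: smult carrier)
        moreover have "l (q (S + vscale (w n) (unitv n))) = l (q S) + l (q (vscale (w n) (unitv n)))"
          using add'[of "q S" "q (vscale (w n) (unitv n))"] S un N_scale[OF un] by (simp add: add carrier)
        ultimately have "l (q (S + vscale (w n) (unitv n))) = (\<Sum>i<n. v i * w i) + v n * w n"
          using S(1) Suc.prems by (simp add: v_def mult.commute)
        then show ?case
          unfolding sum.lessThan_Suc S_def[symmetric] using N_add[OF S(2) N_scale[OF un]] by (rule conjI)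
      qed
      from this[of d] show ?thesis using vec_expand[OF w] by (simp add: dot_def)
    qed
    then have "l = functional v"
      using ext by (auto simp: functional_def fun_eq_iff extensional_def carrier coords_q)
    moreover have "v \<in> vecs d" by (simp add: v_def vecs_def)
    ultimately show "l \<in> functional ` vecs d" by blast
  qed (use lin in auto)
  fix x y :: "nat \<Rightarrow> 'a" and a
  show "\<zero>\<^bsub>dual_module M\<^esub> = functional 0"
    by (auto simp: dual_module_def functional_def dot_linear fun_eq_iff)
  show "a \<odot>\<^bsub>dual_module M\<^esub> functional x = functional (vscale a x)"
    by (auto simp: dual_module_def functional_def dot_linear fun_eq_iff)
  show "functional x \<oplus>\<^bsub>dual_module M\<^esub> functional y = functional (x + y)"
    by (auto simp: dual_module_def functional_def dot_linear fun_eq_iff)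
  assume xy: "x \<in> vecs d" "y \<in> vecs d"
  show "functional x = functional y \<longleftrightarrow> x - y \<in> {0}"
  proof
    assume "functional x = functional y"
    then have "x i = y i" if "i < d" for i using functional_basis[OF that] by metis
    then have "x i = y i" for i using xy by (cases "i < d") (auto simp: vecs_def)
    then show "x - y \<in> {0}" by (auto simp: fun_eq_iff)
  qed simp
qed (auto simp: subspace_vecs vec.subspace_0)

lemma free_presentation_dual: "free_presentation (dual_module M) functional d"
  by (simp add: free_presentation_def presentation_dual)

end

lemma dual_pairing_vec:
  assumes "free_base_change M q d \<iota>"
  shows "dual_pairing \<iota>
      (tensor_vec \<iota> (dual_module M) (\<lambda>i. free_presentation.functional M q d (unitv i)) d a)
      (tensor_vec \<iota> M (\<lambda>i. q (unitv i)) d b) = dot d a b"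
proof -
  interpret B: free_base_change M q d \<iota> by fact
  interpret D: free_base_change "dual_module M" B.functional d \<iota>
    by (intro free_base_change.intro B.free_presentation_dual B.h.comm_ring_hom_axioms)
  have id: "comm_ring_hom (id :: 'b \<Rightarrow> 'b)" using comm_ring_hom_ident by (simp add: id_def)
  have P: "presentation (*) (as_module (id :: 'b \<Rightarrow> 'b) UNIV) (\<lambda>x. x) UNIV {0}"
    by (rule presentation_as_module) (auto intro: ring_module.intro rg.module_axioms)
  have inner: "tensor_lift id (as_module id UNIV) (\<lambda>v. \<iota> (l v)) (tensor_vec \<iota> M B.basis d b)
      = (\<Sum>i<d. b i * \<iota> (l (B.basis i)))" if "l \<in> carrier (dual_module M)" for l
    using that by (subst B.tensor_lift_vec[OF id P]) (auto simp: dual_module_def B.h.hom_add B.h.hom_mult)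
  have "dual_pairing \<iota> (tensor_vec \<iota> (dual_module M) D.basis d a) (tensor_vec \<iota> M B.basis d b)
      = (\<Sum>i<d. a i * (\<Sum>j<d. b j * \<iota> (D.basis i (B.basis j))))"
    unfolding dual_pairing_def
  proof (subst D.tensor_lift_vec[OF id P, where t="\<lambda>l. \<Sum>j<d. b j * \<iota> (l (B.basis j))"])
    show "(\<Sum>j<d. b j * \<iota> ((l \<oplus>\<^bsub>dual_module M\<^esub> l') (B.basis j)))
        = (\<Sum>j<d. b j * \<iota> (l (B.basis j))) + (\<Sum>j<d. b j * \<iota> (l' (B.basis j)))" for l l'
      by (simp add: dual_module_def B.basis_in B.h.hom_add distrib_left sum.distrib)
    show "(\<Sum>j<d. b j * \<iota> ((c \<odot>\<^bsub>dual_module M\<^esub> l) (B.basis j)))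
        = id (\<iota> c) * (\<Sum>j<d. b j * \<iota> (l (B.basis j)))" for l c
      by (simp add: dual_module_def B.basis_in B.h.hom_mult sum_distrib_left mult.left_commute)
  qed (auto simp: inner)
  also have "\<dots> = (\<Sum>i<d. a i * (\<Sum>j<d. b j * \<iota> (unitv i j)))"
    by (simp add: B.functional_basis)
  also have "\<dots> = (\<Sum>i<d. a i * dot d b (unitv i))"
    by (intro sum.cong arg_cong[where f="\<lambda>x. _ * x"] refl) (simp add: dot_def unitv_def if_distrib cong: if_cong)
  also have "\<dots> = dot d a b" by (simp add: dot_unitv) (simp add: dot_def)
  finally show ?thesis .
qed

section \<open>Points of projective spaces in coordinates\<close>

lemma span_hom_cover:
  assumes f: "comm_ring_hom f" and U: "a \<in> rg.span U" and UV: "f ` U \<subseteq> V"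
  shows "f a \<in> rg.span V"
proof -
  interpret f: comm_ring_hom f by fact
  show ?thesis using U
  proof (induction rule: rg.span_induct_alt)
    case base
    show ?case by (simp add: rg.span_zero)
  next
    case (step c x y)
    then have "f x \<in> rg.span V" using UV by (intro rg.span_base) auto
    then show ?case
      unfolding f.hom_add f.hom_mult by (intro rg.span_add rg.span_scale step)
  qed
qed

lemma dot_hom:
  assumes "comm_ring_hom f"
  shows "dot d (f \<circ> a) (f \<circ> b) = f (dot d a b)"
proof -
  interpret f: comm_ring_hom f by fact
  show ?thesis by (simp add: dot_def f.hom_sum f.hom_mult)
qed

text \<open>The images of \<open>c\<close>, \<open>e\<close> and \<open>\<sigma>\<close> under \<open>f\<close> are again a splitting: by linearity the condition on \<open>v\<close> has to be
  checked for unit vectors only, and there it is the image of the given one. Consequently taking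
  orthogonals commutes with base change.\<close>

lemma dual_pair_push:
  assumes f: "comm_ring_hom f" and dp: "dual_pair d K L"
  shows "dual_pair d (vec.span ((\<circ>) f ` K)) (vec.span ((\<circ>) f ` L))"
proof -
  interpret f: comm_ring_hom f by fact
  let ?K = "vec.span ((\<circ>) f ` K)" and ?L = "vec.span ((\<circ>) f ` L)"
  have KL: "K \<subseteq> vecs d" "L \<subseteq> vecs d" and orth: "\<And>l v. l \<in> L \<Longrightarrow> v \<in> K \<Longrightarrow> dot d l v = 0"
    using dp by (auto simp: dual_pair_def)
  have fv: "f \<circ> v \<in> vecs d" if "v \<in> vecs d" for v
    using that by (auto simp: vecs_def)
  have sub: "?K \<subseteq> vecs d" "?L \<subseteq> vecs d"
    using fv KL by (intro vec.span_minimal subspace_vecs; blast)+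
  have orth': "dot d l v = 0" if l: "l \<in> ?L" and v: "v \<in> ?K" for l v
    using l
  proof (induction rule: vec.span_induct_alt)
    case base
    show ?case by (rule dot_zero_left)
  next
    case (step c x y)
    then obtain l0 where l0: "l0 \<in> L" "x = f \<circ> l0" by blast
    have "dot d (f \<circ> l0) v = 0" using v
    proof (induction rule: vec.span_induct_alt)
      case base
      show ?case by (rule dot_zero_right)
    next
      case (step c x y)
      then obtain v0 where v0: "v0 \<in> K" "x = f \<circ> v0" by blast
      show ?case unfolding dot_add_right dot_scale_right v0 dot_hom[OF f] orth[OF l0(1) v0(1)] step(2) by simp
    qed
    then show ?case unfolding dot_add_left dot_scale_left l0 step(2) by simp
  qed
  have "f ` splittings d K L \<subseteq> splittings d ?K ?L"
  proof
    fix \<tau> assume "\<tau> \<in> f ` splittings d K L"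
    then obtain c e where ce: "c \<in> L" "e \<in> vecs d" "\<tau> = f (dot d c e)"
      "\<forall>v\<in>vecs d. vscale (dot d c e) v - vscale (dot d c v) e \<in> K"
      by (auto simp: splittings_def)
    have "vscale \<tau> v - vscale (dot d (f \<circ> c) v) (f \<circ> e) \<in> ?K" if v: "v \<in> vecs d" for v
    proof -
      have "vscale \<tau> v - vscale (dot d (f \<circ> c) v) (f \<circ> e)
          = (\<Sum>i<d. vscale (v i) (f \<circ> (vscale (dot d c e) (unitv i) - vscale (c i) e)))"
      proof -
        have u: "f \<circ> (vscale (dot d c e) (unitv i) - vscale (c i) e)
            = vscale \<tau> (unitv i) - vscale (f (c i)) (f \<circ> e)" for i
          by (auto simp: fun_eq_iff f.hom_minus f.hom_mult ce(3) unitv_def)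
        have "(\<Sum>i<d. vscale (v i) (vscale \<tau> (unitv i))) = vscale \<tau> v"
          unfolding vec.scale_left_commute[of _ \<tau>] vec.scale_sum_right[symmetric] vec_expand[OF v] ..
        moreover have "(\<Sum>i<d. vscale (v i) (vscale (f (c i)) (f \<circ> e))) = vscale (dot d (f \<circ> c) v) (f \<circ> e)"
          unfolding dot_def vec.scale_sum_left by (intro sum.cong) (auto simp: fun_eq_iff mult_ac)
        ultimately show ?thesis unfolding u vec.scale_right_diff_distrib sum_subtractf by simp
      qed
      also have "\<dots> \<in> ?K"
      proof (intro vec.span_sum vec.span_scale vec.span_base imageI)
        fix i assume "i \<in> {..<d}"
        then show "vscale (dot d c e) (unitv i) - vscale (c i) e \<in> K"
          using ce(4)[rule_format, of "unitv i"] by (simp add: unitv_in_vecs dot_unitv)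
      qed
      finally show ?thesis .
    qed
    moreover have "f \<circ> c \<in> ?L" "f \<circ> e \<in> vecs d" using ce fv by (auto intro: vec.span_base)
    ultimately show "\<tau> \<in> splittings d ?K ?L"
      unfolding splittings_def using dot_hom[OF f, of d c e] ce(3) by blast
  qed
  moreover have "1 \<in> rg.span (splittings d K L)" using dp by (simp add: dual_pair_def)
  ultimately have "f 1 \<in> rg.span (splittings d ?K ?L)" using span_hom_cover[OF f] by blast
  then show ?thesis unfolding dual_pair_def using sub orth' by simp
qed

definition quotients_of :: "nat \<Rightarrow> (nat \<Rightarrow> 'a::comm_ring_1) set set" where
  "quotients_of d = {K. vec.subspace K \<and> K \<subseteq> vecs d \<and> vec.lf (vecs d) K 1}"

definition lines_of :: "nat \<Rightarrow> (nat \<Rightarrow> 'a::comm_ring_1) set set" where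
  "lines_of d = {L. vec.subspace L \<and> L \<subseteq> vecs d \<and> vec.lf L {0} 1 \<and>
     (\<exists>L'. vec.subspace L' \<and> L' \<subseteq> vecs d \<and> L \<inter> L' = {0} \<and> {x + y | x y. x \<in> L \<and> y \<in> L'} = vecs d)}"

lemma quotients_of_iff: "K \<in> quotients_of d \<longleftrightarrow> dual_pair d K (perp d K)"
  using dual_pair_of_quotient[of K d] dual_pair_quotient[of d K]
  by (auto simp: quotients_of_def dual_pair_def)

lemma lines_of_iff: "L \<in> lines_of d \<longleftrightarrow> dual_pair d (perp d L) L"
proof
  assume "L \<in> lines_of d"
  then show "dual_pair d (perp d L) L"
    unfolding lines_of_def using dual_pair_of_summand[of L d] by blast
next
  assume dp: "dual_pair d (perp d L) L"
  then have "vec.subspace L" "L \<subseteq> vecs d" by (simp_all add: dual_pair_def)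
  then show "L \<in> lines_of d"
    unfolding lines_of_def using dual_pair_line[OF dp] dual_pair_summand[OF dp] by blast
qed

lemma perp_quotient:
  assumes "K \<in> quotients_of d"
  shows "perp d K \<in> lines_of d" "perp d (perp d K) = K"
  using assms dual_pair_perp[of d K "perp d K"] by (simp_all add: quotients_of_iff lines_of_iff)

lemma perp_line:
  assumes "L \<in> lines_of d"
  shows "perp d L \<in> quotients_of d" "perp d (perp d L) = L"
  using assms dual_pair_perp[of d "perp d L" L] by (simp_all add: quotients_of_iff lines_of_iff)

lemma bij_betw_perp: "bij_betw (perp d) (quotients_of d) (lines_of d)"
  by (rule bij_betw_byWitness[where f'="perp d"]) (use perp_quotient perp_line in blast)+

lemma bij_betw_image_sets:
  assumes "\<And>K. K \<in> S \<Longrightarrow> K \<subseteq> W" "inj_on g W" "T = (`) g ` S"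
  shows "bij_betw ((`) g) S T"
  unfolding bij_betw_def assms(3) inj_on_def
  using inj_on_image_eq_iff[OF assms(2)] assms(1) by auto

lemma proj_quotients_vec:
  fixes M :: "(complex, 'm) module" and \<iota> :: "complex \<Rightarrow> 'b::comm_ring_1"
  assumes "free_base_change M q d \<iota>"
  shows "bij_betw ((`) (tensor_vec \<iota> M (\<lambda>i. q (unitv i)) d)) (quotients_of d) (proj_quotients \<iota> M)"
proof -
  interpret B: free_base_change M q d \<iota> by fact
  interpret P: presentation vscale "base_change \<iota> M" "tensor_vec \<iota> M B.basis d" "vecs d" "{0}"
    by (rule B.presentation_tensor_vec)
  have lf: "locally_free (quotient_module (base_change \<iota> M) (tensor_vec \<iota> M B.basis d ` K)) 1
      \<longleftrightarrow> vec.lf (vecs d) K 1" if K: "vec.subspace K" "K \<subseteq> vecs d" for K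
  proof -
    interpret Q: presentation vscale "quotient_module (base_change \<iota> M) (tensor_vec \<iota> M B.basis d ` K)"
      "\<lambda>v. a_r_coset (base_change \<iota> M) (tensor_vec \<iota> M B.basis d ` K) (tensor_vec \<iota> M B.basis d v)"
      "vecs d" "{v \<in> vecs d. tensor_vec \<iota> M B.basis d v \<in> tensor_vec \<iota> M B.basis d ` K}"
      by (rule P.presentation_quotient[OF P.submodule_image[OF K]])
    show ?thesis
      using Q.locally_free_iff[of 1] P.preimage_image[OF K] vec.subspace_0[OF K(1)] by simp
  qed
  show ?thesis
  proof (rule bij_betw_image_sets)
    show "K \<subseteq> vecs d" if "K \<in> quotients_of d" for K :: "(nat \<Rightarrow> 'b) set"
      using that by (simp add: quotients_of_def)
    show "inj_on (tensor_vec \<iota> M B.basis d) (vecs d)" by (rule inj_onI) (simp add: P.eq)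
    show "proj_quotients \<iota> M = (`) (tensor_vec \<iota> M B.basis d) ` quotients_of d"
    proof (intro equalityI subsetI)
      fix H assume "H \<in> proj_quotients \<iota> M"
      then have H: "submodule H (rng :: 'b ring) (base_change \<iota> M)" "locally_free (quotient_module (base_change \<iota> M) H) 1"
        unfolding proj_quotients_def by blast+
      obtain K where K: "vec.subspace K" "K \<subseteq> vecs d" "H = tensor_vec \<iota> M B.basis d ` K"
        using H(1) unfolding P.submodule_iff by blast
      then have "K \<in> quotients_of d" using H(2) lf by (simp add: quotients_of_def)
      then show "H \<in> (`) (tensor_vec \<iota> M B.basis d) ` quotients_of d" using K(3) by blast
    next
      fix H assume "H \<in> (`) (tensor_vec \<iota> M B.basis d) ` quotients_of d"
      then obtain K where K: "vec.subspace K" "K \<subseteq> vecs d" "vec.lf (vecs d) K 1"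
        "H = tensor_vec \<iota> M B.basis d ` K" by (auto simp: quotients_of_def)
      then show "H \<in> proj_quotients \<iota> M"
        using lf[OF K(1,2)] P.submodule_image[OF K(1,2)] by (simp add: proj_quotients_def)
    qed
  qed
qed

lemma proj_lines_vec:
  fixes M :: "(complex, 'm) module" and \<iota> :: "complex \<Rightarrow> 'b::comm_ring_1"
  assumes "free_base_change M q d \<iota>"
  shows "bij_betw ((`) (tensor_vec \<iota> M (\<lambda>i. q (unitv i)) d)) (lines_of d) (proj_lines \<iota> M)"
proof -
  interpret B: free_base_change M q d \<iota> by fact
  let ?t = "tensor_vec \<iota> M B.basis d"
  interpret P: presentation vscale "base_change \<iota> M" ?t "vecs d" "{0}"
    by (rule B.presentation_tensor_vec)
  have inj: "inj_on ?t (vecs d)" by (rule inj_onI) (simp add: P.eq)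
  have lf: "locally_free ((base_change \<iota> M)\<lparr>carrier := ?t ` L\<rparr>) 1 \<longleftrightarrow> vec.lf L {0} 1"
    if L: "vec.subspace L" "L \<subseteq> vecs d" for L
  proof -
    interpret Q: presentation vscale "(base_change \<iota> M)\<lparr>carrier := ?t ` L\<rparr>" ?t L "{0}"
      using P.presentation_submodule[OF L(1) _ L(2)] vec.subspace_0[OF L(1)] by simp
    show ?thesis by (rule Q.locally_free_iff)
  qed
  have compl: "?t ` L \<inter> ?t ` L' = {\<zero>\<^bsub>base_change \<iota> M\<^esub>} \<and> set_add (base_change \<iota> M) (?t ` L) (?t ` L') = carrier (base_change \<iota> M)
      \<longleftrightarrow> L \<inter> L' = {0} \<and> {x + y | x y. x \<in> L \<and> y \<in> L'} = vecs d"
    if L: "vec.subspace L" "L \<subseteq> vecs d" "vec.subspace L'" "L' \<subseteq> vecs d" for L L'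
  proof -
    have "?t ` L \<inter> ?t ` L' = {\<zero>\<^bsub>base_change \<iota> M\<^esub>} \<longleftrightarrow> ?t ` (L \<inter> L') = ?t ` {0}"
      using inj_on_image_Int[OF inj L(2,4)] by (simp add: P.zero)
    also have "\<dots> \<longleftrightarrow> L \<inter> L' = {0}"
      using L by (intro inj_on_image_eq_iff[OF inj]) (auto simp: P.N0)
    finally have 1: "?t ` L \<inter> ?t ` L' = {\<zero>\<^bsub>base_change \<iota> M\<^esub>} \<longleftrightarrow> L \<inter> L' = {0}" .
    have "{x + y | x y. x \<in> L \<and> y \<in> L'} \<subseteq> vecs d" using L P.N_add by blast
    then have 2: "set_add (base_change \<iota> M) (?t ` L) (?t ` L') = carrier (base_change \<iota> M)
        \<longleftrightarrow> {x + y | x y. x \<in> L \<and> y \<in> L'} = vecs d"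
      unfolding P.set_add_image[OF L(2,4)] P.carrier by (intro inj_on_image_eq_iff[OF inj]) auto
    show ?thesis unfolding 1 2 ..
  qed
  show ?thesis
  proof (rule bij_betw_image_sets[OF _ inj])
    show "L \<subseteq> vecs d" if "L \<in> lines_of d" for L :: "(nat \<Rightarrow> 'b) set"
      using that by (simp add: lines_of_def)
    show "proj_lines \<iota> M = (`) ?t ` lines_of d"
    proof (intro equalityI subsetI)
      fix H assume "H \<in> proj_lines \<iota> M"
      then obtain H' where H: "submodule H (rng :: 'b ring) (base_change \<iota> M)" "submodule H' (rng :: 'b ring) (base_change \<iota> M)"
        "locally_free ((base_change \<iota> M)\<lparr>carrier := H\<rparr>) 1"
        "H \<inter> H' = {\<zero>\<^bsub>base_change \<iota> M\<^esub>}" "set_add (base_change \<iota> M) H H' = carrier (base_change \<iota> M)"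
        unfolding proj_lines_def by blast
      obtain L where L: "vec.subspace L" "L \<subseteq> vecs d" "H = ?t ` L"
        using H(1) unfolding P.submodule_iff by blast
      obtain L' where L': "vec.subspace L'" "L' \<subseteq> vecs d" "H' = ?t ` L'"
        using H(2) unfolding P.submodule_iff by blast
      have "L \<inter> L' = {0}" "{x + y | x y. x \<in> L \<and> y \<in> L'} = vecs d"
        using compl[OF L(1,2) L'(1,2)] H(4,5) unfolding L(3) L'(3) by blast+
      then have "L \<in> lines_of d"
        unfolding lines_of_def using L L' H(3) lf[OF L(1,2)] by blast
      then show "H \<in> (`) ?t ` lines_of d" using L(3) by blast
    next
      fix H assume "H \<in> (`) ?t ` lines_of d"
      then obtain L L' where L: "vec.subspace L" "L \<subseteq> vecs d" "H = ?t ` L" "vec.lf L {0} 1"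
        and L': "vec.subspace L'" "L' \<subseteq> vecs d"
        and c: "L \<inter> L' = {0} \<and> {x + y | x y. x \<in> L \<and> y \<in> L'} = vecs d"
        unfolding lines_of_def by blast
      have "submodule H rng (base_change \<iota> M)" "submodule (?t ` L') rng (base_change \<iota> M)"
        using P.submodule_image L L' by simp_all
      moreover have "locally_free ((base_change \<iota> M)\<lparr>carrier := H\<rparr>) 1" using lf[OF L(1,2)] L(3,4) by simp
      moreover have "H \<inter> ?t ` L' = {\<zero>\<^bsub>base_change \<iota> M\<^esub>} \<and> set_add (base_change \<iota> M) H (?t ` L') = carrier (base_change \<iota> M)"
        unfolding L(3) by (rule iffD2[OF compl[OF L(1,2) L'] c])
      ultimately show "H \<in> proj_lines \<iota> M" unfolding proj_lines_def by blast
    qed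
  qed
qed

lemma annihilator_vec:
  fixes M :: "(complex, 'm) module" and \<iota> :: "complex \<Rightarrow> 'b::comm_ring_1"
  assumes B: "free_base_change M q d \<iota>" and K: "K \<subseteq> vecs d"
  shows "annihilator \<iota> M (tensor_vec \<iota> M (\<lambda>i. q (unitv i)) d ` K)
    = tensor_vec \<iota> (dual_module M) (\<lambda>i. free_presentation.functional M q d (unitv i)) d ` perp d K"
proof -
  interpret B: free_base_change M q d \<iota> by fact
  interpret D: free_base_change "dual_module M" B.functional d \<iota>
    by (intro free_base_change.intro B.free_presentation_dual B.h.comm_ring_hom_axioms)
  interpret P: presentation vscale "base_change \<iota> (dual_module M)" "tensor_vec \<iota> (dual_module M) D.basis d" "vecs d" "{0}"
    by (rule D.presentation_tensor_vec)
  show ?thesis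
    unfolding annihilator_def P.carrier perp_def using dual_pairing_vec[OF B] by auto
qed

text \<open>In coordinates, base change of a submodule applies \<open>f\<close> to every vector.\<close>

lemma pull_submodule_vec:
  fixes M :: "(complex, 'm) module" and \<iota> :: "complex \<Rightarrow> 'a::comm_ring_1" and f :: "'a \<Rightarrow> 'b::comm_ring_1"
  assumes B: "free_base_change M q d \<iota>" and f: "comm_ring_hom f" and K: "K \<subseteq> vecs d"
  shows "pull_submodule \<iota> f M (tensor_vec \<iota> M (\<lambda>i. q (unitv i)) d ` K)
    = tensor_vec (f \<circ> \<iota>) M (\<lambda>i. q (unitv i)) d ` vec.span ((\<circ>) f ` K)"
proof -
  interpret B: free_base_change M q d \<iota> by fact
  interpret f: comm_ring_hom f by fact
  have comp: "comm_ring_hom (f \<circ> \<iota>)"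
    by (rule comm_ring_hom_comp[OF f B.h.comm_ring_hom_axioms])
  interpret C: free_base_change M q d "f \<circ> \<iota>"
    by (intro free_base_change.intro B.free_presentation_axioms comp)
  interpret P: presentation vscale "base_change (f \<circ> \<iota>) M" "tensor_vec (f \<circ> \<iota>) M C.basis d" "vecs d" "{0}"
    by (rule C.presentation_tensor_vec)
  have lift: "tensor_lift f (base_change (f \<circ> \<iota>) M) (tensor_one (f \<circ> \<iota>) M) (tensor_vec \<iota> M B.basis d v)
      = tensor_vec (f \<circ> \<iota>) M C.basis d (f \<circ> v)" if v: "v \<in> vecs d" for v
  proof -
    have "tensor_lift f (base_change (f \<circ> \<iota>) M) (tensor_one (f \<circ> \<iota>) M) (tensor_vec \<iota> M B.basis d v)
      = tensor_vec (f \<circ> \<iota>) M C.basis d (\<Sum>i<d. vscale (f (v i)) ((f \<circ> \<iota>) \<circ> B.coords (B.basis i)))"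
    proof (rule B.tensor_lift_vec[OF f C.presentation_tensor_vec])
      fix x assume x: "x \<in> carrier M"
      show "f \<circ> \<iota> \<circ> B.coords x \<in> vecs d" using B.coords_in[OF x] by (rule C.hom_vec)
      show "tensor_one (f \<circ> \<iota>) M x = tensor_vec (f \<circ> \<iota>) M C.basis d (f \<circ> \<iota> \<circ> B.coords x)"
        using C.tensor_one_vec[OF B.coords_in[OF x]] B.q_coords[OF x] by simp
      show "f \<circ> \<iota> \<circ> B.coords (a \<odot>\<^bsub>M\<^esub> x) = vscale (f (\<iota> a)) (f \<circ> \<iota> \<circ> B.coords x)" for a
        using x by (auto simp: B.coords_smult fun_eq_iff B.h.hom_mult f.hom_mult)
      show "f \<circ> \<iota> \<circ> B.coords (x \<oplus>\<^bsub>M\<^esub> y) = (f \<circ> \<iota> \<circ> B.coords x) + (f \<circ> \<iota> \<circ> B.coords y)"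
        if "y \<in> carrier M" for y
        using x that by (auto simp: B.coords_add fun_eq_iff B.h.hom_add f.hom_add)
    qed
    also have "(\<Sum>i<d. vscale (f (v i)) ((f \<circ> \<iota>) \<circ> B.coords (B.basis i)))
        = (\<Sum>i<d. vscale ((f \<circ> v) i) (unitv i))"
      by (intro sum.cong) (auto simp: B.coords_q unitv_in_vecs, auto simp: unitv_def fun_eq_iff)
    also have "\<dots> = f \<circ> v"
      by (rule vec_expand) (use v in \<open>auto simp: vecs_def\<close>)
    finally show ?thesis .
  qed
  have "tensor_lift f (base_change (f \<circ> \<iota>) M) (tensor_one (f \<circ> \<iota>) M) ` tensor_vec \<iota> M B.basis d ` K
      = tensor_vec (f \<circ> \<iota>) M C.basis d ` (\<circ>) f ` K"
    unfolding image_image using K lift by (intro image_cong) auto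
  moreover have "(\<circ>) f ` K \<subseteq> vecs d" using K by (auto simp: vecs_def)
  moreover have "vec.span ((\<circ>) f ` K \<union> {0}) = vec.span ((\<circ>) f ` K)"
  proof (rule equalityI)
    show "vec.span ((\<circ>) f ` K \<union> {0}) \<subseteq> vec.span ((\<circ>) f ` K)"
      by (rule vec.span_minimal) (auto simp: vec.span_base vec.span_zero)
  qed (rule vec.span_mono, blast)
  ultimately show ?thesis
    unfolding pull_submodule_def using P.submodule_span_image[of "(\<circ>) f ` K"] by simp
qed

section \<open>Polynomials in two variables over an algebra\<close>

lemma map_poly_hom:
  assumes "comm_ring_hom f"
  shows "comm_ring_hom (map_poly f)"
proof -
  interpret f: comm_ring_hom f by fact
  show ?thesis
  proof
    show "map_poly f (x + y) = map_poly f x + map_poly f y" for x y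
      by (rule poly_eqI) (simp add: coeff_map_poly f.hom_add)
    show "map_poly f (x * y) = map_poly f x * map_poly f y" for x y
      by (rule poly_eqI) (simp add: coeff_map_poly coeff_mult f.hom_sum f.hom_mult)
  qed (simp_all add: map_poly_1)
qed

lemma map_coeffs_hom: "comm_ring_hom f \<Longrightarrow> comm_ring_hom (map_coeffs f)"
  unfolding map_coeffs_def by (intro map_poly_hom)

lemma map_coeffs_comp:
  assumes "comm_ring_hom f" "comm_ring_hom g"
  shows "map_coeffs (f \<circ> g) u = map_coeffs f (map_coeffs g u)"
proof -
  interpret f: comm_ring_hom f by fact
  interpret g: comm_ring_hom g by fact
  show ?thesis by (intro poly_eqI) (simp add: map_coeffs_def coeff_map_poly)
qed

lemma const2_hom: "comm_ring_hom const2"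
  by unfold_locales (auto simp: const2_def one_pCons)

definition pscale :: "'a::comm_ring_1 \<Rightarrow> 'a poly poly \<Rightarrow> 'a poly poly" where
  "pscale a u = const2 a * u"

interpretation pp: ring_module pscale
proof -
  interpret c: comm_ring_hom const2 by (rule const2_hom)
  show "ring_module pscale"
    by unfold_locales (auto simp: pscale_def algebra_simps c.hom_add c.hom_mult)
qed

lemma coeff_pscale: "coeff (coeff (pscale a u) j) k = a * coeff (coeff u j) k"
  by (simp add: pscale_def const2_def)

lemma pscale_mult: "pscale a u * v = pscale a (u * v)" "v * pscale a u = pscale a (v * u)"
  by (simp_all add: pscale_def mult_ac)

lemma map_coeffs_pscale:
  assumes "comm_ring_hom f"
  shows "map_coeffs f (pscale a u) = pscale (f a) (map_coeffs f u)"
proof -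
  interpret f: comm_ring_hom f by fact
  show ?thesis
    by (intro poly_eqI) (simp add: map_coeffs_def coeff_map_poly coeff_pscale f.hom_mult)
qed

definition monomial2 :: "nat \<Rightarrow> nat \<Rightarrow> 'a::comm_ring_1 poly poly" where
  "monomial2 k j = monom (monom 1 k) j"

lemma map_coeffs_monomial2:
  assumes "comm_ring_hom f"
  shows "map_coeffs f (monomial2 k j) = monomial2 k j"
proof -
  interpret f: comm_ring_hom f by fact
  show ?thesis by (intro poly_eqI) (simp add: map_coeffs_def coeff_map_poly monomial2_def)
qed

lemma pscale_monomial2: "pscale c (monomial2 k j) = monom (monom c k) j"
  by (intro poly_eqI) (simp add: coeff_pscale monomial2_def)

text \<open>Monomials generate \<open>A[x,y]\<close> as an \<open>A\<close>-module and come from the complex numbers. Therefore linear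
  identities, and closure of an \<open>A\<close>-submodule under multiplication, need to be checked on them only.\<close>

lemma monomials_span: "u \<in> pp.span {monomial2 k j | k j. True}"
proof -
  let ?S = "pp.span {monomial2 k j | k j. True}"
  have mon: "monom v j \<in> ?S" for v :: "'a poly" and j
  proof -
    have "monom (\<Sum>k\<le>m. monom (coeff v k) k) j = (\<Sum>k\<le>m. monom (monom (coeff v k) k) j)" for m
      by (induction m) (simp_all add: add_monom[symmetric])
    from this[of "degree v"]
    have "monom v j = (\<Sum>k\<le>degree v. pscale (coeff v k) (monomial2 k j))"
      unfolding poly_as_sum_of_monoms pscale_monomial2 .
    also have "\<dots> \<in> ?S" by (intro pp.span_sum pp.span_scale pp.span_base) blast
    finally show ?thesis .
  qed
  have "u = (\<Sum>j\<le>degree u. monom (coeff u j) j)" by (simp add: poly_as_sum_of_monoms)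
  also have "\<dots> \<in> ?S" by (intro pp.span_sum mon)
  finally show ?thesis .
qed

lemma poly_induct_monomials [case_names zero step]:
  assumes "P 0" and "\<And>c k j u. P u \<Longrightarrow> P (pscale c (monomial2 k j) + u)"
  shows "P u"
  using monomials_span[of u]
  by (induction rule: pp.span_induct_alt) (use assms in auto)

lemma ideal_subspace: "rg.subspace W \<Longrightarrow> pp.subspace W"
  by (rule pp.subspaceI) (auto simp: pscale_def rg.subspace_0 rg.subspace_add rg.subspace_scale)

lemma subspace_ideal:
  assumes W: "pp.subspace W" and mon: "\<And>k j u. u \<in> W \<Longrightarrow> monomial2 k j * u \<in> W"
  shows "rg.subspace W"
proof (rule rg.subspaceI)
  fix u c assume u: "u \<in> W"
  show "c * u \<in> W"
  proof (induction c rule: poly_induct_monomials)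
    case zero
    show ?case using pp.subspace_0[OF W] by simp
  next
    case (step a k j c)
    then show ?case
      using pp.subspace_add[OF W pp.subspace_scale[OF W mon[OF u]] step]
      by (simp add: distrib_right pscale_mult)
  qed
qed (use pp.subspace_0[OF W] pp.subspace_add[OF W] in auto)

lemma span_ideal:
  assumes f: "comm_ring_hom f" and I: "rg.subspace I"
  shows "rg.subspace (pp.span (map_coeffs f ` I))"
proof (rule subspace_ideal[OF pp.subspace_span])
  interpret m: comm_ring_hom "map_coeffs f" by (rule map_coeffs_hom[OF f])
  fix k j u assume "u \<in> pp.span (map_coeffs f ` I)"
  then show "monomial2 k j * u \<in> pp.span (map_coeffs f ` I)"
  proof (induction rule: pp.span_induct_alt)
    case base
    show ?case by (simp add: pp.span_zero)
  next
    case (step c x y)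
    then obtain g where g: "g \<in> I" "x = map_coeffs f g" by blast
    have "monomial2 k j * x = map_coeffs f (monomial2 k j * g)"
      by (simp add: m.hom_mult map_coeffs_monomial2[OF f] g)
    also have "\<dots> \<in> pp.span (map_coeffs f ` I)"
      using rg.subspace_scale[OF I g(1)] by (intro pp.span_base) blast
    finally have "monomial2 k j * x \<in> pp.span (map_coeffs f ` I)" .
    then show ?case
      unfolding distrib_left pscale_mult by (intro pp.span_add pp.span_scale step)
  qed
qed

text \<open>The \<open>A\<close>-module generated by the image of an ideal is already an ideal.\<close>

lemma extend_ideal_span:
  assumes f: "comm_ring_hom f" and I: "rg.subspace I"
  shows "extend_ideal f I = pp.span (map_coeffs f ` I)"
  unfolding extend_ideal_def genideal_rng
proof (rule equalityI)
  show "rg.span (map_coeffs f ` I) \<subseteq> pp.span (map_coeffs f ` I)"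
    by (rule rg.span_minimal[OF pp.span_superset span_ideal[OF f I]])
  show "pp.span (map_coeffs f ` I) \<subseteq> rg.span (map_coeffs f ` I)"
    by (rule pp.span_minimal[OF rg.span_superset ideal_subspace[OF rg.subspace_span]])
qed

definition support2 :: "'a::comm_ring_1 poly poly \<Rightarrow> (nat \<times> nat) set" where
  "support2 u = {(j, k). coeff (coeff u j) k \<noteq> 0}"

lemma finite_support2: "finite (support2 u)"
proof (rule finite_subset)
  show "support2 u \<subseteq> Sigma {..degree u} (\<lambda>j. {..degree (coeff u j)})"
    by (auto simp: support2_def intro!: le_degree)
qed auto

text \<open>The base change \<open>A[x,y] = R \<otimes> A \<rightarrow> A\<close> of a complex linear functional on \<open>R\<close>.\<close>

definition extend_functional ::
    "(complex \<Rightarrow> 'a::comm_ring_1) \<Rightarrow> (complex poly poly \<Rightarrow> complex) \<Rightarrow> 'a poly poly \<Rightarrow> 'a" where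
  "extend_functional h l u =
     (\<Sum>(j, k)\<in>support2 u. coeff (coeff u j) k * h (l (monomial2 k j)))"

lemma extend_functional_superset:
  assumes "finite F" "support2 u \<subseteq> F"
  shows "extend_functional h l u = (\<Sum>(j, k)\<in>F. coeff (coeff u j) k * h (l (monomial2 k j)))"
  unfolding extend_functional_def
  using assms by (intro sum.mono_neutral_left) (auto simp: support2_def)

lemma extend_functional_hom: "module_hom pscale (*) (extend_functional h l)"
proof
  fix u v :: "'a poly poly" and a
  let ?F = "support2 u \<union> support2 v"
  have "finite ?F" "support2 (u + v) \<subseteq> ?F" by (auto simp: finite_support2) (auto simp: support2_def)
  then show "extend_functional h l (u + v) = extend_functional h l u + extend_functional h l v"
    by (simp add: extend_functional_superset[of ?F] sum.distrib[symmetric] distrib_right split_beta)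
  have "support2 (pscale a u) \<subseteq> support2 u" by (auto simp: support2_def coeff_pscale)
  then show "extend_functional h l (pscale a u) = a * extend_functional h l u"
    by (simp add: extend_functional_superset[of "support2 u"] finite_support2 coeff_pscale
        sum_distrib_left split_beta mult.assoc)
qed

lemma extend_functional_monomial: "extend_functional h l (monomial2 k j) = h (l (monomial2 k j))"
  by (subst extend_functional_superset[of "{(j, k)}"]) (auto simp: support2_def monomial2_def split: if_splits)

lemma extend_functional_map_coeffs:
  assumes h: "comm_ring_hom h" and l: "module_hom pscale (*) l"
  shows "extend_functional h l (map_coeffs h g) = h (l g)"
proof -
  interpret h: comm_ring_hom h by fact
  interpret m: comm_ring_hom "map_coeffs h" by (rule map_coeffs_hom[OF h])
  interpret l: module_hom pscale "(*)" l by fact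
  interpret E: module_hom pscale "(*)" "extend_functional h l" by (rule extend_functional_hom)
  show ?thesis
  proof (induction g rule: poly_induct_monomials)
    case zero
    show ?case using m.hom_zero h.hom_zero l.zero E.zero by simp
  next
    case (step c k j u)
    then show ?case
      by (simp add: m.hom_add map_coeffs_pscale[OF h] map_coeffs_monomial2[OF h] E.add E.scale
          extend_functional_monomial l.add l.scale h.hom_add h.hom_mult)
  qed
qed

lemma eval_at_hom: "comm_ring_hom (eval_at p)"
  by unfold_locales (auto simp: eval_at_def)

lemma eval_at_const2 [simp]: "eval_at p (const2 c) = c"
  by (simp add: eval_at_def const2_def)

lemma max_ideal_iff: "r \<in> max_ideal p \<longleftrightarrow> eval_at p r = 0"
  by (simp add: max_ideal_def a_kernel_def kernel_def)

lemma max_ideal_ideal: "rg.subspace (max_ideal p)"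
proof -
  interpret e: comm_ring_hom "eval_at p" by (rule eval_at_hom)
  show ?thesis by (rule rg.subspaceI) (auto simp: max_ideal_iff e.hom_add e.hom_mult)
qed

section \<open>The fibre of an ideal at a point\<close>

locale ideal_at_point =
  fixes J :: "complex poly poly set" and p :: "complex \<times> complex"
  assumes J: "rg.subspace J"
begin

abbreviation mJ :: "complex poly poly set" where
  "mJ \<equiv> ideal_prod rng (max_ideal p) J"

sublocale e: comm_ring_hom "eval_at p"
  by (rule eval_at_hom)

lemma mJ: "rg.subspace mJ"
  using ring.ideal_prod_is_ideal[OF ring_rng, of "max_ideal p" J] J max_ideal_ideal
  unfolding ideal_rng by blast

lemma mJ_prod: "eval_at p r = 0 \<Longrightarrow> g \<in> J \<Longrightarrow> r * g \<in> mJ"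
  using ideal_prod.prod[of r "max_ideal p" g J rng] by (simp add: max_ideal_iff)

lemma mJ_induct [consumes 1, case_names prod sum]:
  assumes "h \<in> mJ" and "\<And>r g. eval_at p r = 0 \<Longrightarrow> g \<in> J \<Longrightarrow> P (r * g)"
    and "\<And>a b. a \<in> mJ \<Longrightarrow> P a \<Longrightarrow> b \<in> mJ \<Longrightarrow> P b \<Longrightarrow> P (a + b)"
  shows "P h"
  using assms(1)
  by (induction rule: ideal_prod.induct) (use assms(2,3) in \<open>auto simp: max_ideal_iff\<close>)

lemma mJ_subset: "mJ \<subseteq> J"
proof
  fix h assume "h \<in> mJ"
  then show "h \<in> J"
    by (induction rule: mJ_induct) (auto simp: rg.subspace_scale[OF J] rg.subspace_add[OF J])
qed

text \<open>The polynomial \<open>r - r(p)\<close> vanishes at \<open>p\<close>.\<close>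

lemma mJ_eval: "g \<in> J \<Longrightarrow> r * g - pscale (eval_at p r) g \<in> mJ"
  using mJ_prod[of "r - const2 (eval_at p r)" g] by (simp add: e.hom_minus pscale_def algebra_simps)

lemma J_module: "presentation (*) (as_module id J) (\<lambda>x. x) J {0}"
  by (rule presentation_as_module) (auto intro: J ring_module.intro rg.module_axioms)

sublocale R: base_change_presentation "(*)" "as_module id J" "\<lambda>x. x" J "{0}" "eval_at p"
  by (intro base_change_presentation.intro J_module eval_at_hom)

lemma restrict_class: "restrict_to_fibre J p g = R.tensor_class (Poly_Mapping.single g 1)"
  by (simp add: restrict_to_fibre_def R.tensor_one_class)

definition rel :: "(complex poly poly \<Rightarrow>\<^sub>0 complex) set" where
  "rel = tensor_relations (eval_at p) (as_module id J)"

lemma relation_add: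
  "x \<in> J \<Longrightarrow> y \<in> J \<Longrightarrow> Poly_Mapping.single (x + y) 1 - Poly_Mapping.single x 1
     - Poly_Mapping.single y 1 \<in> rel"
  unfolding rel_def R.tensor_relations relations_def
  by (intro fm.span_base UnI1) (auto simp: as_module_def)

lemma relation_smult:
  "x \<in> J \<Longrightarrow> Poly_Mapping.single (r * x) 1 - Poly_Mapping.single x (eval_at p r)
     \<in> rel"
  unfolding rel_def R.tensor_relations relations_def
  by (intro fm.span_base UnI2) (auto simp: as_module_def)

lemma J_carrier: "carrier (as_module id J) = J"
  by (simp add: as_module_def)

lemma relations_subspace: "fm.subspace rel"
  by (simp add: rel_def R.tensor_relations)

text \<open>The map \<open>\<Sum> g \<otimes> c \<mapsto> \<Sum> c g\<close> with values in \<open>J\<close>. It is a map of vector spaces, not of \<open>R\<close>-modules, and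
  becomes well defined on \<open>J \<otimes> R/\<mm>\<close> modulo \<open>\<mm>J\<close>.\<close>

abbreviation total :: "(complex poly poly \<Rightarrow>\<^sub>0 complex) \<Rightarrow> complex poly poly" where
  "total \<equiv> lift (\<lambda>c. c) pscale (\<lambda>g. g)"

lemma total_extension: "semilinear_extension pscale (\<lambda>c::complex. c)"
  by (intro semilinear_extension.intro pp.ring_module_axioms comm_ring_hom_ident)

lemmas total_add = semilinear_extension.lift_add[OF total_extension]
  and total_diff = semilinear_extension.lift_diff[OF total_extension]
  and total_scale = semilinear_extension.lift_scale[OF total_extension]
  and total_single = semilinear_extension.lift_single[OF total_extension]

lemma total_J: "c \<in> supported J \<Longrightarrow> total c \<in> J"
  unfolding lift_def
  by (intro pp.subspace_sum pp.subspace_scale ideal_subspace[OF J]) (auto simp: supported_def)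

lemma total_relations:
  assumes "c \<in> rel"
  shows "total c \<in> mJ"
  using assms unfolding rel_def R.tensor_relations
proof (induction rule: fm.span_induct_alt)
  case base
  show ?case using rg.subspace_0[OF mJ] by (simp add: lift_def)
next
  case (step c x y)
  have "total x \<in> mJ"
    using step(1) unfolding relations_def
  proof (elim UnE CollectE exE conjE)
    fix g g' assume "x = Poly_Mapping.single (g \<oplus>\<^bsub>as_module id J\<^esub> g') 1 - Poly_Mapping.single g 1 - Poly_Mapping.single g' 1"
    then show ?thesis using rg.subspace_0[OF mJ] by (simp add: total_diff total_single as_module_def)
  next
    fix r g assume "x = Poly_Mapping.single (r \<odot>\<^bsub>as_module id J\<^esub> g) 1 - Poly_Mapping.single g (eval_at p r)"
      "g \<in> carrier (as_module id J)"
    then show ?thesis using mJ_eval[of g r] by (simp add: total_diff total_single as_module_def)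
  qed
  then show ?case
    unfolding total_add total_scale
    using step(2) pp.subspace_add[OF ideal_subspace[OF mJ]] pp.subspace_scale[OF ideal_subspace[OF mJ]] by blast
qed

lemma single_mJ:
  assumes "h \<in> mJ"
  shows "Poly_Mapping.single h 1 \<in> rel"
  using assms
proof (induction rule: mJ_induct)
  case (prod r g)
  then have "Poly_Mapping.single (r * g) 1 \<in> rel"
    using relation_smult[of g r] by simp
  then show ?case .
next
  case (sum a b)
  then have "a \<in> J" "b \<in> J" using mJ_subset by auto
  from fm.subspace_add[OF relations_subspace relation_add[OF this] fm.subspace_add[OF relations_subspace sum.IH]]
  have "Poly_Mapping.single (a + b) 1 \<in> rel"
    by simp
  then show ?case .
qed

lemma single_total:
  assumes c: "c \<in> supported J"
  shows "c - Poly_Mapping.single (total c) 1 \<in> rel"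
proof -
  have "(\<Sum>g\<in>F. Poly_Mapping.single g (Poly_Mapping.lookup c g))
      - Poly_Mapping.single (\<Sum>g\<in>F. pscale (Poly_Mapping.lookup c g) g) 1 \<in> rel"
    if "finite F" "F \<subseteq> J" for F
    using that
  proof (induction F)
    case empty
    have "Poly_Mapping.single 0 1 \<in> rel" by (rule single_mJ[OF rg.subspace_0[OF mJ]])
    from fm.subspace_neg[OF relations_subspace this] show ?case by simp
  next
    case (insert g F)
    let ?s = "\<Sum>g\<in>F. pscale (Poly_Mapping.lookup c g) g"
    have g: "g \<in> J" "pscale (Poly_Mapping.lookup c g) g \<in> J"
      using insert rg.subspace_scale[OF J] by (auto simp: pscale_def)
    have s: "?s \<in> J"
      using insert.prems by (intro pp.subspace_sum[OF ideal_subspace[OF J]] pp.subspace_scale[OF ideal_subspace[OF J]]) auto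
    have 1: "Poly_Mapping.single (pscale (Poly_Mapping.lookup c g) g) 1
        - Poly_Mapping.single g (Poly_Mapping.lookup c g) \<in> rel"
      using relation_smult[OF g(1), of "const2 (Poly_Mapping.lookup c g)"] by (simp add: pscale_def)
    have 2: "(\<Sum>g\<in>F. Poly_Mapping.single g (Poly_Mapping.lookup c g)) - Poly_Mapping.single ?s 1 \<in> rel"
      using insert by simp
    show ?case
      using fm.subspace_diff[OF relations_subspace fm.subspace_diff[OF relations_subspace 2 1] relation_add[OF g(2) s]] insert.hyps
      by (simp add: algebra_simps)
  qed
  from this[of "Poly_Mapping.keys c"] show ?thesis
    using c by (simp add: supported_def sum_singles lift_def)
qed

text \<open>The isomorphism \<open>J/\<mm>J \<cong> J \<otimes> R/\<mm>\<close>: by \<open>single_total\<close> every tensor is of the form \<open>g \<otimes> 1\<close>, and \<open>total\<close>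
  provides the inverse.\<close>

lemma presentation_fibre: "presentation pscale (ideal_fibre J p) (restrict_to_fibre J p) J mJ"
proof -
  interpret B: presentation fscale "ideal_fibre J p" R.tensor_class "supported J" rel
    using R.presentation_base_change by (simp add: ideal_fibre_def J_carrier rel_def)
  note sJ = single_supported[of _ J "1 :: complex"]
  show ?thesis
  proof
    show "pp.subspace J" by (rule ideal_subspace[OF J])
    show "mJ \<subseteq> J" by (rule mJ_subset)
    show "carrier (ideal_fibre J p) = restrict_to_fibre J p ` J"
      unfolding B.carrier
    proof (intro equalityI subsetI)
      fix u assume "u \<in> R.tensor_class ` supported J"
      then obtain c where c: "c \<in> supported J" "u = R.tensor_class c" by blast
      then have "u = restrict_to_fibre J p (total c)"
        unfolding restrict_class using B.eq[OF c(1) sJ] total_J single_total by simp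
      then show "u \<in> restrict_to_fibre J p ` J" using total_J[OF c(1)] by blast
    qed (auto simp: restrict_class sJ)
    have "Poly_Mapping.single 0 1 \<in> rel" by (rule single_mJ[OF rg.subspace_0[OF mJ]])
    then show "\<zero>\<^bsub>ideal_fibre J p\<^esub> = restrict_to_fibre J p 0"
      using B.eq0[OF sJ[of 0]] rg.subspace_0[OF J] by (simp add: B.zero restrict_class)
  next
    fix x y a assume x: "x \<in> J"
    show "a \<odot>\<^bsub>ideal_fibre J p\<^esub> restrict_to_fibre J p x = restrict_to_fibre J p (pscale a x)"
    proof -
      have ax: "pscale a x \<in> J" using pp.subspace_scale[OF ideal_subspace[OF J] x] .
      have f: "fscale a (Poly_Mapping.single x 1) = Poly_Mapping.single x a"
        by (rule poly_mapping_eqI) (simp add: lookup_single when_def)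
      have "Poly_Mapping.single (pscale a x) 1 - Poly_Mapping.single x a \<in> rel"
        using relation_smult[OF x, of "const2 a"] by (simp add: pscale_def)
      then have "R.tensor_class (Poly_Mapping.single (pscale a x) 1) = R.tensor_class (Poly_Mapping.single x a)"
        using B.eq[OF sJ[OF ax] single_supported[OF x]] by simp
      then show ?thesis using B.smult[OF sJ[OF x], of a] by (simp add: restrict_class f)
    qed
    assume y: "y \<in> J"
    have xy: "x + y \<in> J" "x - y \<in> J" using rg.subspace_add[OF J x y] rg.subspace_diff[OF J x y] .
    have "Poly_Mapping.single (x + y) 1 - (Poly_Mapping.single x 1 + Poly_Mapping.single y 1) \<in> rel"
      using relation_add[OF x y] by (simp add: diff_diff_eq)
    then show "restrict_to_fibre J p x \<oplus>\<^bsub>ideal_fibre J p\<^esub> restrict_to_fibre J p y = restrict_to_fibre J p (x + y)"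
      unfolding restrict_class using B.add[OF sJ[OF x] sJ[OF y]] B.eq[OF sJ[OF xy(1)] B.N_add[OF sJ[OF x] sJ[OF y]]]
      by simp
    have "Poly_Mapping.single x 1 - Poly_Mapping.single y 1 \<in> rel \<longleftrightarrow> x - y \<in> mJ"
    proof
      assume "Poly_Mapping.single x 1 - Poly_Mapping.single y 1 \<in> rel"
      from total_relations[OF this] show "x - y \<in> mJ" by (simp add: total_diff total_single)
    next
      assume "x - y \<in> mJ"
      from fm.subspace_add[OF relations_subspace relation_add[OF xy(2) y] single_mJ[OF this]]
      show "Poly_Mapping.single x 1 - Poly_Mapping.single y 1 \<in> rel" by simp
    qed
    then show "restrict_to_fibre J p x = restrict_to_fibre J p y \<longleftrightarrow> x - y \<in> mJ"
      unfolding restrict_class using B.eq[OF sJ[OF x] sJ[OF y]] by simp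
  qed
qed

lemma presentation_quotient_mJ:
  "presentation pscale (quotient_module (as_module const2 J) mJ)
     (\<lambda>g. a_r_coset (as_module const2 J :: (complex, _) module) mJ g) J mJ"
proof -
  interpret P: presentation pscale "as_module const2 J" "\<lambda>x. x" J "{0}"
    by (rule presentation_as_module[OF pp.ring_module_axioms _ ideal_subspace[OF J]]) (simp add: pscale_def)
  have "submodule ((\<lambda>x. x) ` mJ) (rng :: complex ring) (as_module const2 J)"
    by (rule P.submodule_image[OF ideal_subspace[OF mJ] mJ_subset])
  then have "submodule mJ (rng :: complex ring) (as_module const2 J)" by simp
  from P.presentation_quotient[OF this] show ?thesis
    using mJ_subset by (simp add: Int_absorb1 Collect_conj_eq)
qed

end

section \<open>Ideals of finite colength\<close>

lemma presentation_plane_quotient: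
  assumes I: "rg.subspace (I :: 'a::comm_ring_1 poly poly set)"
  shows "presentation pscale (quotient_module (as_module (const2 :: 'a \<Rightarrow> _) UNIV) I)
    (\<lambda>u. a_r_coset (as_module (const2 :: 'a \<Rightarrow> _) UNIV) I u) UNIV I"
proof -
  interpret P: presentation pscale "as_module (const2 :: 'a \<Rightarrow> _) UNIV" "\<lambda>u. u" UNIV "{0}"
    by (rule presentation_as_module[OF pp.ring_module_axioms]) (simp_all add: pscale_def)
  have "submodule ((\<lambda>u. u) ` I) (rng :: 'a ring) (as_module const2 UNIV)"
    by (rule P.submodule_image[OF ideal_subspace[OF I]]) simp
  then have "submodule I (rng :: 'a ring) (as_module const2 UNIV)" by simp
  from P.presentation_quotient[OF this] show ?thesis by simp
qed

lemma hilb_iff: "I \<in> hilb n \<longleftrightarrow> rg.subspace I \<and> pp.lf UNIV I n"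
  using presentation.locally_free_iff[OF presentation_plane_quotient, of I n]
  by (auto simp: hilb_def ideal_rng)

text \<open>A basis of \<open>R/J\<close>, lifted to \<open>R\<close>, together with the coordinate functionals on \<open>R\<close>.\<close>

lemma colength_basis:
  assumes J: "J \<in> hilb_closed_points n"
  obtains e cf where "rg.subspace J" and "\<And>i. i < n \<Longrightarrow> module_hom pscale (*) (cf i)"
    and "\<And>i g. i < n \<Longrightarrow> g \<in> J \<Longrightarrow> cf i g = 0"
    and "\<And>i j. i < n \<Longrightarrow> j < n \<Longrightarrow> cf i (e j) = (if i = j then 1 else 0)"
    and "\<And>r. r - (\<Sum>i<n. pscale (cf i r) (e i)) \<in> J"
proof -
  let ?M = "quotient_module (as_module (const2 :: complex \<Rightarrow> _) UNIV) J"
  have I: "rg.subspace J" using J by (simp add: hilb_closed_points_def ideal_rng)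
  then have I': "pp.subspace J" by (rule ideal_subspace)
  interpret P: presentation pscale ?M "\<lambda>u. a_r_coset (as_module (const2 :: complex \<Rightarrow> _) UNIV) J u" UNIV J
    by (rule presentation_plane_quotient[OF I])
  let ?q = "\<lambda>u. a_r_coset (as_module (const2 :: complex \<Rightarrow> _) UNIV) J u"
  have "free_of_rank ?M n" using J by (simp add: hilb_closed_points_def)
  then obtain E where E: "E \<in> {..<n} \<rightarrow> carrier ?M" and gen: "\<forall>m\<in>carrier ?M.
        \<exists>!c. c \<in> extensional {..<n} \<and> m = (\<Oplus>\<^bsub>?M\<^esub>i\<in>{..<n}. c i \<odot>\<^bsub>?M\<^esub> E i)"
    unfolding free_of_rank_def by (rule bexE)
  have "\<forall>i<n. \<exists>u. E i = ?q u" using E P.carrier by blast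
  then obtain e where e: "\<And>i. i < n \<Longrightarrow> E i = ?q (e i)" by metis
  have comb: "(\<Oplus>\<^bsub>?M\<^esub>i\<in>{..<n}. c i \<odot>\<^bsub>?M\<^esub> E i) = ?q (\<Sum>i<n. pscale (c i) (e i))" for c
    by (rule P.finsum) (use P.smult in \<open>auto simp: e\<close>)
  have ex1: "\<exists>!c. c \<in> extensional {..<n} \<and> r - (\<Sum>i<n. pscale (c i) (e i)) \<in> J" for r
  proof -
    have "?q r \<in> carrier ?M" unfolding P.carrier by (rule imageI) simp
    from gen[rule_format, OF this] show ?thesis unfolding comb by (simp add: P.eq)
  qed
  define C where "C r = (THE c. c \<in> extensional {..<n} \<and> r - (\<Sum>i<n. pscale (c i) (e i)) \<in> J)" for r
  have C: "r - (\<Sum>i<n. pscale (C r i) (e i)) \<in> J" for r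
    using theI'[OF ex1[of r]] by (simp add: C_def)
  have Cuniq: "c i = C r i" if c: "r - (\<Sum>i<n. pscale (c i) (e i)) \<in> J" and i: "i < n" for c r i
  proof -
    have "r - (\<Sum>i<n. pscale (restrict c {..<n} i) (e i)) \<in> J" using c by simp
    then have "restrict c {..<n} \<in> extensional {..<n} \<and> r - (\<Sum>i<n. pscale (restrict c {..<n} i) (e i)) \<in> J"
      by simp
    from the1_equality[where P="\<lambda>c. c \<in> extensional {..<n} \<and> r - (\<Sum>i<n. pscale (c i) (e i)) \<in> J",
        OF ex1 this] have "C r = restrict c {..<n}" unfolding C_def .
    then show ?thesis using i by simp
  qed
  show ?thesis
  proof (rule that[of "\<lambda>i r. C r i" e])
    show "module_hom pscale (*) (\<lambda>r. C r i)" if i: "i < n" for i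
    proof
      fix r r' :: "complex poly poly" and a
      have "(r + r') - (\<Sum>i<n. pscale (C r i + C r' i) (e i))
          = (r - (\<Sum>i<n. pscale (C r i) (e i))) + (r' - (\<Sum>i<n. pscale (C r' i) (e i)))"
        by (simp add: pp.scale_left_distrib sum.distrib)
      also have "\<dots> \<in> J" by (intro pp.subspace_add[OF I'] C)
      finally show "C (r + r') i = C r i + C r' i" using Cuniq[OF _ i] by metis
      have "pscale a r - (\<Sum>i<n. pscale (a * C r i) (e i)) = pscale a (r - (\<Sum>i<n. pscale (C r i) (e i)))"
        by (simp add: pp.scale_right_diff_distrib pp.scale_sum_right)
      also have "\<dots> \<in> J" by (intro pp.subspace_scale[OF I'] C)
      finally show "C (pscale a r) i = a * C r i" using Cuniq[OF _ i] by metis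
    qed
    show "C g i = 0" if "i < n" "g \<in> J" for i g
      using Cuniq[of g "\<lambda>_. 0" i] that by simp
    show "C (e j) i = (if i = j then 1 else 0)" if "i < n" "j < n" for i j
    proof -
      have "(\<Sum>k<n. pscale (if k = j then 1 else 0) (e k)) = e j"
        using that by (subst sum.remove[of _ j]) (auto intro!: sum.neutral)
      then show ?thesis
        using Cuniq[of "e j" "\<lambda>k. if k = j then 1 else 0" i] that pp.subspace_0[OF I'] by simp
    qed
  qed (use I C in auto)
qed

interpretation cpp: Vector_Spaces.vector_space "pscale :: complex \<Rightarrow> _"
  by unfold_locales (auto simp: algebra_simps pp.scale_right_distrib pp.scale_left_distrib)

lemma monomials_generate:
  fixes W :: "'a::comm_ring_1 poly poly set"
  assumes W: "pp.subspace W" and 1: "1 \<in> W"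
    and x: "\<And>u. u \<in> W \<Longrightarrow> monomial2 1 0 * u \<in> W" and y: "\<And>u. u \<in> W \<Longrightarrow> monomial2 0 1 * u \<in> W"
  shows "u \<in> W"
proof -
  have mult: "monomial2 (k + k') (j + j') = monomial2 k j * (monomial2 k' j' :: 'a poly poly)" for k k' j j'
    by (simp add: monomial2_def mult_monom)
  have "monomial2 k j \<in> W" for k j
  proof (induction k)
    case 0
    show ?case
    proof (induction j)
      case 0
      have "monomial2 0 0 = (1 :: 'a poly poly)" by (simp add: monomial2_def)
      then show ?case using 1 by simp
    next
      case (Suc j)
      have "monomial2 0 (1 + j) \<in> W" using y[OF Suc.IH] mult[of 0 0 1 j] by (simp only: add_0)
      then show ?case by simp
    qed
  next
    case (Suc k)
    have "monomial2 (1 + k) j \<in> W" using x[OF Suc.IH] mult[of 1 k 0 j] by (simp only: add_0)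
    then show ?case by simp
  qed
  then have "{monomial2 k j | k j. True} \<subseteq> W" by blast
  from pp.span_minimal[OF this W] show ?thesis using monomials_span by blast
qed

locale colength_ideal = ideal_at_point J p for J p +
  fixes n :: nat and e :: "nat \<Rightarrow> complex poly poly" and cf :: "nat \<Rightarrow> complex poly poly \<Rightarrow> complex"
  assumes cf_hom: "i < n \<Longrightarrow> module_hom pscale (*) (cf i)"
    and cf_J: "i < n \<Longrightarrow> g \<in> J \<Longrightarrow> cf i g = 0"
    and cf_e: "i < n \<Longrightarrow> j < n \<Longrightarrow> cf i (e j) = (if i = j then 1 else 0)"
    and cf_gen: "r - (\<Sum>i<n. pscale (cf i r) (e i)) \<in> J"
begin

text \<open>Let \<open>E\<close> be the span of the lifts \<open>e i\<close>, so that \<open>R = E \<oplus> J\<close>. Let \<open>G\<close> consist of the components in \<open>J\<close> of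
  \<open>1\<close>, \<open>x e i\<close> and \<open>y e i\<close>. Then \<open>E + span G + \<mm>J\<close> contains \<open>1\<close> and is closed under multiplication by \<open>x\<close> and
  \<open>y\<close>, since these act on \<open>J/\<mm>J\<close> as scalars. So it is all of \<open>R\<close>, and intersecting with \<open>J\<close> removes \<open>E\<close>.\<close>

lemma finite_generation_mod_mJ:
  obtains G where "finite G" "G \<subseteq> J" "J \<subseteq> pp.span (mJ \<union> G)"
proof -
  \<comment> \<open>The component of \<open>r\<close> in \<open>J\<close> along the decomposition \<open>R = E \<oplus> J\<close>.\<close>
  let ?red = "\<lambda>r. r - (\<Sum>i<n. pscale (cf i r) (e i))"
  define G where "G = insert (?red 1) ((\<lambda>i. ?red (monomial2 1 0 * e i)) ` {..<n}
      \<union> (\<lambda>i. ?red (monomial2 0 1 * e i)) ` {..<n})"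
  have G: "finite G" "G \<subseteq> J" unfolding G_def using cf_gen by auto
  let ?E = "e ` {..<n}"
  let ?W = "pp.span (?E \<union> (mJ \<union> G))"
  have red: "r \<in> ?W" if "?red r \<in> G" for r
  proof -
    have "?red r + (\<Sum>i<n. pscale (cf i r) (e i)) \<in> ?W"
      using that by (intro pp.span_add pp.span_sum pp.span_scale pp.span_base) auto
    then show ?thesis by simp
  qed
  have closed: "m * u \<in> ?W" if m: "\<And>i. i < n \<Longrightarrow> ?red (m * e i) \<in> G" and u: "u \<in> ?W" for m u
    using u
  proof (induction rule: pp.span_induct_alt)
    case base
    show ?case by (simp add: pp.span_zero)
  next
    case (step c x y)
    have "m * x \<in> ?W" using step(1)
    proof (elim UnE imageE)
      fix i assume "x = e i" "i \<in> {..<n}"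
      then show ?thesis using red[OF m] by simp
    next
      assume "x \<in> mJ"
      then have "m * x \<in> mJ" by (rule rg.subspace_scale[OF mJ])
      then show ?thesis by (intro pp.span_base) auto
    next
      assume x: "x \<in> G"
      have "(m * x - pscale (eval_at p m) x) + pscale (eval_at p m) x \<in> ?W"
        using x mJ_eval[of x m] G by (intro pp.span_add pp.span_scale pp.span_base) auto
      then show ?thesis by simp
    qed
    then show ?case unfolding distrib_left pscale_mult by (intro pp.span_add pp.span_scale step)
  qed
  have all: "u \<in> ?W" for u
  proof (rule monomials_generate[OF pp.subspace_span])
    show "1 \<in> ?W" by (rule red) (simp add: G_def)
    show "monomial2 1 0 * u \<in> ?W" if "u \<in> ?W" for u by (rule closed[OF _ that]) (simp add: G_def)
    show "monomial2 0 1 * u \<in> ?W" if "u \<in> ?W" for u by (rule closed[OF _ that]) (simp add: G_def)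
  qed
  have "J \<subseteq> pp.span (mJ \<union> G)"
  proof
    fix g assume g: "g \<in> J"
    obtain a w where aw: "g = a + w" "a \<in> pp.span ?E" "w \<in> pp.span (mJ \<union> G)"
      using all[of g] unfolding pp.span_Un[of ?E] by blast
    have "pp.span (mJ \<union> G) \<subseteq> J"
      using mJ_subset G by (intro pp.span_minimal ideal_subspace[OF J]) auto
    then have "a \<in> J" using aw g rg.subspace_diff[OF J g, of w] by auto
    have "(\<Sum>i<n. pscale (cf i a) (e i)) = a" using aw(2)
    proof (induction rule: pp.span_induct_alt)
      case base
      have "cf i 0 = 0" if "i < n" for i using cf_J[OF that] rg.subspace_0[OF J] by blast
      then show ?case by simp
    next
      case (step c x y)
      then obtain j where j: "j < n" "x = e j" by blast
      have "cf i (pscale c x + y) = c * (if i = j then 1 else 0) + cf i y" if "i < n" for i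
      proof -
        interpret module_hom pscale "(*)" "cf i" by (rule cf_hom[OF that])
        show ?thesis using cf_e[OF that j(1)] j(2) by (simp add: add scale)
      qed
      then have "(\<Sum>i<n. pscale (cf i (pscale c x + y)) (e i))
          = (\<Sum>i<n. pscale (c * (if i = j then 1 else 0)) (e i)) + (\<Sum>i<n. pscale (cf i y) (e i))"
        by (simp add: pp.scale_left_distrib sum.distrib)
      also have "(\<Sum>i<n. pscale (c * (if i = j then 1 else 0)) (e i)) = pscale c (e j)"
        using j by (subst sum.remove[of _ j]) (auto intro!: sum.neutral)
      finally show ?case using step(2) j by simp
    qed
    then have "a = 0" using cf_J[OF _ \<open>a \<in> J\<close>] by simp
    then show "g \<in> pp.span (mJ \<union> G)" using aw by simp
  qed
  then show ?thesis using that G by blast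
qed

text \<open>Extend a basis \<open>B0\<close> of \<open>\<mm>J\<close> by finitely many elements to a basis \<open>B\<close> of \<open>J\<close>, and this to a basis \<open>BB\<close>
  of \<open>R\<close>. The added elements represent a basis of \<open>J/\<mm>J\<close>, and the basis of \<open>R\<close> extends its coordinate
  functionals to \<open>R\<close>. After base change they are functionals on \<open>A[x,y]\<close>, through which the map
  \<open>J \<otimes> A \<rightarrow> J(p) \<otimes> A\<close> factors.\<close>

lemma fibre_basis_exists:
  obtains d :: nat and b and lam :: "nat \<Rightarrow> complex poly poly \<Rightarrow> complex"
    where "\<And>i. i < d \<Longrightarrow> module_hom pscale (*) (lam i)"
    and "\<And>i. i < d \<Longrightarrow> b i \<in> J"
    and "\<And>i j. i < d \<Longrightarrow> j < d \<Longrightarrow> lam i (b j) = (if i = j then 1 else 0)"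
    and "\<And>i g. i < d \<Longrightarrow> g \<in> mJ \<Longrightarrow> lam i g = 0"
    and "\<And>g. g \<in> J \<Longrightarrow> g - (\<Sum>i<d. pscale (lam i g) (b i)) \<in> mJ"
proof -
  obtain G where G: "finite G" "G \<subseteq> J" "J \<subseteq> pp.span (mJ \<union> G)" by (rule finite_generation_mod_mJ)
  obtain B0 where B0: "B0 \<subseteq> mJ" "pp.independent B0" "mJ \<subseteq> pp.span B0"
    by (rule cpp.maximal_independent_subset[of mJ]) (rule that)
  obtain B where B: "B0 \<subseteq> B" "B \<subseteq> B0 \<union> G" "pp.independent B" "B0 \<union> G \<subseteq> pp.span B"
    by (rule cpp.maximal_independent_subset_extend[OF Un_upper1[of B0 G] B0(2)]) (rule that)
  obtain BB where BB: "B \<subseteq> BB" "pp.independent BB" "UNIV \<subseteq> pp.span BB"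
    by (rule cpp.maximal_independent_subset_extend[OF subset_UNIV[of B] B(3)]) (rule that)
  have spanB: "J \<subseteq> pp.span B"
  proof -
    have "mJ \<union> G \<subseteq> pp.span B" using B0(3) pp.span_mono[OF B(1)] B(4) by blast
    then have "pp.span (mJ \<union> G) \<subseteq> pp.span B" by (rule pp.span_minimal) simp
    then show ?thesis using G by blast
  qed
  have "finite (B - B0)" by (rule finite_subset[OF _ G(1)]) (use B(2) in blast)
  then obtain b where b: "bij_betw b {0..<card (B - B0)} (B - B0)" using ex_bij_betw_nat_finite by blast
  define d where "d = card (B - B0)"
  have bB: "b i \<in> B - B0" if "i < d" for i
    using b that by (auto simp: d_def bij_betw_def)
  have b_inj: "i = j" if "b i = b j" "i < d" "j < d" for i j
    using b that by (auto simp: d_def bij_betw_def inj_on_def)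
  define lam where "lam i r = pp.representation BB r (b i)" for i r
  have spanBB: "r \<in> pp.span BB" for r using BB(3) by blast
  have lam_hom: "module_hom pscale (*) (lam i)" for i
    by unfold_locales
      (simp_all add: lam_def pp.representation_add[OF BB(2)] pp.representation_scale[OF BB(2)] spanBB)
  have lam_b: "lam i (b j) = (if i = j then 1 else 0)" if "i < d" "j < d" for i j
  proof -
    have "b j \<in> BB" using bB[OF that(2)] BB(1) by blast
    then show ?thesis using b_inj that by (auto simp: lam_def pp.representation_basis[OF BB(2)])
  qed
  have lam_mJ: "lam i g = 0" if "i < d" "g \<in> mJ" for i g
  proof -
    have "pp.representation BB g = pp.representation B0 g"
      using that B0 B BB by (intro pp.representation_extend) auto
    then show ?thesis
      using pp.representation_ne_zero[of B0 g "b i"] bB[OF that(1)] by (auto simp: lam_def)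
  qed
  have "g - (\<Sum>i<d. pscale (lam i g) (b i)) \<in> mJ" if g: "g \<in> J" for g
  proof -
    have sub: "pp.subspace mJ" by (rule ideal_subspace[OF mJ])
    have "g \<in> pp.span B" using g spanB by blast
    then show ?thesis
    proof (induction rule: pp.span_induct_alt)
      case base
      have "lam i 0 = 0" for i
      proof -
        interpret module_hom pscale "(*)" "lam i" by (rule lam_hom)
        show ?thesis by (rule zero)
      qed
      then show ?case using pp.subspace_0[OF sub] by simp
    next
      case (step c x y)
      have lin: "lam i (pscale c x + y) = c * lam i x + lam i y" for i
      proof -
        interpret module_hom pscale "(*)" "lam i" by (rule lam_hom)
        show ?thesis by (simp add: add scale)
      qed
      have "x - (\<Sum>i<d. pscale (lam i x) (b i)) \<in> mJ"
      proof (cases "x \<in> B0")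
        case True
        then have "x \<in> mJ" using B0 by blast
        then show ?thesis using lam_mJ by simp
      next
        case False
        then have "x \<in> b ` {0..<card (B - B0)}" using b step(1) by (auto simp: bij_betw_def)
        then obtain j where j: "j < d" "x = b j" by (auto simp: d_def)
        have "(\<Sum>i<d. pscale (lam i x) (b i)) = b j"
          using j lam_b by (subst sum.remove[of _ j]) (auto intro!: sum.neutral)
        then show ?thesis using j pp.subspace_0[OF sub] by simp
      qed
      from pp.subspace_add[OF sub pp.subspace_scale[OF sub this] step(2)]
      have "pscale c (x - (\<Sum>i<d. pscale (lam i x) (b i))) + (y - (\<Sum>i<d. pscale (lam i y) (b i))) \<in> mJ" .
      also have "pscale c (x - (\<Sum>i<d. pscale (lam i x) (b i))) + (y - (\<Sum>i<d. pscale (lam i y) (b i)))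
          = (pscale c x + y) - (\<Sum>i<d. pscale (lam i (pscale c x + y)) (b i))"
        by (simp add: lin pp.scale_left_distrib sum.distrib pp.scale_right_diff_distrib pp.scale_sum_right)
      finally show ?case .
    qed
  qed
  moreover have "b i \<in> J" if "i < d" for i using bB[OF that] B(2) G(2) by blast
  ultimately show ?thesis using that[of d lam b] lam_hom lam_b lam_mJ by blast
qed

end

section \<open>Pushing forward along an algebra map, and the residual point\<close>

lemma span_push:
  assumes f: "comm_ring_hom f"
  shows "pp.span (map_coeffs f ` pp.span S) = pp.span (map_coeffs f ` S)"
proof (rule equalityI)
  interpret m: comm_ring_hom "map_coeffs f" by (rule map_coeffs_hom[OF f])
  have "map_coeffs f u \<in> pp.span (map_coeffs f ` S)" if "u \<in> pp.span S" for u
    using that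
  proof (induction rule: pp.span_induct_alt)
    case base
    have "map_coeffs f 0 \<in> pp.span (map_coeffs f ` S)" by (simp only: m.hom_zero pp.span_zero)
    then show ?case .
  next
    case (step c x y)
    have "map_coeffs f x \<in> pp.span (map_coeffs f ` S)" using step(1) by (intro pp.span_base imageI)
    then show ?case
      unfolding m.hom_add map_coeffs_pscale[OF f] by (intro pp.span_add pp.span_scale step)
  qed
  then show "pp.span (map_coeffs f ` pp.span S) \<subseteq> pp.span (map_coeffs f ` S)"
    by (intro pp.span_minimal pp.subspace_span) blast
  show "pp.span (map_coeffs f ` S) \<subseteq> pp.span (map_coeffs f ` pp.span S)"
    by (intro pp.span_mono image_mono pp.span_superset)
qed

lemma extend_functional_push:
  assumes f: "comm_ring_hom f"
  shows "extend_functional (f \<circ> h) l (map_coeffs f u) = f (extend_functional h l u)"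
proof -
  interpret f: comm_ring_hom f by fact
  have "support2 (map_coeffs f u) \<subseteq> support2 u"
    by (auto simp: support2_def map_coeffs_def coeff_map_poly)
  from extend_functional_superset[OF finite_support2 this]
  have "extend_functional (f \<circ> h) l (map_coeffs f u)
      = (\<Sum>(j, k)\<in>support2 u. f (coeff (coeff u j) k) * f (h (l (monomial2 k j))))"
    by (simp add: map_coeffs_def coeff_map_poly)
  then show ?thesis
    by (simp add: extend_functional_def f.hom_sum f.hom_mult split_beta)
qed

text \<open>Each \<open>r\<close> acts on the invertible module \<open>J'/I\<close> as a unique scalar \<open>\<rho> r\<close>; uniqueness makes \<open>\<rho>\<close> a ring
  homomorphism.\<close>

lemma residual_ex1:
  fixes I J' :: "'a::comm_ring_1 poly poly set"
  assumes h: "comm_ring_hom h" and I: "rg.subspace I" and J': "rg.subspace J'" and IJ: "I \<subseteq> J'"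
    and lf: "pp.lf J' I 1"
  shows "\<exists>!\<rho>. \<rho> \<in> plane_points h \<and> (\<forall>r. \<forall>g\<in>J'. map_coeffs h r * g - const2 (\<rho> r) * g \<in> I)"
proof -
  interpret m: comm_ring_hom "map_coeffs h" by (rule map_coeffs_hom[OF h])
  note I' = ideal_subspace[OF I] and J'' = ideal_subspace[OF J']
  have uniq: "a = a'" if "\<forall>g\<in>J'. u * g - pscale a g \<in> I" "\<forall>g\<in>J'. u * g - pscale a' g \<in> I" for u a a'
  proof -
    have "pscale (a' - a) g \<in> I" if g: "g \<in> J'" for g
      using pp.subspace_diff[OF I' \<open>\<forall>g\<in>J'. u * g - pscale a g \<in> I\<close>[rule_format, OF g]
          \<open>\<forall>g\<in>J'. u * g - pscale a' g \<in> I\<close>[rule_format, OF g]]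
      by (simp add: pp.scale_left_diff_distrib)
    from pp.lf_1_faithful[OF lf this] show ?thesis by simp
  qed
  have "\<exists>a. \<forall>g\<in>J'. map_coeffs h r * g - pscale a g \<in> I" for r
  proof (rule pp.invertible_endomorphism_scalar[OF J'' I' IJ lf, where \<phi>="\<lambda>g. map_coeffs h r * g"])
    show "module_hom pscale pscale ((*) (map_coeffs h r))"
      by unfold_locales (simp_all add: distrib_left pscale_mult)
  qed (use rg.subspace_scale[OF I] rg.subspace_scale[OF J'] in auto)
  then obtain \<rho> where \<rho>: "\<And>r. \<forall>g\<in>J'. map_coeffs h r * g - pscale (\<rho> r) g \<in> I" by metis
  have "\<rho> \<in> plane_points h"
  proof -
    have add: "\<rho> (r + s) = \<rho> r + \<rho> s" for r s
    proof (rule uniq[OF \<rho>])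
      have "map_coeffs h (r + s) * g - pscale (\<rho> r + \<rho> s) g
          = (map_coeffs h r * g - pscale (\<rho> r) g) + (map_coeffs h s * g - pscale (\<rho> s) g)" for g
        by (simp add: m.hom_add pp.scale_left_distrib distrib_right)
      then show "\<forall>g\<in>J'. map_coeffs h (r + s) * g - pscale (\<rho> r + \<rho> s) g \<in> I"
        using \<rho> pp.subspace_add[OF I'] by simp
    qed
    have mult: "\<rho> (r * s) = \<rho> r * \<rho> s" for r s
    proof (rule uniq[OF \<rho>])
      have "map_coeffs h (r * s) * g - pscale (\<rho> r * \<rho> s) g
          = map_coeffs h s * (map_coeffs h r * g - pscale (\<rho> r) g)
            + pscale (\<rho> r) (map_coeffs h s * g - pscale (\<rho> s) g)" for g
        by (simp add: m.hom_mult pp.scale_right_diff_distrib pscale_mult algebra_simps)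
      then show "\<forall>g\<in>J'. map_coeffs h (r * s) * g - pscale (\<rho> r * \<rho> s) g \<in> I"
        using \<rho> pp.subspace_add[OF I'] rg.subspace_scale[OF I] pp.subspace_scale[OF I'] by simp
    qed
    have const: "\<rho> (const2 c) = h c" for c
    proof (rule uniq[OF \<rho>])
      interpret h: comm_ring_hom h by (rule h)
      have "map_coeffs h (const2 c) = const2 (h c)"
        by (intro poly_eqI) (auto simp: map_coeffs_def coeff_map_poly const2_def coeff_pCons split: nat.split)
      then show "\<forall>g\<in>J'. map_coeffs h (const2 c) * g - pscale (h c) g \<in> I"
        using rg.subspace_0[OF I] by (simp add: pscale_def)
    qed
    interpret h: comm_ring_hom h by (rule h)
    have "\<rho> 1 = 1" using const[of 1] by (simp add: const2_def flip: one_pCons)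
    then show ?thesis by (simp add: plane_points_def Ring.ring_hom_def add mult const)
  qed
  moreover have "\<sigma> = \<rho>" if "\<forall>r. \<forall>g\<in>J'. map_coeffs h r * g - const2 (\<sigma> r) * g \<in> I" for \<sigma>
    using uniq[OF _ \<rho>] that by (auto simp: fun_eq_iff pscale_def)
  ultimately show ?thesis using \<rho> by (intro ex1I[of _ \<rho>]) (auto simp: pscale_def)
qed

section \<open>The fibre of the nested Hilbert scheme\<close>

locale fibre_basis = colength_ideal J p n e cf for J p n e cf +
  fixes d :: nat and b :: "nat \<Rightarrow> complex poly poly" and lam :: "nat \<Rightarrow> complex poly poly \<Rightarrow> complex"
  assumes lam_hom: "i < d \<Longrightarrow> module_hom pscale (*) (lam i)"
    and b_J: "i < d \<Longrightarrow> b i \<in> J"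
    and lam_b: "i < d \<Longrightarrow> j < d \<Longrightarrow> lam i (b j) = (if i = j then 1 else 0)"
    and lam_mJ: "i < d \<Longrightarrow> g \<in> mJ \<Longrightarrow> lam i g = 0"
    and lam_residual: "g \<in> J \<Longrightarrow> g - (\<Sum>i<d. pscale (lam i g) (b i)) \<in> mJ"
begin

definition lamv :: "complex poly poly \<Rightarrow> nat \<Rightarrow> complex" where
  "lamv g = (\<lambda>i. if i < d then lam i g else 0)"

definition comb :: "(nat \<Rightarrow> complex) \<Rightarrow> complex poly poly" where
  "comb v = (\<Sum>i<d. pscale (v i) (b i))"

definition fibre_vec :: "(nat \<Rightarrow> complex) \<Rightarrow> (complex poly poly \<Rightarrow>\<^sub>0 complex) set" where
  "fibre_vec v = restrict_to_fibre J p (comb v)"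

lemma lamv_in: "lamv g \<in> vecs d"
  by (simp add: lamv_def vecs_def)

lemma lamv_hom: "module_hom pscale vscale lamv"
proof
  fix x y :: "complex poly poly" and a
  show "lamv (x + y) = lamv x + lamv y"
  proof
    fix i show "lamv (x + y) i = (lamv x + lamv y) i"
      using module_hom.add[OF lam_hom[of i]] by (simp add: lamv_def)
  qed
  show "lamv (pscale a x) = vscale a (lamv x)"
  proof
    fix i show "lamv (pscale a x) i = vscale a (lamv x) i"
      using module_hom.scale[OF lam_hom[of i]] by (simp add: lamv_def)
  qed
qed

lemma lamv_b: "i < d \<Longrightarrow> lamv (b i) = unitv i"
  by (auto simp: lamv_def lam_b unitv_def)

lemma lamv_comb: "v \<in> vecs d \<Longrightarrow> lamv (comb v) = v"
proof -
  assume v: "v \<in> vecs d"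
  have "lamv (comb v) = (\<Sum>i<d. vscale (v i) (lamv (b i)))"
    unfolding comb_def module_hom.sum[OF lamv_hom] module_hom.scale[OF lamv_hom] ..
  also have "\<dots> = (\<Sum>i<d. vscale (v i) (unitv i))" by (intro sum.cong refl) (simp only: lamv_b lessThan_iff)
  finally show ?thesis using vec_expand[OF v] by simp
qed

lemma comb_J: "comb v \<in> J"
  unfolding comb_def by (intro pp.subspace_sum pp.subspace_scale ideal_subspace[OF J] b_J) auto

lemma comb_add: "comb (v + w) = comb v + comb w"
  and comb_scale: "comb (vscale a v) = pscale a (comb v)"
  and comb_diff: "comb (v - w) = comb v - comb w"
  by (simp_all add: comb_def pp.scale_left_distrib sum.distrib pp.scale_sum_right
      pp.scale_left_diff_distrib sum_subtractf)

lemma comb_lamv: "g \<in> J \<Longrightarrow> g - comb (lamv g) \<in> mJ"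
  using lam_residual by (simp add: comb_def lamv_def)

lemma lamv_mJ: "g \<in> mJ \<Longrightarrow> lamv g = 0"
  by (auto simp: lamv_def lam_mJ)

lemma restrict_vec: "g \<in> J \<Longrightarrow> restrict_to_fibre J p g = fibre_vec (lamv g)"
proof -
  assume g: "g \<in> J"
  interpret P: presentation pscale "ideal_fibre J p" "restrict_to_fibre J p" J mJ
    by (rule presentation_fibre)
  show ?thesis unfolding fibre_vec_def using P.eq[OF g comb_J] comb_lamv[OF g] by simp
qed

lemma free_presentation_fibre: "free_presentation (ideal_fibre J p) fibre_vec d"
proof
  interpret P: presentation pscale "ideal_fibre J p" "restrict_to_fibre J p" J mJ
    by (rule presentation_fibre)
  show "carrier (ideal_fibre J p) = fibre_vec ` vecs d"
    unfolding P.carrier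
  proof (intro equalityI subsetI)
    fix u assume "u \<in> restrict_to_fibre J p ` J"
    then obtain g where "g \<in> J" "u = restrict_to_fibre J p g" by blast
    then show "u \<in> fibre_vec ` vecs d" using restrict_vec lamv_in by auto
  next
    fix u assume "u \<in> fibre_vec ` vecs d"
    then show "u \<in> restrict_to_fibre J p ` J" using comb_J by (auto simp: fibre_vec_def)
  qed
  have "comb 0 = 0" by (simp add: comb_def)
  then show "\<zero>\<^bsub>ideal_fibre J p\<^esub> = fibre_vec 0" by (simp only: P.zero fibre_vec_def)
  fix x y :: "nat \<Rightarrow> complex" and a assume x: "x \<in> vecs d"
  show "a \<odot>\<^bsub>ideal_fibre J p\<^esub> fibre_vec x = fibre_vec (vscale a x)"
    unfolding fibre_vec_def comb_scale by (rule P.smult[OF comb_J])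
  assume y: "y \<in> vecs d"
  show "fibre_vec x \<oplus>\<^bsub>ideal_fibre J p\<^esub> fibre_vec y = fibre_vec (x + y)"
    unfolding fibre_vec_def comb_add by (rule P.add[OF comb_J comb_J])
  have "comb (x - y) \<in> mJ \<longleftrightarrow> x - y = 0"
  proof
    assume "comb (x - y) \<in> mJ"
    from lamv_mJ[OF this] show "x - y = 0" using lamv_comb[OF vec.subspace_diff[OF subspace_vecs x y]] by simp
  next
    assume "x - y = 0"
    then show "comb (x - y) \<in> mJ" using \<open>comb 0 = 0\<close> rg.subspace_0[OF mJ] by (simp only:)
  qed
  then show "fibre_vec x = fibre_vec y \<longleftrightarrow> x - y \<in> {0}"
    unfolding fibre_vec_def P.eq[OF comb_J comb_J] comb_diff by simp
qed (auto simp: subspace_vecs vec.subspace_0)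

text \<open>The map \<open>J\<^sub>A \<rightarrow> J(p) \<otimes> A = A\<^sup>d\<close>, extended to \<open>A[x,y]\<close>.\<close>

definition Lam :: "(complex \<Rightarrow> 'a::comm_ring_1) \<Rightarrow> 'a poly poly \<Rightarrow> nat \<Rightarrow> 'a" where
  "Lam h u = (\<lambda>i. if i < d then extend_functional h (lam i) u else 0)"

lemma Lam_in: "Lam h u \<in> vecs d"
  by (simp add: Lam_def vecs_def)

lemma Lam_hom: "module_hom pscale vscale (Lam h)"
proof
  fix x y :: "'a poly poly" and a
  show "Lam h (x + y) = Lam h x + Lam h y"
    by (rule ext) (simp add: Lam_def module_hom.add[OF extend_functional_hom])
  show "Lam h (pscale a x) = vscale a (Lam h x)"
    by (rule ext) (simp add: Lam_def module_hom.scale[OF extend_functional_hom])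
qed

lemma Lam_push: "comm_ring_hom f \<Longrightarrow> Lam (f \<circ> h) (map_coeffs f u) = f \<circ> Lam h u"
proof -
  assume f: "comm_ring_hom f"
  interpret f: comm_ring_hom f by fact
  show ?thesis by (auto simp: Lam_def fun_eq_iff extend_functional_push[OF f])
qed

end

locale fibre_over = fibre_basis J p n e cf d b lam + h: comm_ring_hom h
  for J p n e cf d b lam and h :: "complex \<Rightarrow> 'a::comm_ring_1"
begin

abbreviation JA where "JA \<equiv> extend_ideal h J"
abbreviation mJA where "mJA \<equiv> pp.span (map_coeffs h ` mJ)"

lemma h: "comm_ring_hom h" ..

lemma map_coeffs_h: "comm_ring_hom (map_coeffs h)" by (rule map_coeffs_hom[OF h])

lemma JA_span: "JA = pp.span (map_coeffs h ` J)" by (rule extend_ideal_span[OF h J])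

lemma JA: "rg.subspace JA" unfolding JA_span by (rule span_ideal[OF h J])

lemma JA': "pp.subspace JA" by (rule ideal_subspace[OF JA])

lemma mJA_JA: "mJA \<subseteq> JA"
  unfolding JA_span by (intro pp.span_mono image_mono mJ_subset)

lemma map_JA: "g \<in> J \<Longrightarrow> map_coeffs h g \<in> JA"
  unfolding JA_span by (intro pp.span_base imageI)

lemma Lam_map: "Lam h (map_coeffs h g) = h \<circ> lamv g"
  by (auto simp: Lam_def lamv_def fun_eq_iff extend_functional_map_coeffs[OF h lam_hom])

lemma Lam_mJA: "u \<in> mJA \<Longrightarrow> Lam h u = 0"
proof (induction rule: pp.span_induct_alt)
  case base
  show ?case by (rule module_hom.zero[OF Lam_hom])
next
  case (step c x y)
  then have "Lam h x = 0" by (auto simp: Lam_map lamv_mJ fun_eq_iff)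
  then show ?case
    unfolding module_hom.add[OF Lam_hom] module_hom.scale[OF Lam_hom] step(2) vec.scale_zero_right by simp
qed

lemma JA_induct [consumes 1, case_names zero step]:
  assumes "u \<in> JA" and "P 0"
    and "\<And>a g u. g \<in> J \<Longrightarrow> u \<in> JA \<Longrightarrow> P u \<Longrightarrow> P (pscale a (map_coeffs h g) + u)"
  shows "P u"
proof -
  have "u \<in> JA \<and> P u" using assms(1) unfolding JA_span
  proof (induction rule: pp.span_induct_alt)
    case base
    show ?case using assms(2) pp.span_zero by blast
  next
    case (step c x y)
    then obtain g where g: "g \<in> J" "x = map_coeffs h g" by blast
    have "pscale c x + y \<in> pp.span (map_coeffs h ` J)"
      by (rule pp.span_add[OF pp.span_scale[OF pp.span_base[OF step(1)]] conjunct1[OF step(2)]])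
    then show ?case using assms(3)[OF g(1)] step(2) g(2) unfolding JA_span by blast
  qed
  then show ?thesis ..
qed

text \<open>Right exactness of base change: on \<open>J\<^sub>A\<close> the kernel of \<open>Lam\<close> is \<open>(\<mm>J)\<^sub>A\<close>.\<close>

lemma Lam_residual: "u \<in> JA \<Longrightarrow> u - (\<Sum>i<d. pscale (Lam h u i) (map_coeffs h (b i))) \<in> mJA"
proof (induction rule: JA_induct)
  case zero
  show ?case unfolding module_hom.zero[OF Lam_hom] using pp.span_zero by simp
next
  case (step a g u)
  interpret m: comm_ring_hom "map_coeffs h" by (rule map_coeffs_h)
  have "map_coeffs h (g - comb (lamv g)) \<in> mJA"
    using comb_lamv[OF step(1)] by (intro pp.span_base imageI)
  moreover have "map_coeffs h (g - comb (lamv g))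
      = map_coeffs h g - (\<Sum>i<d. pscale (h (lamv g i)) (map_coeffs h (b i)))"
    by (simp add: m.hom_minus comb_def m.hom_sum map_coeffs_pscale[OF h])
  ultimately have "map_coeffs h g - (\<Sum>i<d. pscale (h (lamv g i)) (map_coeffs h (b i))) \<in> mJA" by simp
  from pp.span_add[OF pp.span_scale[OF this] step(3)]
  have "pscale a (map_coeffs h g - (\<Sum>i<d. pscale (h (lamv g i)) (map_coeffs h (b i))))
      + (u - (\<Sum>i<d. pscale (Lam h u i) (map_coeffs h (b i)))) \<in> mJA" .
  also have "pscale a (map_coeffs h g - (\<Sum>i<d. pscale (h (lamv g i)) (map_coeffs h (b i))))
      + (u - (\<Sum>i<d. pscale (Lam h u i) (map_coeffs h (b i))))
      = (pscale a (map_coeffs h g) + u)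
        - (\<Sum>i<d. pscale (Lam h (pscale a (map_coeffs h g) + u) i) (map_coeffs h (b i)))"
    unfolding module_hom.add[OF Lam_hom] module_hom.scale[OF Lam_hom] Lam_map
    by (simp add: pp.scale_right_diff_distrib pp.scale_left_distrib sum.distrib pp.scale_sum_right)
  finally show ?case .
qed

lemma Lam_image: "Lam h ` JA = vecs d"
proof (intro equalityI subsetI)
  fix v :: "nat \<Rightarrow> 'a" assume v: "v \<in> vecs d"
  define u where "u = (\<Sum>i<d. pscale (v i) (map_coeffs h (b i)))"
  have "u \<in> JA" unfolding u_def using b_J map_JA by (intro pp.subspace_sum[OF JA'] pp.subspace_scale[OF JA']) auto
  have "Lam h u = (\<Sum>i<d. vscale (v i) (h \<circ> lamv (b i)))"
    unfolding u_def module_hom.sum[OF Lam_hom] module_hom.scale[OF Lam_hom] Lam_map ..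
  also have "\<dots> = (\<Sum>i<d. vscale (v i) (unitv i))"
    by (intro sum.cong refl) (auto simp: lamv_b, auto simp: unitv_def fun_eq_iff)
  also have "\<dots> = v" by (rule vec_expand[OF v])
  finally show "v \<in> Lam h ` JA" using \<open>u \<in> JA\<close> by blast
qed (use Lam_in in auto)

definition preimage :: "(nat \<Rightarrow> 'a) set \<Rightarrow> 'a poly poly set" where
  "preimage K = {u \<in> JA. Lam h u \<in> K}"

lemma Lam_preimage: "K \<subseteq> vecs d \<Longrightarrow> Lam h ` preimage K = K"
proof (intro equalityI subsetI)
  fix v assume "K \<subseteq> vecs d" "v \<in> K"
  then have "v \<in> Lam h ` JA" unfolding Lam_image by blast
  then show "v \<in> Lam h ` preimage K" using \<open>v \<in> K\<close> by (auto simp: preimage_def)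
qed (auto simp: preimage_def)

lemma mJA_preimage: "vec.subspace K \<Longrightarrow> mJA \<subseteq> preimage K"
  unfolding preimage_def using mJA_JA Lam_mJA vec.subspace_0 by fastforce

lemma preimage_Lam:
  assumes I: "pp.subspace I" "mJA \<subseteq> I" "I \<subseteq> JA"
  shows "preimage (Lam h ` I) = I"
proof (intro equalityI subsetI)
  fix u assume "u \<in> preimage (Lam h ` I)"
  then obtain w where w: "u \<in> JA" "w \<in> I" "Lam h u = Lam h w" by (auto simp: preimage_def)
  have "Lam h (u - w) = 0" using w by (simp add: module_hom.diff[OF Lam_hom])
  then have "u - w \<in> mJA"
    using Lam_residual[of "u - w"] pp.subspace_diff[OF JA' w(1), of w] w(2) I(3) by auto
  then show "u \<in> I" using pp.subspace_add[OF I(1) _ w(2), of "u - w"] I(2) by auto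
qed (use I in \<open>auto simp: preimage_def\<close>)

lemma eval_mJA: "u \<in> JA \<Longrightarrow> map_coeffs h r * u - pscale (h (eval_at p r)) u \<in> mJA"
proof (induction rule: JA_induct)
  case zero
  show ?case using pp.span_zero by simp
next
  case (step a g u)
  interpret m: comm_ring_hom "map_coeffs h" by (rule map_coeffs_h)
  have "map_coeffs h (r * g - pscale (eval_at p r) g) \<in> mJA"
    using mJ_eval[OF step(1)] by (intro pp.span_base imageI)
  then have "map_coeffs h r * map_coeffs h g - pscale (h (eval_at p r)) (map_coeffs h g) \<in> mJA"
    by (simp add: m.hom_minus m.hom_mult map_coeffs_pscale[OF h])
  from pp.span_add[OF pp.span_scale[OF this, of a] step(3)]
  show ?case
    by (simp add: distrib_left pscale_mult pp.scale_right_distrib pp.scale_right_diff_distrib algebra_simps)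
qed

text \<open>Multiplication by a monomial acts on \<open>J\<^sub>A\<close> modulo \<open>(\<mm>J)\<^sub>A\<close> as a scalar, so every \<open>A\<close>-submodule between
  the two is an ideal.\<close>

lemma preimage_ideal:
  assumes K: "vec.subspace K"
  shows "rg.subspace (preimage K)"
proof -
  have sub: "pp.subspace (preimage K)"
  proof (rule pp.subspaceI)
    show "0 \<in> preimage K"
      using pp.subspace_0[OF JA'] vec.subspace_0[OF K] by (simp add: preimage_def module_hom.zero[OF Lam_hom])
    show "u + v \<in> preimage K" if "u \<in> preimage K" "v \<in> preimage K" for u v
      using that pp.subspace_add[OF JA'] vec.subspace_add[OF K]
      by (simp add: preimage_def module_hom.add[OF Lam_hom])
    show "pscale c u \<in> preimage K" if "u \<in> preimage K" for u c
      using that pp.subspace_scale[OF JA'] vec.subspace_scale[OF K]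
      by (simp add: preimage_def module_hom.scale[OF Lam_hom])
  qed
  show ?thesis
  proof (rule subspace_ideal[OF sub])
    fix k j u assume u: "u \<in> preimage K"
    let ?r = "monomial2 k j :: complex poly poly"
    have "map_coeffs h ?r * u - pscale (h (eval_at p ?r)) u \<in> preimage K"
      using eval_mJA[of u ?r] mJA_preimage[OF K] u by (auto simp: preimage_def)
    from pp.subspace_add[OF sub this pp.subspace_scale[OF sub u, of "h (eval_at p ?r)"]]
    show "monomial2 k j * u \<in> preimage K" by (simp add: map_coeffs_monomial2[OF h])
  qed
qed

lemma lf_preimage_iff: "pp.lf JA (preimage K) 1 \<longleftrightarrow> vec.lf (vecs d) K 1"
  by (rule module_hom.lf_preimage[OF Lam_hom pp.ring_module_axioms vec.ring_module_axioms])
    (use Lam_image JA' in \<open>auto simp: preimage_def\<close>)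

text \<open>The lifted basis of \<open>R/J\<close> remains a basis after base change; independence is seen by the base
  changes of the coordinate functionals, which vanish on \<open>J\<^sub>A\<close>.\<close>

lemma JA_hilb: "JA \<in> hilb n"
proof -
  interpret m: comm_ring_hom "map_coeffs h" by (rule map_coeffs_h)
  let ?e = "\<lambda>i. map_coeffs h (e i)"
  have gen: "\<exists>c. u - (\<Sum>i<n. pscale (c i) (?e i)) \<in> JA" for u
  proof (induction u rule: poly_induct_monomials)
    case zero
    show ?case using pp.subspace_0[OF JA'] by (intro exI[of _ "\<lambda>_. 0"]) simp
  next
    case (step a k j u)
    then obtain c where c: "u - (\<Sum>i<n. pscale (c i) (?e i)) \<in> JA" by blast
    let ?r = "monomial2 k j :: complex poly poly"
    have "map_coeffs h (?r - (\<Sum>i<n. pscale (cf i ?r) (e i))) \<in> JA" by (rule map_JA[OF cf_gen])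
    then have "monomial2 k j - (\<Sum>i<n. pscale (h (cf i ?r)) (?e i)) \<in> JA"
      by (simp add: m.hom_minus m.hom_sum map_coeffs_pscale[OF h] map_coeffs_monomial2[OF h])
    from pp.subspace_add[OF JA' pp.subspace_scale[OF JA' this, of a] c]
    have "(pscale a (monomial2 k j) + u) - (\<Sum>i<n. pscale (a * h (cf i ?r) + c i) (?e i)) \<in> JA"
      by (simp add: pp.scale_right_diff_distrib pp.scale_left_distrib sum.distrib pp.scale_sum_right algebra_simps)
    then show ?case by (intro exI)
  qed
  have ind: "c i = 0" if c: "(\<Sum>i<n. pscale (c i) (?e i)) \<in> JA" and i: "i < n" for c i
  proof -
    interpret E: module_hom pscale "(*)" "extend_functional h (cf i)" by (rule extend_functional_hom)
    have ext: "extend_functional h (cf i) (map_coeffs h g) = h (cf i g)" for g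
      by (rule extend_functional_map_coeffs[OF h cf_hom[OF i]])
    have "extend_functional h (cf i) u = 0" if "u \<in> JA" for u
      using that
    proof (induction rule: JA_induct)
      case zero
      show ?case by (rule E.zero)
    next
      case (step a g u)
      then show ?case using cf_J[OF i step(1)] by (simp add: E.add E.scale ext)
    qed
    from this[OF c] have "(\<Sum>j<n. c j * h (cf i (e j))) = 0" by (simp add: E.sum E.scale ext)
    moreover have "(\<Sum>j<n. c j * h (cf i (e j))) = c i"
      using i by (subst sum.remove[of _ i]) (auto simp: cf_e intro!: sum.neutral)
    ultimately show ?thesis by simp
  qed
  have "pp.free_at UNIV JA n 1"
    unfolding pp.free_at_def
  proof (intro bexI[of _ ?e] conjI ballI allI impI)
    fix u show "\<exists>k c. pscale (1 ^ k) u - (\<Sum>i<n. pscale (c i) (?e i)) \<in> JA"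
      using gen[of u] by simp
  next
    fix c assume "(\<Sum>i<n. pscale (c i) (?e i)) \<in> JA"
    then show "\<exists>k. \<forall>i<n. 1 ^ k * c i = 0" using ind by simp
  qed simp
  then show ?thesis unfolding hilb_iff pp.lf_def using JA rg.span_base[of 1] by blast
qed

lemma point: "h \<circ> eval_at p \<in> plane_points h"
  by (auto simp: plane_points_def Ring.ring_hom_def e.hom_add e.hom_mult h.hom_add h.hom_mult)

text \<open>For a flag in the fibre, the residual point being \<open>p\<close> forces
  \<open>(\<mm>J)\<^sub>A \<subseteq> I\<close>, so \<open>I\<close> is the preimage of its image in \<open>A\<^sup>d\<close>. Conversely, on a preimage the polynomial ring
  acts through evaluation at \<open>p\<close>, and this is its residual point by uniqueness.\<close>

lemma fibre_eq: "fibre h n J p = (\<lambda>K. (preimage K, JA)) ` quotients_of d"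
proof (intro equalityI subsetI)
  fix Q assume "Q \<in> fibre h n J p"
  then obtain I where Q: "Q = (I, JA)" "I \<in> hilb (Suc n)" "I \<subseteq> JA" "residual h I JA = h \<circ> eval_at p"
    by (cases Q) (auto simp: fibre_def nested_hilb_def phi_def)
  have I: "rg.subspace I" "pp.lf UNIV I (Suc n)" using Q(2) by (simp_all add: hilb_iff)
  have I': "pp.subspace I" by (rule ideal_subspace[OF I(1)])
  have lf: "pp.lf JA I 1"
    using pp.lf_kernel[OF pp.subspace_UNIV JA' I' Q(3) _ _ I(2)] JA_hilb by (simp add: hilb_iff)
  have act: "map_coeffs h r * g - const2 (h (eval_at p r)) * g \<in> I" if "g \<in> JA" for r g
    using theI'[OF residual_ex1[OF h I(1) JA Q(3) lf], folded residual_def] Q(4) that by simp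
  interpret m: comm_ring_hom "map_coeffs h" by (rule map_coeffs_h)
  have "map_coeffs h g \<in> I" if "g \<in> mJ" for g
    using that
  proof (induction rule: mJ_induct)
    case (prod r g)
    then show ?case using act[OF map_JA[OF prod(2)], of r] by (simp add: m.hom_mult const2_def)
  next
    case (sum a b)
    then show ?case using rg.subspace_add[OF I(1)] by (simp add: m.hom_add)
  qed
  then have "mJA \<subseteq> I" by (intro pp.span_minimal I') auto
  then have pre: "preimage (Lam h ` I) = I" using preimage_Lam[OF I' _ Q(3)] by blast
  have "Lam h ` I \<in> quotients_of d"
    unfolding quotients_of_def
    using module_hom.subspace_image[OF Lam_hom I'] Lam_in lf lf_preimage_iff[of "Lam h ` I"] pre by auto
  then show "Q \<in> (\<lambda>K. (preimage K, JA)) ` quotients_of d" using Q(1) pre by force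
next
  fix Q assume "Q \<in> (\<lambda>K. (preimage K, JA)) ` quotients_of d"
  then obtain K where K: "vec.subspace K" "K \<subseteq> vecs d" "vec.lf (vecs d) K 1" and Q: "Q = (preimage K, JA)"
    by (auto simp: quotients_of_def)
  have I: "rg.subspace (preimage K)" by (rule preimage_ideal[OF K(1)])
  have IJ: "preimage K \<subseteq> JA" by (auto simp: preimage_def)
  have lf: "pp.lf JA (preimage K) 1" using K(3) lf_preimage_iff by blast
  have "pp.lf UNIV (preimage K) (Suc n)"
    using pp.lf_extension[OF JA' ideal_subspace[OF I] IJ _ _ lf] JA_hilb by (simp add: hilb_iff)
  then have "preimage K \<in> hilb (Suc n)" using I by (simp add: hilb_iff)
  moreover have "residual h (preimage K) JA = h \<circ> eval_at p"
    unfolding residual_def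
  proof (rule the1_equality[OF residual_ex1[OF h I JA IJ lf]], intro conjI allI ballI)
    fix r g assume "g \<in> JA"
    then show "map_coeffs h r * g - const2 ((h \<circ> eval_at p) r) * g \<in> preimage K"
      using eval_mJA[of g r] mJA_preimage[OF K(1)] by (auto simp: pscale_def)
  qed (rule point)
  ultimately show "Q \<in> fibre h n J p"
    using JA_hilb IJ Q by (simp add: fibre_def nested_hilb_def phi_def)
qed

lemma bij_betw_preimage: "bij_betw (\<lambda>K. (preimage K, JA)) (quotients_of d) (fibre h n J p)"
  unfolding bij_betw_def fibre_eq
proof (intro conjI refl inj_onI)
  fix K K' assume K: "K \<in> quotients_of d" "K' \<in> quotients_of d" "(preimage K, JA) = (preimage K', JA)"
  then have "Lam h ` preimage K = Lam h ` preimage K'" by simp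
  then show "K = K'" using K(1,2) Lam_preimage by (simp add: quotients_of_def)
qed

sublocale V: free_base_change "ideal_fibre J p" fibre_vec d h
  by (intro free_base_change.intro free_presentation_fibre h)

text \<open>On \<open>J \<otimes> A\<close>, the map to \<open>J(p) \<otimes> A\<close> is the map \<open>?\<mu>\<close> to \<open>A[x,y]\<close> followed by \<open>Lam\<close>, and the image of \<open>?\<mu>\<close>
  is \<open>J\<^sub>A\<close>.\<close>

lemma flag_to_quotient_vec:
  assumes I: "I \<subseteq> JA"
  shows "flag_to_quotient h J p (I, J') = tensor_vec h (ideal_fibre J p) V.basis d ` Lam h ` I"
proof -
  interpret N: base_change_presentation pscale "as_module const2 J" "\<lambda>g. g" J "{0}" h
    by (intro base_change_presentation.intro h presentation_as_module[OF pp.ring_module_axioms _ ideal_subspace[OF J]])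
      (simp add: pscale_def)
  interpret B: presentation fscale "base_change h (as_module const2 J)" N.tensor_class "supported J"
      "tensor_relations h (as_module const2 J)"
    using N.presentation_base_change by (simp add: as_module_def)
  have carr: "carrier (as_module const2 J) = J" by (simp add: as_module_def)
  have id: "comm_ring_hom (id :: 'a \<Rightarrow> 'a)" using comm_ring_hom_ident by (simp add: id_def)
  interpret m: comm_ring_hom "map_coeffs h" by (rule map_coeffs_h)
  let ?\<mu> = "lift id pscale (map_coeffs h)"
  have mu_ext: "semilinear_extension pscale (id :: 'a \<Rightarrow> 'a)"
    by (intro semilinear_extension.intro pp.ring_module_axioms id)
  have PU: "presentation pscale (as_module (const2 :: 'a \<Rightarrow> _) UNIV) (\<lambda>u. u) UNIV {0}"
    by (rule presentation_as_module[OF pp.ring_module_axioms]) (simp_all add: pscale_def)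
  have mc: "map_coeffs h (const2 a * g) = pscale (h a) (map_coeffs h g)" for a g
    by (simp add: map_coeffs_pscale[OF h] flip: pscale_def)
  have mu: "tensor_lift id (as_module const2 UNIV) (map_coeffs h) (N.tensor_class c) = ?\<mu> c"
    if "c \<in> supported J" for c
    by (rule N.tensor_lift_class[OF id PU])
      (use that in \<open>auto simp: carr as_module_def m.hom_add mc\<close>)
  have pi: "tensor_lift id (base_change h (ideal_fibre J p))
         (\<lambda>g. tensor_one h (ideal_fibre J p) (restrict_to_fibre J p g)) (N.tensor_class c)
      = tensor_vec h (ideal_fibre J p) V.basis d (Lam h (?\<mu> c))" if c: "c \<in> supported J" for c
  proof -
    have "tensor_lift id (base_change h (ideal_fibre J p))
         (\<lambda>g. tensor_one h (ideal_fibre J p) (restrict_to_fibre J p g)) (N.tensor_class c)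
        = tensor_vec h (ideal_fibre J p) V.basis d (lift id vscale (\<lambda>g. Lam h (map_coeffs h g)) c)"
    proof (rule N.tensor_lift_class[OF id V.presentation_tensor_vec])
      show "tensor_one h (ideal_fibre J p) (restrict_to_fibre J p g)
          = tensor_vec h (ideal_fibre J p) V.basis d (Lam h (map_coeffs h g))"
        if "g \<in> carrier (as_module const2 J)" for g
        using that V.tensor_one_vec[OF lamv_in, of g] restrict_vec[of g] by (simp add: carr Lam_map)
      show "Lam h (map_coeffs h (g \<oplus>\<^bsub>as_module const2 J\<^esub> g')) = Lam h (map_coeffs h g) + Lam h (map_coeffs h g')" for g g'
        by (simp add: as_module_def m.hom_add module_hom.add[OF Lam_hom])
      show "Lam h (map_coeffs h (a \<odot>\<^bsub>as_module const2 J\<^esub> g)) = vscale (id (h a)) (Lam h (map_coeffs h g))" for a g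
        by (simp add: as_module_def mc module_hom.scale[OF Lam_hom])
      show "c \<in> supported (carrier (as_module const2 J))" using c by (simp add: carr)
    qed (rule Lam_in)
    also have "lift id vscale (\<lambda>g. Lam h (map_coeffs h g)) c = Lam h (?\<mu> c)"
      unfolding lift_def module_hom.sum[OF Lam_hom] module_hom.scale[OF Lam_hom] ..
    finally show ?thesis .
  qed
  have surj: "\<exists>c\<in>supported J. ?\<mu> c = u" if "u \<in> JA" for u
    using that
  proof (induction rule: JA_induct)
    case zero
    show ?case
      by (rule bexI[of _ 0]) (simp_all add: lift_def fm.subspace_0[OF subspace_supported])
  next
    case (step a g u)
    then obtain c where c: "c \<in> supported J" "?\<mu> c = u" by blast
    have "?\<mu> (Poly_Mapping.single g a + c) = pscale a (map_coeffs h g) + u"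
      using c by (simp add: semilinear_extension.lift_add[OF mu_ext] semilinear_extension.lift_single[OF mu_ext])
    then show ?case
      using fm.subspace_add[OF subspace_supported single_supported[OF step(1)] c(1)] by blast
  qed
  have "{w \<in> carrier (base_change h (as_module const2 J)).
          tensor_lift id (as_module const2 UNIV) (map_coeffs h) w \<in> I}
      = N.tensor_class ` {c \<in> supported J. ?\<mu> c \<in> I}"
    unfolding B.carrier using mu by auto
  then have "flag_to_quotient h J p (I, J')
      = (\<lambda>c. tensor_vec h (ideal_fibre J p) V.basis d (Lam h (?\<mu> c))) ` {c \<in> supported J. ?\<mu> c \<in> I}"
    unfolding flag_to_quotient_def fst_conv
    by (simp only: image_image) (intro image_cong refl pi, simp)
  also have "\<dots> = tensor_vec h (ideal_fibre J p) V.basis d ` Lam h ` ?\<mu> ` {c \<in> supported J. ?\<mu> c \<in> I}"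
    by (simp add: image_image)
  also have "?\<mu> ` {c \<in> supported J. ?\<mu> c \<in> I} = I" using surj I by blast
  finally show ?thesis .
qed

lemma flag_to_quotient_preimage:
  assumes "K \<in> quotients_of d"
  shows "flag_to_quotient h J p (preimage K, J') = tensor_vec h (ideal_fibre J p) V.basis d ` K"
  using flag_to_quotient_vec[of "preimage K"] Lam_preimage[of K] assms
  by (simp add: preimage_def quotients_of_def)

lemma flag_to_line_preimage:
  assumes "K \<in> quotients_of d"
  shows "flag_to_line h J p (preimage K, J')
    = tensor_vec h (dual_module (ideal_fibre J p)) (\<lambda>i. V.functional (unitv i)) d ` perp d K"
  unfolding flag_to_line_def flag_to_quotient_preimage[OF assms]
  by (rule annihilator_vec[OF V.free_base_change_axioms]) (use assms in \<open>simp add: quotients_of_def\<close>)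

lemma bij_flag_to_quotient:
  "bij_betw (flag_to_quotient h J p) (fibre h n J p) (proj_quotients h (ideal_fibre J p))"
proof -
  have "bij_betw (flag_to_quotient h J p \<circ> (\<lambda>K. (preimage K, JA))) (quotients_of d) (proj_quotients h (ideal_fibre J p))"
    using proj_quotients_vec[OF V.free_base_change_axioms]
    by (rule bij_betw_cong[THEN iffD1, rotated]) (simp add: flag_to_quotient_preimage)
  then show ?thesis using bij_betw_comp_iff[OF bij_betw_preimage] by blast
qed

lemma dual_base_change: "free_base_change (dual_module (ideal_fibre J p)) V.functional d h"
  by (intro free_base_change.intro V.free_presentation_dual h)

lemma bij_flag_to_line:
  "bij_betw (flag_to_line h J p) (fibre h n J p) (proj_lines h (dual_module (ideal_fibre J p)))"
proof -
  have "bij_betw ((`) (tensor_vec h (dual_module (ideal_fibre J p)) (\<lambda>i. V.functional (unitv i)) d) \<circ> perp d)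
      (quotients_of d) (proj_lines h (dual_module (ideal_fibre J p)))"
    using bij_betw_perp proj_lines_vec[OF dual_base_change] by (rule bij_betw_trans)
  then have "bij_betw (flag_to_line h J p \<circ> (\<lambda>K. (preimage K, JA))) (quotients_of d)
      (proj_lines h (dual_module (ideal_fibre J p)))"
    by (rule bij_betw_cong[THEN iffD1, rotated]) (simp add: flag_to_line_preimage)
  then show ?thesis using bij_betw_comp_iff[OF bij_betw_preimage] by blast
qed

end

section \<open>Naturality and conclusion\<close>

text \<open>The extension of \<open>I\<close> along \<open>f\<close> contains the extension of \<open>\<mm>J\<close>, so it is the preimage of its image under
  \<open>Lam\<close>; and \<open>Lam\<close> commutes with \<open>f\<close>.\<close>

lemma pull_flag_preimage:
  assumes A: "fibre_over J p n e cf d b lam h" and f: "comm_ring_hom f"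
    and K: "vec.subspace K" "K \<subseteq> vecs d"
  shows "pull_flag f (fibre_over.preimage J d lam h K, extend_ideal h J)
    = (fibre_over.preimage J d lam (f \<circ> h) (vec.span ((\<circ>) f ` K)), extend_ideal (f \<circ> h) J)"
proof -
  interpret A: fibre_over J p n e cf d b lam h by fact
  have comp: "comm_ring_hom (f \<circ> h)" by (rule comm_ring_hom_comp[OF f A.h])
  interpret B: fibre_over J p n e cf d b lam "f \<circ> h"
    by (intro fibre_over.intro A.fibre_basis_axioms comp)
  have image_comp: "map_coeffs (f \<circ> h) ` S = map_coeffs f ` map_coeffs h ` S" for S
    unfolding image_image by (intro image_cong refl map_coeffs_comp[OF f A.h])
  have JA: "extend_ideal f A.JA = B.JA"
    using extend_ideal_span[OF f A.JA] unfolding A.JA_span B.JA_span span_push[OF f] image_comp .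
  define I where "I = pp.span (map_coeffs f ` A.preimage K)"
  have I: "extend_ideal f (A.preimage K) = I"
    unfolding I_def by (rule extend_ideal_span[OF f A.preimage_ideal[OF K(1)]])
  have "B.mJA = pp.span (map_coeffs f ` A.mJA)"
    unfolding span_push[OF f] image_comp ..
  also have "\<dots> \<subseteq> I" unfolding I_def by (intro pp.span_mono image_mono A.mJA_preimage[OF K(1)])
  finally have mI: "B.mJA \<subseteq> I" .
  have "I \<subseteq> pp.span (map_coeffs f ` A.JA)"
    unfolding I_def by (intro pp.span_mono image_mono) (auto simp: A.preimage_def)
  then have IJ: "I \<subseteq> B.JA" using JA extend_ideal_span[OF f A.JA] by simp
  have Lam_I: "A.Lam (f \<circ> h) ` I = vec.span ((\<circ>) f ` K)"
  proof -
    have "A.Lam (f \<circ> h) ` I = vec.span (A.Lam (f \<circ> h) ` map_coeffs f ` A.preimage K)"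
      unfolding I_def by (rule module_hom.span_image[OF A.Lam_hom, symmetric])
    also have "A.Lam (f \<circ> h) ` map_coeffs f ` A.preimage K = (\<circ>) f ` A.Lam h ` A.preimage K"
      unfolding image_image by (intro image_cong refl A.Lam_push[OF f])
    finally show ?thesis unfolding A.Lam_preimage[OF K(2)] .
  qed
  have "I = B.preimage (A.Lam (f \<circ> h) ` I)"
    by (rule B.preimage_Lam[OF _ mI IJ, symmetric]) (simp add: I_def)
  then show ?thesis by (simp add: pull_flag_def I JA Lam_I)
qed

theorem proposition5p10:
  fixes n :: nat and J :: "complex poly poly set" and p :: "complex \<times> complex"
    and \<iota> :: "complex \<Rightarrow> 'a::comm_ring_1" and f :: "'a \<Rightarrow> 'b::comm_ring_1"
  assumes J: "J \<in> hilb_closed_points n"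
    and \<iota>: "\<iota> \<in> ring_hom rng rng"
    and f: "f \<in> ring_hom rng rng"
  shows
    "\<comment> \<open>\<open>J(p) \<cong> J/\<mm>\<^sub>p J\<close>\<close>
     (\<exists>\<psi>. module_iso \<psi> (quotient_module (as_module const2 J) (ideal_prod rng (max_ideal p) J))
             (ideal_fibre J p) \<and>
          (\<forall>g\<in>J. \<psi> (a_r_coset (as_module const2 J :: (complex, _) module)
             (ideal_prod rng (max_ideal p) J) g) = restrict_to_fibre J p g)) \<and>
     \<comment> \<open>the fibre is the projective space of lines in the dual of \<open>J(p)\<close>\<close>
     bij_betw (flag_to_line \<iota> J p) (fibre \<iota> n J p)
       (proj_lines \<iota> (dual_module (ideal_fibre J p))) \<and>
     \<comment> \<open>equivalently, the projective space of one-dimensional quotients of \<open>J(p)\<close>\<close>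
     bij_betw (flag_to_quotient \<iota> J p) (fibre \<iota> n J p)
       (proj_quotients \<iota> (ideal_fibre J p)) \<and>
     \<comment> \<open>naturally in the algebra\<close>
     (\<forall>Q \<in> fibre \<iota> n J p.
        pull_flag f Q \<in> fibre (f \<circ> \<iota>) n J p \<and>
        flag_to_line (f \<circ> \<iota>) J p (pull_flag f Q) =
          pull_submodule \<iota> f (dual_module (ideal_fibre J p)) (flag_to_line \<iota> J p Q) \<and>
        flag_to_quotient (f \<circ> \<iota>) J p (pull_flag f Q) =
          pull_submodule \<iota> f (ideal_fibre J p) (flag_to_quotient \<iota> J p Q))"
proof -
  have h: "comm_ring_hom \<iota>" and f': "comm_ring_hom f" using \<iota> f by (simp_all add: comm_ring_hom_rng)
  obtain e cf where ideal: "rg.subspace J" and cf: "\<And>i. i < n \<Longrightarrow> module_hom pscale (*) (cf i)"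
      "\<And>i g. i < n \<Longrightarrow> g \<in> J \<Longrightarrow> cf i g = 0"
      "\<And>i j. i < n \<Longrightarrow> j < n \<Longrightarrow> cf i (e j) = (if i = j then 1 else 0)"
      "\<And>r. r - (\<Sum>i<n. pscale (cf i r) (e i)) \<in> J"
    by (rule colength_basis[OF J]) (rule that)
  interpret C: colength_ideal J p n e cf
    by (intro colength_ideal.intro ideal_at_point.intro colength_ideal_axioms.intro ideal cf)
  obtain d b lam where "fibre_basis J p n e cf d b lam"
  proof (rule C.fibre_basis_exists)
    fix d :: nat and b and lam :: "nat \<Rightarrow> complex poly poly \<Rightarrow> complex"
    assume "\<And>i. i < d \<Longrightarrow> module_hom pscale (*) (lam i)" "\<And>i. i < d \<Longrightarrow> b i \<in> J"
      "\<And>i j. i < d \<Longrightarrow> j < d \<Longrightarrow> lam i (b j) = (if i = j then 1 else 0)"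
      "\<And>i g. i < d \<Longrightarrow> g \<in> C.mJ \<Longrightarrow> lam i g = 0"
      "\<And>g. g \<in> J \<Longrightarrow> g - (\<Sum>i<d. pscale (lam i g) (b i)) \<in> C.mJ"
    then have "fibre_basis J p n e cf d b lam"
      by (intro fibre_basis.intro C.colength_ideal_axioms fibre_basis_axioms.intro)
    then show thesis by (rule that)
  qed
  then interpret F: fibre_basis J p n e cf d b lam .
  interpret A: fibre_over J p n e cf d b lam \<iota>
    by (intro fibre_over.intro F.fibre_basis_axioms h)
  have comp: "comm_ring_hom (f \<circ> \<iota>)" by (rule comm_ring_hom_comp[OF f' h])
  interpret B: fibre_over J p n e cf d b lam "f \<circ> \<iota>"
    by (intro fibre_over.intro F.fibre_basis_axioms comp)
  let ?V = "ideal_fibre J p"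
  show ?thesis
  proof (intro conjI ballI)
    show "\<exists>\<psi>. module_iso \<psi> (quotient_module (as_module const2 J) (ideal_prod rng (max_ideal p) J)) ?V \<and>
          (\<forall>g\<in>J. \<psi> (a_r_coset (as_module const2 J :: (complex, _) module)
             (ideal_prod rng (max_ideal p) J) g) = restrict_to_fibre J p g)"
      by (rule module_iso_of_presentations[OF C.presentation_quotient_mJ C.presentation_fibre])
    show "bij_betw (flag_to_line \<iota> J p) (fibre \<iota> n J p) (proj_lines \<iota> (dual_module ?V))"
      by (rule A.bij_flag_to_line)
    show "bij_betw (flag_to_quotient \<iota> J p) (fibre \<iota> n J p) (proj_quotients \<iota> ?V)"
      by (rule A.bij_flag_to_quotient)
    fix Q assume "Q \<in> fibre \<iota> n J p"
    then obtain K where K: "K \<in> quotients_of d" "Q = (A.preimage K, A.JA)"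
      unfolding A.fibre_eq by blast
    then have sub: "vec.subspace K" "K \<subseteq> vecs d" by (simp_all add: quotients_of_def)
    define KB where "KB = vec.span ((\<circ>) f ` K)"
    have dp: "dual_pair d KB (vec.span ((\<circ>) f ` perp d K))"
      unfolding KB_def using K(1) by (intro dual_pair_push[OF f']) (simp add: quotients_of_iff)
    have perp: "perp d KB = vec.span ((\<circ>) f ` perp d K)" using dual_pair_perp(1)[OF dp] by simp
    then have KB: "KB \<in> quotients_of d" using dp by (simp add: quotients_of_iff)
    have pull: "pull_flag f Q = (B.preimage KB, B.JA)"
      unfolding K(2) KB_def by (rule pull_flag_preimage[OF A.fibre_over_axioms f' sub])
    show "pull_flag f Q \<in> fibre (f \<circ> \<iota>) n J p"
      unfolding pull B.fibre_eq using KB by (rule imageI)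
    show "flag_to_quotient (f \<circ> \<iota>) J p (pull_flag f Q) = pull_submodule \<iota> f ?V (flag_to_quotient \<iota> J p Q)"
      unfolding pull unfolding K(2) B.flag_to_quotient_preimage[OF KB] A.flag_to_quotient_preimage[OF K(1)]
        pull_submodule_vec[OF A.V.free_base_change_axioms f' sub(2)] unfolding KB_def ..
    have "perp d K \<subseteq> vecs d" by (auto simp: perp_def)
    from pull_submodule_vec[OF A.dual_base_change f' this]
    show "flag_to_line (f \<circ> \<iota>) J p (pull_flag f Q) = pull_submodule \<iota> f (dual_module ?V) (flag_to_line \<iota> J p Q)"
      unfolding pull unfolding K(2) B.flag_to_line_preimage[OF KB] A.flag_to_line_preimage[OF K(1)] perp by simp
  qed
qed

end
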